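(* Given an $n$-vertex graph $G$ with distance to outerplanar $k$, MinPOHPP and MinPOHCP can be solved on $G$ in $n^{O(k)}$ time.
   Context: A graph is outerplanar if it has a crossing-free plane embedding with all vertices on the outer face. The distance to outerplanar of $G$ is the minimum number of vertices whose deletion leaves an outerplanar graph. A partial order $\pi$ on $V(G)$ is a reflexive, antisymmetric, transitive relation. An ordered Hamiltonian path $(v_1,\dots,v_n)$ (each vertex exactly once, consecutive vertices adjacent) is $\pi$-extending if $(v_i,v_j)\in\pi$ implies $i\le j$. MinPOHPP: given $G$, a partial order $\pi$ on $V(G)$ and edge costs $c:E(G)\to\mathbb{R}$, find a $\pi$-extending ordered Hamiltonian path of minimum total cost (or report none exists). MinPOHCP: the same for $\pi$-extending ordered Hamiltonian paths $(v_1,\dots,v_n)$ with $v_1v_n\in E(G)$, with the cost including the edge $v_nv_1$. *)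

theory Defs
  imports "HOL-Analysis.Analysis"
begin

section \<open>Outerplanar graphs and distance to outerplanar\<close>

definition sgraph :: "'a set \<Rightarrow> 'a set set \<Rightarrow> bool" where
  "sgraph V E \<longleftrightarrow> finite V \<and> E \<subseteq> {e. e \<subseteq> V \<and> card e = 2}"

text \<open>The vertex \<open>v\<close> is drawn as the point \<open>p v\<close> and the edge \<open>e\<close> as the arc \<open>g e\<close>.  The
  last two conditions say that the interior of an arc contains no vertex and no point of
  another arc.  As in the library's Jordan curve theorem, the plane is the type of complex
  numbers.\<close>

definition plane_embedding ::
    "'a set \<Rightarrow> 'a set set \<Rightarrow> ('a \<Rightarrow> complex) \<Rightarrow> ('a set \<Rightarrow> real \<Rightarrow> complex) \<Rightarrow> bool" where
  "plane_embedding V E p g \<longleftrightarrow>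
     inj_on p V \<and>
     (\<forall>e\<in>E. arc (g e) \<and> {pathstart (g e), pathfinish (g e)} = p ` e) \<and>
     (\<forall>e\<in>E. path_image (g e) \<inter> p ` V = p ` e) \<and>
     (\<forall>e\<in>E. \<forall>f\<in>E. e \<noteq> f \<longrightarrow> path_image (g e) \<inter> path_image (g f) \<subseteq> p ` V)"

definition drawing ::
    "'a set \<Rightarrow> 'a set set \<Rightarrow> ('a \<Rightarrow> complex) \<Rightarrow> ('a set \<Rightarrow> real \<Rightarrow> complex) \<Rightarrow> complex set" where
  "drawing V E p g = p ` V \<union> (\<Union>e\<in>E. path_image (g e))"

text \<open>The drawing of a finite graph is compact, so its \<^const>\<open>outside\<close> is the unique unbounded
  face; a vertex is on that face iff it belongs to the boundary of the face.\<close>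

definition outerplanar :: "'a set \<Rightarrow> 'a set set \<Rightarrow> bool" where
  "outerplanar V E \<longleftrightarrow>
     (\<exists>p g. plane_embedding V E p g \<and> (\<forall>v\<in>V. p v \<in> frontier (outside (drawing V E p g))))"

definition distance_to_outerplanar :: "'a set \<Rightarrow> 'a set set \<Rightarrow> nat" where
  "distance_to_outerplanar V E =
     (LEAST k. \<exists>S\<subseteq>V. card S = k \<and> outerplanar (V - S) {e\<in>E. e \<inter> S = {}})"

lemma distance_to_outerplanar_attained:
  fixes V :: "'a set"
  assumes "sgraph V E"
  shows "\<exists>S\<subseteq>V. card S = distance_to_outerplanar V E \<and> outerplanar (V - S) {e\<in>E. e \<inter> S = {}}"
proof -
  have "e \<inter> V \<noteq> {}" if "e \<in> E" for e
  proof -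
    have "e \<subseteq> V" "card e = 2"
      using assms that by (auto simp: sgraph_def)
    then show ?thesis
      by (metis card.empty inf.absorb1 zero_neq_numeral)
  qed
  then have "{e\<in>E. e \<inter> V = {}} = {}"
    by blast
  moreover have "outerplanar ({} :: 'a set) {}"
    by (simp add: outerplanar_def plane_embedding_def)
  ultimately have "outerplanar (V - V) {e\<in>E. e \<inter> V = {}}"
    by (simp only: Diff_cancel)
  then have "\<exists>k. \<exists>S\<subseteq>V. card S = k \<and> outerplanar (V - S) {e\<in>E. e \<inter> S = {}}"
    by blast
  then show ?thesis
    unfolding distance_to_outerplanar_def by (rule LeastI_ex)
qed


section \<open>Ordered Hamiltonian paths extending a partial order\<close>

definition ordered_ham_path :: "'a set \<Rightarrow> 'a set set \<Rightarrow> 'a list \<Rightarrow> bool" where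
  "ordered_ham_path V E vs \<longleftrightarrow>
     distinct vs \<and> set vs = V \<and> (\<forall>i. Suc i < length vs \<longrightarrow> {vs ! i, vs ! Suc i} \<in> E)"

definition extending :: "('a \<times> 'a) set \<Rightarrow> 'a list \<Rightarrow> bool" where
  "extending \<pi> vs \<longleftrightarrow>
     (\<forall>i < length vs. \<forall>j < length vs. (vs ! i, vs ! j) \<in> \<pi> \<longrightarrow> i \<le> j)"

definition POHP :: "'a set \<Rightarrow> 'a set set \<Rightarrow> ('a \<times> 'a) set \<Rightarrow> 'a list \<Rightarrow> bool" where
  "POHP V E \<pi> vs \<longleftrightarrow> ordered_ham_path V E vs \<and> extending \<pi> vs"

definition POHC :: "'a set \<Rightarrow> 'a set set \<Rightarrow> ('a \<times> 'a) set \<Rightarrow> 'a list \<Rightarrow> bool" where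
  "POHC V E \<pi> vs \<longleftrightarrow> POHP V E \<pi> vs \<and> {hd vs, last vs} \<in> E"

definition path_cost :: "('a set \<Rightarrow> real) \<Rightarrow> 'a list \<Rightarrow> real" where
  "path_cost c vs = (\<Sum>i < length vs - 1. c {vs ! i, vs ! Suc i})"

definition cycle_cost :: "('a set \<Rightarrow> real) \<Rightarrow> 'a list \<Rightarrow> real" where
  "cycle_cost c vs = path_cost c vs + c {last vs, hd vs}"


section \<open>The machine model\<close>

text \<open>
  Programs of a unit-cost real RAM in structured form.  The memory consists of cells holding
  natural numbers and cells holding real numbers.  A cell is addressed by the name of an array
  and two indices, and indices may be computed (indirect addressing); scalars and
  one-dimensional arrays use index 0 for the superfluous indices.

  The arithmetic is deliberately limited to addition, subtraction and comparison:
  unit-cost multiplication of unbounded numbers, or rounding reals, would give the machine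
  unreasonable power.  Real constants are restricted to integers so that no
  information can be hidden in them.
\<close>

datatype nexp =
    NConst nat
  | NCell string nexp nexp
  | NAdd nexp nexp
  | NSub nexp nexp

datatype rexp =
    RConst int
  | RCell string nexp nexp
  | RAdd rexp rexp
  | RSub rexp rexp

datatype bexp =
    NLess nexp nexp
  | RLess rexp rexp
  | BNot bexp
  | BAnd bexp bexp

datatype com =
    Skip
  | NAssign string nexp nexp nexp
  | RAssign string nexp nexp rexp
  | Seq com com
  | Cond bexp com com
  | While bexp com

record state =
  nmem :: "string \<Rightarrow> nat \<Rightarrow> nat \<Rightarrow> nat"
  rmem :: "string \<Rightarrow> nat \<Rightarrow> nat \<Rightarrow> real"

primrec nval :: "nexp \<Rightarrow> state \<Rightarrow> nat" where
  "nval (NConst m) s = m"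
| "nval (NCell x a b) s = nmem s x (nval a s) (nval b s)"
| "nval (NAdd a b) s = nval a s + nval b s"
| "nval (NSub a b) s = nval a s - nval b s"

primrec rval :: "rexp \<Rightarrow> state \<Rightarrow> real" where
  "rval (RConst m) s = of_int m"
| "rval (RCell x a b) s = rmem s x (nval a s) (nval b s)"
| "rval (RAdd a b) s = rval a s + rval b s"
| "rval (RSub a b) s = rval a s - rval b s"

primrec bval :: "bexp \<Rightarrow> state \<Rightarrow> bool" where
  "bval (NLess a b) s \<longleftrightarrow> nval a s < nval b s"
| "bval (RLess a b) s \<longleftrightarrow> rval a s < rval b s"
| "bval (BNot b) s \<longleftrightarrow> \<not> bval b s"
| "bval (BAnd a b) s \<longleftrightarrow> bval a s \<and> bval b s"

definition upd_cell ::
    "(string \<Rightarrow> nat \<Rightarrow> nat \<Rightarrow> 'v) \<Rightarrow> string \<Rightarrow> nat \<Rightarrow> nat \<Rightarrow> 'v \<Rightarrow> string \<Rightarrow> nat \<Rightarrow> nat \<Rightarrow> 'v" where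
  "upd_cell m x i j v = m(x := (m x)(i := (m x i)(j := v)))"

text \<open>\<open>exec c s t s'\<close>: started in \<open>s\<close>, the program \<open>c\<close> halts in state \<open>s'\<close> after \<open>t\<close> steps.  Every
  assignment and every evaluation of a test is one step.  The expressions are part of the fixed
  program text, so charging for each operation inside them changes \<open>t\<close> only by a
  constant factor.\<close>

inductive exec :: "com \<Rightarrow> state \<Rightarrow> nat \<Rightarrow> state \<Rightarrow> bool" where
  exec_Skip: "exec Skip s 1 s"
| exec_NAssign:
    "exec (NAssign x a b e) s 1
       (s\<lparr>nmem := upd_cell (nmem s) x (nval a s) (nval b s) (nval e s)\<rparr>)"
| exec_RAssign:
    "exec (RAssign x a b e) s 1
       (s\<lparr>rmem := upd_cell (rmem s) x (nval a s) (nval b s) (rval e s)\<rparr>)"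
| exec_Seq: "exec c\<^sub>1 s t\<^sub>1 s' \<Longrightarrow> exec c\<^sub>2 s' t\<^sub>2 s'' \<Longrightarrow> exec (Seq c\<^sub>1 c\<^sub>2) s (t\<^sub>1 + t\<^sub>2) s''"
| exec_CondTrue: "bval b s \<Longrightarrow> exec c\<^sub>1 s t s' \<Longrightarrow> exec (Cond b c\<^sub>1 c\<^sub>2) s (1 + t) s'"
| exec_CondFalse: "\<not> bval b s \<Longrightarrow> exec c\<^sub>2 s t s' \<Longrightarrow> exec (Cond b c\<^sub>1 c\<^sub>2) s (1 + t) s'"
| exec_WhileFalse: "\<not> bval b s \<Longrightarrow> exec (While b c) s 1 s"
| exec_WhileTrue:
    "bval b s \<Longrightarrow> exec c s t\<^sub>1 s' \<Longrightarrow> exec (While b c) s' t\<^sub>2 s'' \<Longrightarrow>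
     exec (While b c) s (1 + t\<^sub>1 + t\<^sub>2) s''"

inductive_cases exec_SkipE: "exec Skip s t s'"
inductive_cases exec_NAssignE: "exec (NAssign x a b e) s t s'"
inductive_cases exec_RAssignE: "exec (RAssign x a b e) s t s'"
inductive_cases exec_SeqE: "exec (Seq c\<^sub>1 c\<^sub>2) s t s'"
inductive_cases exec_CondE: "exec (Cond b c\<^sub>1 c\<^sub>2) s t s'"
inductive_cases exec_WhileE: "exec (While b c) s t s'"

lemma exec_deterministic:
  "exec c s t s' \<Longrightarrow> exec c s u s'' \<Longrightarrow> u = t \<and> s'' = s'"
proof (induction arbitrary: u s'' rule: exec.induct)
  case (exec_Skip s)
  then show ?case by (rule exec_SkipE) simp
next
  case (exec_NAssign x a b e s)
  then show ?case by (rule exec_NAssignE) simp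
next
  case (exec_RAssign x a b e s)
  then show ?case by (rule exec_RAssignE) simp
next
  case (exec_Seq c\<^sub>1 s t\<^sub>1 s' c\<^sub>2 t\<^sub>2 s2)
  from exec_Seq.prems show ?case
  proof (rule exec_SeqE)
    fix v r w
    assume u: "u = v + w" and 1: "exec c\<^sub>1 s v r" and 2: "exec c\<^sub>2 r w s''"
    from exec_Seq.IH(1)[OF 1] have "v = t\<^sub>1" "r = s'" by simp_all
    with exec_Seq.IH(2) 2 u show ?thesis by simp
  qed
next
  case (exec_CondTrue b s c\<^sub>1 t s' c\<^sub>2)
  from exec_CondTrue.prems exec_CondTrue.hyps(1) exec_CondTrue.IH show ?case
    by (auto elim!: exec_CondE)
next
  case (exec_CondFalse b s c\<^sub>2 t s' c\<^sub>1)
  from exec_CondFalse.prems exec_CondFalse.hyps(1) exec_CondFalse.IH show ?case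
    by (auto elim!: exec_CondE)
next
  case (exec_WhileFalse b s c)
  from exec_WhileFalse.prems show ?case
    by (rule exec_WhileE) (use exec_WhileFalse.hyps in simp_all)
next
  case (exec_WhileTrue b s c t\<^sub>1 s' t\<^sub>2 s2)
  from exec_WhileTrue.prems show ?case
  proof (rule exec_WhileE)
    assume "\<not> bval b s"
    with exec_WhileTrue.hyps(1) show ?thesis by simp
  next
    fix v r w
    assume u: "u = Suc (v + w)" and 1: "exec c s v r" and 2: "exec (While b c) r w s''"
    from exec_WhileTrue.IH(1)[OF 1] have "v = t\<^sub>1" "r = s'" by simp_all
    with exec_WhileTrue.IH(2) 2 u show ?thesis by simp
  qed
qed


section \<open>Input and output of the algorithms\<close>

text \<open>An instance has the vertices \<open>0, \<dots>, n - 1\<close>.  The graph and the partial order are given by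
  0/1-matrices, the costs by a matrix of reals.  Neither the distance to outerplanar nor a
  deletion set is part of the input.\<close>

definition input_state ::
    "nat \<Rightarrow> nat set set \<Rightarrow> (nat \<times> nat) set \<Rightarrow> (nat set \<Rightarrow> real) \<Rightarrow> state" where
  "input_state n E \<pi> c =
     \<lparr>nmem = (\<lambda>x i j.
         if x = ''n'' \<and> i = 0 \<and> j = 0 then n
         else if x = ''edge'' \<and> {i, j} \<in> E then 1
         else if x = ''order'' \<and> (i, j) \<in> \<pi> then 1
         else 0),
      rmem = (\<lambda>x i j. if x = ''cost'' \<and> {i, j} \<in> E then c {i, j} else 0)\<rparr>"

text \<open>\<open>P\<close> holds for the feasible solutions and \<open>w\<close> is the objective.  The cell \<open>found\<close> tells whether a
  feasible solution exists; if so, the first \<open>n\<close> cells of \<open>path\<close> list an optimal one.\<close>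

definition correct_output ::
    "nat \<Rightarrow> (nat list \<Rightarrow> bool) \<Rightarrow> (nat list \<Rightarrow> real) \<Rightarrow> state \<Rightarrow> bool" where
  "correct_output n P w s \<longleftrightarrow>
     (if \<exists>vs. P vs
      then nmem s ''found'' 0 0 = 1 \<and>
           is_arg_min w P (map (\<lambda>i. nmem s ''path'' 0 i) [0..<n])
      else nmem s ''found'' 0 0 = 0)"

end

theory Submission
  imports Defs "HOL-Complex_Analysis.Complex_Analysis" "HOL-Library.Sublist" "HOL-Library.Nat_Bijection"
begin

text \<open>
  Held and Karp's dynamic program over pairs of a visited set and a last vertex is exact, and it
  stays exact when a visited set \<open>X\<close> is expanded only if deleting \<open>T\<close> from the graph induced by the
  unvisited vertices leaves at most \<open>card T + 1\<close> components: the remainder of a Hamiltonian path,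
  cut at the vertices of \<open>T\<close>, has at most that many pieces.  The same holds for \<open>X\<close> itself, as it is
  traversed by a path.  If \<open>T\<close> leaves an outerplanar graph, then the remaining vertices have a linear
  order without crossing edges, in which disjoint connected sets do not interleave; hence the at most
  \<open>2 * (card T + 1)\<close> components are determined by their first and last elements, a vertex belonging to the
  innermost interval around it, and only \<open>n\<^sup>O\<^sup>(\<^sup>k\<^sup>)\<close> sets \<open>X\<close> survive.  Neither \<open>T\<close> nor \<open>k\<close> is known, so
  round \<open>r\<close> runs the search with the \<open>r\<close>-th candidate for \<open>T\<close> and gives up after about \<open>r\<close> states;
  every nonempty \<open>T\<close> recurs in the enumeration, and the first search that finishes is correct.

  The noncrossing order comes from the Jordan curve theorem: no vertex lies inside a cycle of the
  drawing, which excludes subdivisions of the complete bipartite graph on \<open>2 + 3\<close> vertices and crossing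
  chords of a cycle.  In a connected graph without a cut vertex a longest cycle is then Hamiltonian,
  and smaller pieces are glued at cut vertices.
\<close>

section \<open>Theta curves in the plane\<close>

text \<open>The machine cannot recognise a deletion set, so exactness is kept apart from efficiency.
  The pruning condition is necessary for the prefixes of every Hamiltonian path and for every
  \<open>T\<close>; outerplanarity only bounds how many sets pass it. A search that exhausts its
  queue is thus right whatever its \<open>T\<close> was, and a search is certain to finish once its
  number \<open>r\<close> reaches the bound for its own \<open>T\<close>. This is why a suitable
  \<open>T\<close> has to recur at an index that is large enough and yet not much larger than the
  bound. The empty set has the single index 0; a singleton stands in for it, whence
  \<open>max 1\<close> in the exponent.

  States are compared by visited set, last vertex and first vertex. The first vertex is kept for the
  edge that closes a cycle, so one search serves both problems. As the machine only adds, subtracts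
  and compares, a visited set becomes a number that grows by a tabulated power of 2, and the
  candidates for \<open>T\<close> are numbered so that each arises from an earlier row by inserting
  one vertex, without any division.\<close>

definition lens :: "(real \<Rightarrow> complex) \<Rightarrow> (real \<Rightarrow> complex) \<Rightarrow> complex \<Rightarrow> complex \<Rightarrow> bool" where
  "lens c d a b \<longleftrightarrow> arc c \<and> arc d \<and> pathstart c = a \<and> pathfinish c = b \<and>
     pathstart d = a \<and> pathfinish d = b \<and> path_image c \<inter> path_image d = {a, b}"

lemma lens_sym: "lens c d a b \<Longrightarrow> lens d c a b"
  by (auto simp: lens_def)

lemma lens_simple_path:
  assumes "lens c d a b"
  shows "simple_path (c +++ reversepath d)"
    and "pathfinish (c +++ reversepath d) = pathstart (c +++ reversepath d)"
    and "path_image (c +++ reversepath d) = path_image c \<union> path_image d"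
  using assms
  by (auto simp: lens_def path_image_join arc_reversepath intro!: simple_path_join_loop)

lemma lens_inside:
  assumes "lens c d a b"
  shows "connected (inside (path_image c \<union> path_image d))"
    and "inside (path_image c \<union> path_image d) \<noteq> {}"
    and "frontier (inside (path_image c \<union> path_image d)) = path_image c \<union> path_image d"
  using Jordan_inside_outside [OF lens_simple_path(1,2) [OF assms]] lens_simple_path(3) [OF assms]
  by auto

lemma lens_closure_inside:
  assumes "lens c d a b"
  shows "closure (inside (path_image c \<union> path_image d)) \<subseteq>
         inside (path_image c \<union> path_image d) \<union> (path_image c \<union> path_image d)"
  using lens_inside(3) [OF assms] by (auto simp: closure_Un_frontier)

lemma lens_closed:
  assumes "lens c d a b"
  shows "closed (path_image c \<union> path_image d)"
  using assms by (auto simp: lens_def closed_arc_image)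

text \<open>The winding number of the closed curve is the difference of those of the two arcs; it
  has modulus 1 inside and is 0 outside. Written as an inequality between arcs, being inside can be
  compared across the three curves of a theta graph.\<close>

lemma lens_winding:
  assumes "lens c d a b" and z: "z \<notin> path_image c" "z \<notin> path_image d"
  shows "z \<in> inside (path_image c \<union> path_image d) \<longleftrightarrow> winding_number c z \<noteq> winding_number d z"
proof -
  let ?g = "c +++ reversepath d"
  have p: "path c" "path d" using assms by (auto simp: lens_def arc_imp_path)
  have w: "winding_number ?g z = winding_number c z - winding_number d z"
    using assms p by (subst winding_number_join) (auto simp: winding_number_reversepath lens_def)
  note sp = lens_simple_path [OF assms(1)]
  show ?thesis
  proof
    assume "z \<in> inside (path_image c \<union> path_image d)"
    then have "norm (winding_number ?g z) = 1"
      using simple_closed_path_norm_winding_number_inside sp by metis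
    then show "winding_number c z \<noteq> winding_number d z" unfolding w by (metis diff_self norm_zero zero_neq_one)
  next
    assume ne: "winding_number c z \<noteq> winding_number d z"
    show "z \<in> inside (path_image c \<union> path_image d)"
    proof (rule ccontr)
      assume n: "z \<notin> inside (path_image c \<union> path_image d)"
      have "z \<in> - (path_image c \<union> path_image d)" using z by blast
      then have "z \<in> inside (path_image c \<union> path_image d) \<union> outside (path_image c \<union> path_image d)"
        by (simp only: inside_Un_outside)
      then have "z \<in> outside (path_image ?g)"
        using n unfolding sp(3) by blast
      then have "winding_number ?g z = 0"
        using sp(1,2) by (intro winding_number_zero_in_outside simple_path_imp_path)
      with w ne show False by simp
    qed
  qed
qed

lemma connected_subset_inside:
  fixes S :: "complex set"
  assumes "connected C" "C \<inter> S = {}" "closed S" "z \<in> C" "z \<in> inside S"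
  shows "C \<subseteq> inside S"
proof (rule ccontr)
  assume "\<not> C \<subseteq> inside S"
  then obtain y where y: "y \<in> C" "y \<notin> inside S" by blast
  have cov: "C \<subseteq> inside S \<union> outside S" using assms(2) inside_Un_outside [of S] by auto
  have "open (inside S)" "open (outside S)" using assms(3) by (auto intro: open_inside open_outside)
  moreover have "inside S \<inter> outside S = {}" by (rule inside_Int_outside)
  moreover have "y \<in> outside S" using y cov by blast
  ultimately show False
    using connectedD [OF assms(1), of "inside S" "outside S"] cov assms y by blast
qed

text \<open>The last claim carries a containment of the open arc in a region over to the end points,
  by taking closures.\<close>

lemma lens_arc_interior:
  assumes "arc c" "pathstart c = a" "pathfinish c = b"
  shows "connected (path_image c - {a, b})" "path_image c - {a, b} \<noteq> {}"
    "path_image c \<subseteq> closure (path_image c - {a, b})"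
proof -
  have s: "simple_path c" using assms arc_imp_simple_path by blast
  show "connected (path_image c - {a, b})" "path_image c - {a, b} \<noteq> {}"
    using connected_simple_path_endless [OF s] nonempty_simple_path_endless [OF s] assms by auto
  have "path_image c - {a,b} = c ` {0<..<1}"
    using simple_path_endless [OF s] assms by simp
  moreover have "c ` closure {0<..<1} \<subseteq> closure (c ` {0<..<1})"
    using assms by (intro image_closure_subset)
      (auto simp: arc_def path_def closure_subset)
  ultimately show "path_image c \<subseteq> closure (path_image c - {a, b})"
    by (simp add: path_image_def)
qed

text \<open>Otherwise every open arc avoids the inside of the curve formed by the other two. A point
  inside one of the three curves is then inside a second one, which forces these two curves to
  coincide.\<close>

lemma theta_curve_inside:
  assumes L: "lens c1 c2 a b" "lens c2 c3 a b" "lens c1 c3 a b"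
  shows "path_image c1 - {a, b} \<subseteq> inside (path_image c2 \<union> path_image c3) \<or>
         path_image c2 - {a, b} \<subseteq> inside (path_image c1 \<union> path_image c3) \<or>
         path_image c3 - {a, b} \<subseteq> inside (path_image c1 \<union> path_image c2)"
proof (rule ccontr)
  assume neg: "\<not> ?thesis"
  \<comment> \<open>Both insides are connected and each misses the boundary of the other, so sharing
    \<open>z\<close> makes them equal. Equal frontiers leave no place for the interior of the arc
    \<open>x\<close>.\<close>
  have key: False
    if A: "lens x y a b" "lens y w a b" "lens x w a b"
      and ox: "(path_image x - {a,b}) \<inter> inside (path_image y \<union> path_image w) = {}"
      and ow: "(path_image w - {a,b}) \<inter> inside (path_image x \<union> path_image y) = {}"
      and z: "z \<in> inside (path_image x \<union> path_image y)" "z \<in> inside (path_image y \<union> path_image w)"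
    for x y w z
  proof -
    have ab: "a \<in> path_image y" "b \<in> path_image y" using A(1) by (auto simp: lens_def)
    have 1: "inside (path_image x \<union> path_image y) \<inter> (path_image y \<union> path_image w) = {}"
    proof (intro equals0I, elim IntE)
      fix t assume t: "t \<in> inside (path_image x \<union> path_image y)" "t \<in> path_image y \<union> path_image w"
      then have "t \<notin> path_image x \<union> path_image y" by (auto simp: inside_def)
      then show False using ow ab t by blast
    qed
    have 2: "inside (path_image y \<union> path_image w) \<inter> (path_image x \<union> path_image y) = {}"
    proof (intro equals0I, elim IntE)
      fix t assume t: "t \<in> inside (path_image y \<union> path_image w)" "t \<in> path_image x \<union> path_image y"
      then have "t \<notin> path_image y \<union> path_image w" by (auto simp: inside_def)
      then show False using ox ab t by blast
    qed
    have "inside (path_image x \<union> path_image y) = inside (path_image y \<union> path_image w)"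
      using connected_subset_inside [OF lens_inside(1) [OF A(1)] 1 lens_closed [OF A(2)] z]
        connected_subset_inside [OF lens_inside(1) [OF A(2)] 2 lens_closed [OF A(1)] z(2,1)]
      by blast
    then have "path_image x \<union> path_image y = path_image y \<union> path_image w"
      using lens_inside(3) [OF A(1)] lens_inside(3) [OF A(2)] by metis
    moreover have "path_image x \<inter> path_image y = {a, b}" "path_image x \<inter> path_image w = {a, b}"
      using A(1,3) by (simp_all add: lens_def)
    ultimately have "path_image x \<subseteq> {a,b}" by blast
    then show False using lens_arc_interior(2) [of x a b] A(1) by (auto simp: lens_def)
  qed
  have out: "(path_image x - {a,b}) \<inter> inside (path_image y \<union> path_image w) = {}"
    if "lens x y a b" "lens y w a b" "lens x w a b"
      "\<not> path_image x - {a,b} \<subseteq> inside (path_image y \<union> path_image w)" for x y w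
  proof -
    have c: "connected (path_image x - {a,b})"
      using lens_arc_interior(1) [of x a b] that by (auto simp: lens_def)
    have d: "(path_image x - {a,b}) \<inter> (path_image y \<union> path_image w) = {}"
      using that(1,3) unfolding lens_def by blast
    show ?thesis using connected_subset_inside [OF c d lens_closed [OF that(2)]] that(4) by blast
  qed
  have o1: "(path_image c1 - {a,b}) \<inter> inside (path_image c2 \<union> path_image c3) = {}"
    using out [of c1 c2 c3] L neg by blast
  have o2: "(path_image c2 - {a,b}) \<inter> inside (path_image c1 \<union> path_image c3) = {}"
    using out [of c2 c1 c3] L neg lens_sym by blast
  have o3: "(path_image c3 - {a,b}) \<inter> inside (path_image c1 \<union> path_image c2) = {}"
    using out [of c3 c1 c2] L neg lens_sym by blast
  obtain z where z: "z \<in> inside (path_image c1 \<union> path_image c2)"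
    using lens_inside(2) [OF L(1)] by blast
  have z12: "z \<notin> path_image c1" "z \<notin> path_image c2" using z by (auto simp: inside_def)
  have z3: "z \<notin> path_image c3" using z o3 z12 L(2) unfolding lens_def by blast
  \<comment> \<open>The number of \<open>c3\<close> cannot agree with both of two different numbers,
    so \<open>z\<close> is inside a curve that contains \<open>c3\<close> as well.\<close>
  have "winding_number c1 z \<noteq> winding_number c2 z" using lens_winding [OF L(1) z12] z by simp
  then consider "winding_number c2 z \<noteq> winding_number c3 z" | "winding_number c1 z \<noteq> winding_number c3 z"
    by metis
  then show False
  proof cases
    case 1
    then have "z \<in> inside (path_image c2 \<union> path_image c3)"
      using lens_winding [OF L(2) z12(2) z3] by simp
    then show False using key [OF L o1 o3 z] by simp
  next
    case 2
    then have "z \<in> inside (path_image c1 \<union> path_image c3)"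
      using lens_winding [OF L(3) z12(1) z3] by simp
    then show False
      using key [OF lens_sym [OF L(1)] L(3) L(2) o2] o3 z by (simp add: Un_commute)
  qed
qed

text \<open>The winding numbers around the three closed curves add up to zero.\<close>
lemma theta_curve_inside_cases:
  assumes L: "lens c1 c2 a b" "lens c2 c3 a b" "lens c1 c3 a b"
    and z: "z \<in> inside (path_image c1 \<union> path_image c2)" "z \<notin> path_image c3"
  shows "z \<in> inside (path_image c1 \<union> path_image c3) \<or> z \<in> inside (path_image c2 \<union> path_image c3)"
proof -
  have z12: "z \<notin> path_image c1" "z \<notin> path_image c2" using z by (auto simp: inside_def)
  show ?thesis using lens_winding [OF L(1) z12] lens_winding [OF L(2) z12(2) z(2)]
     lens_winding [OF L(3) z12(1) z(2)] z(1) by metis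
qed

text \<open>The same closed curve is cut at \<open>a\<close>, \<open>b\<close> into
  \<open>c1\<close>, \<open>c2\<close> and at \<open>u\<close>, \<open>v\<close> into
  \<open>d1\<close>, \<open>d2\<close>; the chords are \<open>c\<close> and \<open>d\<close>. The
  assumptions \<open>I\<close> and \<open>I'\<close> are what outerplanarity provides: no branch
  point lies inside any of the curves.\<close>

lemma crossing_chords_inside:
  assumes L: "lens c1 c2 a b" "lens c2 c a b" "lens c1 c a b"
    and M: "lens d1 d2 u v" "lens d2 d u v" "lens d1 d u v"
    and J: "path_image c1 \<union> path_image c2 = path_image d1 \<union> path_image d2"
    and uv: "u \<in> path_image c1 - {a, b}" "v \<in> path_image c2 - {a, b}"
    and ab: "b \<in> path_image d1 - {u, v}" "a \<in> path_image d2 - {u, v}"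
    and dis: "path_image c \<inter> path_image d = {}"
    and I: "\<And>x y w. {x, y} \<subseteq> {c1, c2, c} \<Longrightarrow> w \<in> {u, v} \<Longrightarrow> w \<notin> inside (path_image x \<union> path_image y)"
    and I': "\<And>x y w. {x, y} \<subseteq> {d1, d2, d} \<Longrightarrow> w \<in> {a, b} \<Longrightarrow> w \<notin> inside (path_image x \<union> path_image y)"
  shows False
proof -
  \<comment> \<open>Of the three arcs from \<open>u\<close> to \<open>v\<close>, only the chord can
    run inside, since \<open>d1\<close> carries \<open>b\<close> and \<open>d2\<close> carries
    \<open>a\<close>.\<close>
  have "path_image d - {u, v} \<subseteq> inside (path_image d1 \<union> path_image d2)"
    using theta_curve_inside [OF M] ab I' [of d2 d b] I' [of d1 d a] by blast
  then have sub: "path_image d - {u, v} \<subseteq> inside (path_image c1 \<union> path_image c2)"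
    using J by simp
  have d: "arc d" "pathstart d = u" "pathfinish d = v" using M by (auto simp: lens_def)
  note di = lens_arc_interior [OF d]
  obtain z where z: "z \<in> path_image d - {u, v}" using di(2) by blast
  have disc: "(path_image d - {u, v}) \<inter> path_image e = {}" if "e \<in> {c1, c2, c}" for e
    using dis that sub by (auto simp: inside_def)
  \<comment> \<open>The chord \<open>c\<close> divides the inside, and the open arc \<open>d\<close>
    stays in one of the two parts. By closure both \<open>u\<close> and \<open>v\<close> lie in that
    part or on its boundary, but only one of them is on the boundary arc \<open>e\<close>; the other
    one would be inside.\<close>
  have fin: False
    if e: "e \<in> {c1, c2}" "lens e c a b" "z \<in> inside (path_image e \<union> path_image c)" for e
  proof -
    have "(path_image d - {u, v}) \<inter> (path_image e \<union> path_image c) = {}"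
      using disc [of e] disc [of c] e(1) by blast
    then have "path_image d - {u, v} \<subseteq> inside (path_image e \<union> path_image c)"
      using connected_subset_inside [OF di(1) _ lens_closed [OF e(2)]] z e by blast
    then have "path_image d \<subseteq> closure (inside (path_image e \<union> path_image c))"
      using di(3) closure_mono by blast
    then have "{u, v} \<subseteq> inside (path_image e \<union> path_image c) \<union> (path_image e \<union> path_image c)"
      using lens_closure_inside [OF e(2)] d by auto
    moreover have "u \<notin> path_image c" "v \<notin> path_image c" using dis d by auto
    moreover have "u \<notin> path_image c2" "v \<notin> path_image c1" using uv L by (auto simp: lens_def)
    ultimately show False using I [of e c u] I [of e c v] e(1) by auto
  qed
  have "z \<in> inside (path_image c1 \<union> path_image c2)" "z \<notin> path_image c"
    using sub z dis by auto
  from theta_curve_inside_cases [OF L this] fin [of c1] fin [of c2] L show False by blast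
qed

section \<open>Forbidden configurations of outerplanar graphs\<close>

fun pedges :: "'a list \<Rightarrow> 'a set set" where
  "pedges [] = {}"
| "pedges [x] = {}"
| "pedges (x # y # l) = insert {x, y} (pedges (y # l))"

lemma pedges_append: "pedges (xs @ y # ys) = pedges (xs @ [y]) \<union> pedges (y # ys)"
  by (induction xs rule: pedges.induct) auto

lemma pedges_snoc2: "pedges (xs @ [x, y]) = insert {x, y} (pedges (xs @ [x]))"
  using pedges_append [of xs x "[y]"] by simp

lemma pedges_rev: "pedges (rev l) = pedges l"
  by (induction l rule: pedges.induct) (auto simp: pedges_snoc2 insert_commute)

lemma pedges_subset: "e \<in> pedges l \<Longrightarrow> e \<subseteq> set l"
  by (induction l rule: pedges.induct) auto

lemma Union_pedges: "length l \<ge> 2 \<Longrightarrow> \<Union>(pedges l) = set l"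
proof (induction l rule: pedges.induct)
  case (3 x y l)
  then show ?case by (cases l) auto
qed auto

text \<open>Two internally disjoint walks from \<open>a\<close> to \<open>b\<close> can share only
  the edge joining their ends; this excludes it once a walk has an inner vertex.\<close>

lemma pedges_ends:
  assumes "distinct (a # L @ [b])" "L \<noteq> []"
  shows "{a, b} \<notin> pedges (a # L @ [b])"
proof -
  obtain x L' where L: "L = x # L'" using assms(2) by (cases L) auto
  have "{a, b} \<notin> pedges (x # L' @ [b])"
    using pedges_subset [of "{a, b}" "x # L' @ [b]"] assms L by auto
  moreover have "{a, b} \<noteq> {a, x}" using assms L by (auto simp: doubleton_eq_iff)
  ultimately show ?thesis using L by simp
qed

definition no_K23_subdivision :: "'a set set \<Rightarrow> bool" where
  "no_K23_subdivision E \<longleftrightarrow> \<not> (\<exists>a b L1 L2 L3. L1 \<noteq> [] \<and> L2 \<noteq> [] \<and> L3 \<noteq> [] \<and>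
     distinct (a # b # L1 @ L2 @ L3) \<and>
     pedges (a # L1 @ [b]) \<subseteq> E \<and> pedges (a # L2 @ [b]) \<subseteq> E \<and> pedges (a # L3 @ [b]) \<subseteq> E)"

definition no_crossing_chords :: "'a set set \<Rightarrow> bool" where
  "no_crossing_chords E \<longleftrightarrow> \<not> (\<exists>a b u v M1 M1' M2 M2'.
     distinct (a # M1 @ u # M1' @ b # M2 @ v # M2') \<and>
     pedges (a # M1 @ u # M1' @ b # M2 @ v # M2' @ [a]) \<subseteq> E \<and> {a, b} \<in> E \<and> {u, v} \<in> E)"

section \<open>Arcs of walks in a fixed plane drawing\<close>

context
  fixes V :: "'a set" and E :: "'a set set" and p g
  assumes emb: "plane_embedding V E p g"
    and E: "\<And>e. e \<in> E \<Longrightarrow> e \<subseteq> V \<and> card e = 2"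
begin

lemma
  shows emb_inj: "inj_on p V"
    and emb_arc: "e \<in> E \<Longrightarrow> arc (g e)"
    and emb_ends: "e \<in> E \<Longrightarrow> {pathstart (g e), pathfinish (g e)} = p ` e"
    and emb_vertices: "e \<in> E \<Longrightarrow> path_image (g e) \<inter> p ` V = p ` e"
    and emb_disjoint: "e \<in> E \<Longrightarrow> f \<in> E \<Longrightarrow> e \<noteq> f \<Longrightarrow> path_image (g e) \<inter> path_image (g f) \<subseteq> p ` V"
  using emb unfolding plane_embedding_def by simp_all

definition img :: "'a set set \<Rightarrow> complex set" where
  "img F = (\<Union>e\<in>F. path_image (g e))"

lemma img_Un: "img (F \<union> F') = img F \<union> img F'"
  by (auto simp: img_def)

text \<open>Different arcs meet only in vertices, and a vertex on an arc is one of its ends.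
  Intersections in the plane are thereby computed in the graph.\<close>

lemma img_Int:
  assumes "F \<subseteq> E" "F' \<subseteq> E" "F \<inter> F' = {}"
  shows "img F \<inter> img F' = p ` (\<Union>F \<inter> \<Union>F')"
proof
  note inj = emb_inj
  note pv = emb_vertices
  show "img F \<inter> img F' \<subseteq> p ` (\<Union>F \<inter> \<Union>F')"
  proof
    fix z assume "z \<in> img F \<inter> img F'"
    then obtain e f where ef: "e \<in> F" "f \<in> F'" "z \<in> path_image (g e)" "z \<in> path_image (g f)"
      by (auto simp: img_def)
    then have "e \<in> E" "f \<in> E" "e \<noteq> f" using assms by auto
    then have "z \<in> p ` V" using emb_disjoint [of e f] ef by blast
    then have "z \<in> p ` e" "z \<in> p ` f" using pv ef \<open>e \<in> E\<close> \<open>f \<in> E\<close> by blast+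
    moreover have "p ` e \<inter> p ` f = p ` (e \<inter> f)"
      using inj_on_image_Int [OF inj, of e f] E \<open>e \<in> E\<close> \<open>f \<in> E\<close> by blast
    ultimately show "z \<in> p ` (\<Union>F \<inter> \<Union>F')" using ef by blast
  qed
  show "p ` (\<Union>F \<inter> \<Union>F') \<subseteq> img F \<inter> img F'"
  proof
    fix z assume "z \<in> p ` (\<Union>F \<inter> \<Union>F')"
    then obtain v e f where "z = p v" "v \<in> e" "e \<in> F" "v \<in> f" "f \<in> F'" by auto
    moreover have "p ` e \<subseteq> path_image (g e)" "p ` f \<subseteq> path_image (g f)"
      using pv calculation assms by blast+
    ultimately show "z \<in> img F \<inter> img F'" by (auto simp: img_def)
  qed
qed

text \<open>The embedding fixes the ends of an arc only as an unordered pair, so the arc may have to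
  be reversed.\<close>

lemma arc_edge:
  assumes "{x, y} \<in> E"
  shows "\<exists>\<gamma>. arc \<gamma> \<and> pathstart \<gamma> = p x \<and> pathfinish \<gamma> = p y \<and> path_image \<gamma> = path_image (g {x, y})"
proof -
  have a: "arc (g {x, y})" "{pathstart (g {x, y}), pathfinish (g {x, y})} = p ` {x, y}"
    using emb_arc emb_ends assms by simp_all
  then consider "pathstart (g {x, y}) = p x" "pathfinish (g {x, y}) = p y"
    | "pathstart (g {x, y}) = p y" "pathfinish (g {x, y}) = p x"
    unfolding image_insert image_empty doubleton_eq_iff by blast
  then show ?thesis
  proof cases
    case 1
    then show ?thesis using a by blast
  next
    case 2
    then show ?thesis using a
      by (intro exI [of _ "reversepath (g {x, y})"]) (auto simp: arc_reversepath)
  qed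
qed

lemma arc_walk:
  assumes "length l \<ge> 2" "distinct l" "pedges l \<subseteq> E"
  shows "\<exists>\<gamma>. arc \<gamma> \<and> pathstart \<gamma> = p (hd l) \<and> pathfinish \<gamma> = p (last l) \<and> path_image \<gamma> = img (pedges l)"
  using assms
proof (induction l rule: pedges.induct)
  case (3 x y l)
  have xy: "{x, y} \<in> E" using 3 by simp
  obtain \<gamma>1 where 1: "arc \<gamma>1" "pathstart \<gamma>1 = p x" "pathfinish \<gamma>1 = p y"
    "path_image \<gamma>1 = path_image (g {x, y})" using arc_edge [OF xy] by blast
  show ?case
  proof (cases l)
    case Nil
    then show ?thesis using 1 by (intro exI [of _ \<gamma>1]) (auto simp: img_def)
  next
    case (Cons z l')
    then obtain \<gamma>2 where 2: "arc \<gamma>2" "pathstart \<gamma>2 = p y" "pathfinish \<gamma>2 = p (last (y # l))"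
      "path_image \<gamma>2 = img (pedges (y # l))" using 3 by auto
    have "{x, y} \<notin> pedges (y # l)" using pedges_subset [of "{x, y}" "y # l"] 3 by auto
    then have "img {{x, y}} \<inter> img (pedges (y # l)) = p ` (\<Union>{{x, y}} \<inter> \<Union>(pedges (y # l)))"
      using 3 by (intro img_Int) auto
    also have "\<Union>(pedges (y # l)) = set (y # l)" using Cons by (intro Union_pedges) simp
    also have "\<Union>{{x, y}} \<inter> set (y # l) = {y}" using 3 by auto
    finally have "path_image \<gamma>1 \<inter> path_image \<gamma>2 \<subseteq> {pathstart \<gamma>2}"
      using 1 2 by (simp add: img_def)
    then have "arc (\<gamma>1 +++ \<gamma>2)" using 1 2 by (intro arc_join) auto
    then show ?thesis using 1 2 Cons
      by (intro exI [of _ "\<gamma>1 +++ \<gamma>2"]) (auto simp: path_image_join img_def)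
  qed
qed auto

text \<open>With both lists empty the two walks would be the same edge; with one inner vertex their
  edge sets are disjoint and \<open>img_Int\<close> applies.\<close>

lemma lens_walks:
  assumes d: "distinct (a # b # L1 @ L2)" and n: "L1 \<noteq> [] \<or> L2 \<noteq> []"
    and e: "pedges (a # L1 @ [b]) \<subseteq> E" "pedges (a # L2 @ [b]) \<subseteq> E"
    and \<gamma>1: "arc \<gamma>1" "pathstart \<gamma>1 = p a" "pathfinish \<gamma>1 = p b" "path_image \<gamma>1 = img (pedges (a # L1 @ [b]))"
    and \<gamma>2: "arc \<gamma>2" "pathstart \<gamma>2 = p a" "pathfinish \<gamma>2 = p b" "path_image \<gamma>2 = img (pedges (a # L2 @ [b]))"
  shows "lens \<gamma>1 \<gamma>2 (p a) (p b)"
proof -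
  have "pedges (a # L1 @ [b]) \<inter> pedges (a # L2 @ [b]) = {}"
  proof (intro equals0I, elim IntE)
    fix f assume f: "f \<in> pedges (a # L1 @ [b])" "f \<in> pedges (a # L2 @ [b])"
    then have "f \<subseteq> {a, b}" using pedges_subset [OF f(1)] pedges_subset [OF f(2)] d by auto
    moreover have "card f = 2" using f e E by blast
    ultimately have "f = {a, b}" by (metis card_2_iff card_subset_eq finite.simps d distinct_length_2_or_more)
    then show False using f n d pedges_ends [of a L1 b] pedges_ends [of a L2 b] by auto
  qed
  from img_Int [OF e this] have "path_image \<gamma>1 \<inter> path_image \<gamma>2 = p ` (set (a # L1 @ [b]) \<inter> set (a # L2 @ [b]))"
    using \<gamma>1 \<gamma>2 by (simp add: Union_pedges)
  also have "set (a # L1 @ [b]) \<inter> set (a # L2 @ [b]) = {a, b}" using d by auto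
  finally show ?thesis using \<gamma>1 \<gamma>2 by (simp add: lens_def)
qed

lemma vertex_on_img: "v \<in> V \<Longrightarrow> F \<subseteq> E \<Longrightarrow> p v \<in> img F \<longleftrightarrow> v \<in> \<Union>F"
proof -
  assume v: "v \<in> V" and F: "F \<subseteq> E"
  note inj = emb_inj
  have "p v \<in> path_image (g e) \<longleftrightarrow> v \<in> e" if "e \<in> F" for e
  proof -
    have "path_image (g e) \<inter> p ` V = p ` e"
      using emb_vertices that F by blast
    then have "p v \<in> path_image (g e) \<longleftrightarrow> p v \<in> p ` e" using v by blast
    then show ?thesis using inj_on_image_mem_iff [OF inj v, of e] E F that by blast
  qed
  then show ?thesis by (auto simp: img_def)
qed

section \<open>Drawings with all vertices on the outer face\<close>

context
  assumes outer: "\<forall>v\<in>V. p v \<in> frontier (outside (drawing V E p g))"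
begin

text \<open>The outer face of the whole drawing is contained in that of any part of it. So the
  vertex is in the closure of the outside of \<open>img F\<close>, from which the open set inside is
  disjoint.\<close>

lemma vertex_not_inside:
  assumes "F \<subseteq> E" "closed (img F)" "v \<in> V"
  shows "p v \<notin> inside (img F)"
proof
  assume i: "p v \<in> inside (img F)"
  have "img F \<subseteq> drawing V E p g" using assms by (auto simp: img_def drawing_def)
  then have "outside (drawing V E p g) \<subseteq> outside (img F)" by (rule outside_mono)
  moreover have "p v \<in> closure (outside (drawing V E p g))"
    using outer assms by (auto simp: frontier_def)
  ultimately have "p v \<in> closure (outside (img F))" using closure_mono by blast
  moreover have "open (inside (img F))" using assms by (simp add: open_inside)
  ultimately have "inside (img F) \<inter> outside (img F) \<noteq> {}"
    using i open_Int_closure_eq_empty by blast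
  then show False by (simp add: inside_Int_outside)
qed

text \<open>One of the three paths runs inside the curve formed by the others and takes its inner
  vertex along.\<close>

lemma outer_no_K23_subdivision: "no_K23_subdivision E"
  unfolding no_K23_subdivision_def
proof (intro notI, elim exE conjE)
  fix a b L1 L2 L3
  assume n: "L1 \<noteq> []" "L2 \<noteq> []" "L3 \<noteq> []" and d: "distinct (a # b # L1 @ L2 @ L3)"
    and e: "pedges (a # L1 @ [b]) \<subseteq> E" "pedges (a # L2 @ [b]) \<subseteq> E" "pedges (a # L3 @ [b]) \<subseteq> E"
  obtain c1 where c1: "arc c1" "pathstart c1 = p a" "pathfinish c1 = p b" "path_image c1 = img (pedges (a # L1 @ [b]))"
    using arc_walk [of "a # L1 @ [b]"] e d by auto
  obtain c2 where c2: "arc c2" "pathstart c2 = p a" "pathfinish c2 = p b" "path_image c2 = img (pedges (a # L2 @ [b]))"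
    using arc_walk [of "a # L2 @ [b]"] e d by auto
  obtain c3 where c3: "arc c3" "pathstart c3 = p a" "pathfinish c3 = p b" "path_image c3 = img (pedges (a # L3 @ [b]))"
    using arc_walk [of "a # L3 @ [b]"] e d by auto
  have l: "lens c1 c2 (p a) (p b)" "lens c2 c3 (p a) (p b)" "lens c1 c3 (p a) (p b)"
    using lens_walks [OF _ _ e(1,2) c1 c2] lens_walks [OF _ _ e(2,3) c2 c3] lens_walks [OF _ _ e(1,3) c1 c3] d n
    by auto
  note inj = emb_inj
  have no: "\<not> path_image c - {p a, p b} \<subseteq> inside (path_image c' \<union> path_image c'')"
    if "pedges (a # L @ [b]) \<subseteq> E" "path_image c = img (pedges (a # L @ [b]))"
       "pedges (a # L' @ [b]) \<subseteq> E" "path_image c' = img (pedges (a # L' @ [b]))"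
       "pedges (a # L'' @ [b]) \<subseteq> E" "path_image c'' = img (pedges (a # L'' @ [b]))"
       "L \<noteq> []" "distinct (a # b # L)" "lens c' c'' (p a) (p b)" for c c' c'' L L' L''
  proof
    assume s: "path_image c - {p a, p b} \<subseteq> inside (path_image c' \<union> path_image c'')"
    obtain x where x: "x \<in> set L" using \<open>L \<noteq> []\<close> by (cases L) auto
    have xU: "{x, a, b} \<subseteq> \<Union>(pedges (a # L @ [b]))" using x by (subst Union_pedges) auto
    have V: "{x, a, b} \<subseteq> V" using xU that(1) E by blast
    have "p x \<in> path_image c" using that(1,2) vertex_on_img [of x "pedges (a # L @ [b])"] V xU by auto
    moreover have "p x \<noteq> p a" "p x \<noteq> p b" using inj V x that(8) by (auto simp: inj_on_def)
    ultimately have "p x \<in> inside (img (pedges (a # L' @ [b]) \<union> pedges (a # L'' @ [b])))"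
      using s that by (auto simp: img_Un)
    moreover have "closed (img (pedges (a # L' @ [b]) \<union> pedges (a # L'' @ [b])))"
      using lens_closed [OF that(9)] that by (simp add: img_Un)
    ultimately show False using vertex_not_inside [of "pedges (a # L' @ [b]) \<union> pedges (a # L'' @ [b])" x] that V
      by auto
  qed
  show False
    using theta_curve_inside [OF l] no [OF e(1) c1(4) e(2) c2(4) e(3) c3(4) n(1) _ l(2)]
      no [OF e(2) c2(4) e(1) c1(4) e(3) c3(4) n(2) _ l(3)] no [OF e(3) c3(4) e(1) c1(4) e(2) c2(4) n(3) _ l(1)] d
    by auto
qed

lemma outer_no_crossing_chords: "no_crossing_chords E"
  unfolding no_crossing_chords_def
proof (intro notI, elim exE conjE)
  fix a b u v M1 M1' M2 M2'
  assume d: "distinct (a # M1 @ u # M1' @ b # M2 @ v # M2')"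
    and cyc: "pedges (a # M1 @ u # M1' @ b # M2 @ v # M2' @ [a]) \<subseteq> E"
    and ab: "{a, b} \<in> E" and uv: "{u, v} \<in> E"
  \<comment> \<open>The second half of the cycle is traversed backwards, so that both arcs of a pair
    run in the same direction.\<close>
  let ?c1 = "M1 @ u # M1'" and ?c2 = "rev M2' @ v # rev M2"
  let ?d1 = "M1' @ b # M2" and ?d2 = "rev M1 @ a # rev M2'"
  have r: "pedges (a # rev M2' @ v # rev M2 @ [b]) = pedges (b # M2 @ v # M2' @ [a])"
    using pedges_rev [of "b # M2 @ v # M2' @ [a]"] by simp
  have r2: "pedges (u # rev M1 @ a # rev M2' @ [v]) = pedges (v # M2' @ a # M1 @ [u])"
    using pedges_rev [of "v # M2' @ a # M1 @ [u]"] by simp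
  have split: "pedges (a # M1 @ u # M1' @ b # M2 @ v # M2' @ [a]) =
     pedges (a # M1 @ [u]) \<union> pedges (u # M1' @ [b]) \<union> pedges (b # M2 @ [v]) \<union> pedges (v # M2' @ [a])"
    using pedges_append [of "a # M1" u "M1' @ b # M2 @ v # M2' @ [a]"]
      pedges_append [of "u # M1'" b "M2 @ v # M2' @ [a]"] pedges_append [of "b # M2" v "M2' @ [a]"]
    by auto
  have s1: "pedges (a # ?c1 @ [b]) = pedges (a # M1 @ [u]) \<union> pedges (u # M1' @ [b])"
    using pedges_append [of "a # M1" u "M1' @ [b]"] by simp
  have s2: "pedges (a # ?c2 @ [b]) = pedges (b # M2 @ [v]) \<union> pedges (v # M2' @ [a])"
    using pedges_append [of "b # M2" v "M2' @ [a]"] r by simp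
  have s3: "pedges (u # ?d1 @ [v]) = pedges (u # M1' @ [b]) \<union> pedges (b # M2 @ [v])"
    using pedges_append [of "u # M1'" b "M2 @ [v]"] by simp
  have s4: "pedges (u # ?d2 @ [v]) = pedges (v # M2' @ [a]) \<union> pedges (a # M1 @ [u])"
    using pedges_append [of "v # M2'" a "M1 @ [u]"] r2 by simp
  have e: "pedges (a # ?c1 @ [b]) \<subseteq> E" "pedges (a # ?c2 @ [b]) \<subseteq> E" "pedges (a # [] @ [b]) \<subseteq> E"
     "pedges (u # ?d1 @ [v]) \<subseteq> E" "pedges (u # ?d2 @ [v]) \<subseteq> E" "pedges (u # [] @ [v]) \<subseteq> E"
    using cyc ab uv unfolding s1 s2 s3 s4 split by auto
  obtain c1 where c1: "arc c1" "pathstart c1 = p a" "pathfinish c1 = p b" "path_image c1 = img (pedges (a # ?c1 @ [b]))"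
    using arc_walk [OF _ _ e(1)] d by auto
  obtain c2 where c2: "arc c2" "pathstart c2 = p a" "pathfinish c2 = p b" "path_image c2 = img (pedges (a # ?c2 @ [b]))"
    using arc_walk [OF _ _ e(2)] d by auto
  obtain c where c: "arc c" "pathstart c = p a" "pathfinish c = p b" "path_image c = img (pedges (a # [] @ [b]))"
    using arc_walk [OF _ _ e(3)] d by auto
  obtain d1 where d1: "arc d1" "pathstart d1 = p u" "pathfinish d1 = p v" "path_image d1 = img (pedges (u # ?d1 @ [v]))"
    using arc_walk [OF _ _ e(4)] d by auto
  obtain d2 where d2: "arc d2" "pathstart d2 = p u" "pathfinish d2 = p v" "path_image d2 = img (pedges (u # ?d2 @ [v]))"
    using arc_walk [OF _ _ e(5)] d by auto
  obtain dd where dd: "arc dd" "pathstart dd = p u" "pathfinish dd = p v" "path_image dd = img (pedges (u # [] @ [v]))"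
    using arc_walk [OF _ _ e(6)] d by auto
  have L: "lens c1 c2 (p a) (p b)" "lens c2 c (p a) (p b)" "lens c1 c (p a) (p b)"
    using lens_walks [OF _ _ e(1,2) c1 c2] lens_walks [OF _ _ e(2,3) c2 c] lens_walks [OF _ _ e(1,3) c1 c] d
    by auto
  have M: "lens d1 d2 (p u) (p v)" "lens d2 dd (p u) (p v)" "lens d1 dd (p u) (p v)"
    using lens_walks [OF _ _ e(4,5) d1 d2] lens_walks [OF _ _ e(5,6) d2 dd] lens_walks [OF _ _ e(4,6) d1 dd] d
    by auto
  have J: "path_image c1 \<union> path_image c2 = path_image d1 \<union> path_image d2"
    unfolding c1 c2 d1 d2 s1 s2 s3 s4 img_Un by blast
  note inj = emb_inj
  have V: "{a, b, u, v} \<subseteq> V" using ab uv E by blast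
  have ne: "p u \<noteq> p a" "p u \<noteq> p b" "p v \<noteq> p a" "p v \<noteq> p b"
    using inj V d by (auto simp: inj_on_def)
  have on: "p w \<in> img (pedges l)" if "w \<in> {a, b, u, v}" "w \<in> set l" "length l \<ge> 2" "pedges l \<subseteq> E" for w l
    using vertex_on_img [of w "pedges l"] that V Union_pedges [of l] by blast
  have "path_image c \<inter> path_image dd = p ` (\<Union>{{a, b}} \<inter> \<Union>{{u, v}})"
    unfolding c dd using img_Int [of "{{a, b}}" "{{u, v}}"] ab uv d by (auto simp: doubleton_eq_iff)
  then have dis: "path_image c \<inter> path_image dd = {}" using d by auto
  have I: "p w \<notin> inside (path_image x \<union> path_image y)"
    if "arc x" "arc y" "path_image x = img (pedges l)" "path_image y = img (pedges l')"
      "pedges l \<subseteq> E" "pedges l' \<subseteq> E" "w \<in> {a, b, u, v}" for x y w l l'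
  proof -
    have "closed (path_image x \<union> path_image y)" by (intro closed_Un closed_arc_image that(1,2))
    then have "closed (img (pedges l \<union> pedges l'))" using that by (simp add: img_Un)
    then have "p w \<notin> inside (img (pedges l \<union> pedges l'))" using that V by (intro vertex_not_inside) auto
    then show ?thesis using that by (simp add: img_Un)
  qed
  show False
  proof (rule crossing_chords_inside [OF L M J _ _ _ _ dis])
    show "p u \<in> path_image c1 - {p a, p b}" unfolding c1 using ne e by (auto intro!: on)
    show "p v \<in> path_image c2 - {p a, p b}" unfolding c2 using ne e by (auto intro!: on)
    show "p b \<in> path_image d1 - {p u, p v}" unfolding d1 using ne e by (auto intro!: on)
    show "p a \<in> path_image d2 - {p u, p v}" unfolding d2 using ne e by (auto intro!: on)
    have cc: "arc x \<and> (\<exists>l. path_image x = img (pedges l) \<and> pedges l \<subseteq> E)" if "x \<in> {c1, c2, c, d1, d2, dd}" for x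
      using that c1 c2 c d1 d2 dd e by blast
    have cc': "p w \<notin> inside (path_image x \<union> path_image y)"
      if "x \<in> {c1, c2, c, d1, d2, dd}" "y \<in> {c1, c2, c, d1, d2, dd}" "w \<in> {a, b, u, v}" for x y w
      using cc [OF that(1)] cc [OF that(2)] that(3) I by blast
    show "w \<notin> inside (path_image x \<union> path_image y)" if "{x, y} \<subseteq> {c1, c2, c}" "w \<in> {p u, p v}" for x y w
      using cc' [of x y] that by blast
    show "w \<notin> inside (path_image x \<union> path_image y)" if "{x, y} \<subseteq> {d1, d2, dd}" "w \<in> {p a, p b}" for x y w
      using cc' [of x y] that by blast
  qed
qed

end

end

theorem outerplanar_forbidden:
  assumes "outerplanar V E" "sgraph V E"
  shows "no_K23_subdivision E" "no_crossing_chords E"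
proof -
  obtain p g where pg: "plane_embedding V E p g" "\<forall>v\<in>V. p v \<in> frontier (outside (drawing V E p g))"
    using assms by (auto simp: outerplanar_def)
  have "e \<subseteq> V \<and> card e = 2" if "e \<in> E" for e
    using assms that by (auto simp: sgraph_def)
  then show "no_K23_subdivision E" "no_crossing_chords E"
    using outer_no_K23_subdivision [OF pg(1) _ pg(2)] outer_no_crossing_chords [OF pg(1) _ pg(2)] by metis+
qed

section \<open>Noncrossing orders\<close>

lemma no_K23_subdivisionD:
  assumes "no_K23_subdivision E" "L1 \<noteq> []" "L2 \<noteq> []" "L3 \<noteq> []" "distinct (a # b # L1 @ L2 @ L3)"
    "pedges (a # L1 @ [b]) \<subseteq> E" "pedges (a # L2 @ [b]) \<subseteq> E" "pedges (a # L3 @ [b]) \<subseteq> E"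
  shows False
  using assms unfolding no_K23_subdivision_def by blast

lemma no_crossing_chordsD:
  assumes "no_crossing_chords E" "distinct (a # M1 @ u # M1' @ b # M2 @ v # M2')"
    "pedges (a # M1 @ u # M1' @ b # M2 @ v # M2' @ [a]) \<subseteq> E" "{a, b} \<in> E" "{u, v} \<in> E"
  shows False
  using assms unfolding no_crossing_chords_def by blast

definition noncrossing :: "'a set set \<Rightarrow> 'a list \<Rightarrow> bool" where
  "noncrossing E vs \<longleftrightarrow> (\<forall>a b c d. subseq [a, b, c, d] vs \<longrightarrow> \<not> ({a, c} \<in> E \<and> {b, d} \<in> E))"

lemma four_elements_append:
  assumes "[a, b, c, d] = xs @ ys"
  obtains "xs = []" "ys = [a, b, c, d]" | "xs = [a]" "ys = [b, c, d]" | "xs = [a, b]" "ys = [c, d]"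
    | "xs = [a, b, c]" "ys = [d]" | "xs = [a, b, c, d]" "ys = []"
proof -
  have xs: "xs = take (length xs) [a, b, c, d]" and ys: "ys = drop (length xs) [a, b, c, d]"
    using assms by simp_all
  have "length xs + length ys = length [a, b, c, d]" unfolding assms by simp
  then have "length xs \<le> 4" by simp
  then have "length xs = 0 \<or> length xs = 1 \<or> length xs = 2 \<or> length xs = 3 \<or> length xs = 4"
    by linarith
  then show ?thesis using that xs ys by (elim disjE) simp_all
qed

text \<open>A cyclic shift of four positions at most exchanges the two pairs of opposite elements.
  Rotation serves to bring a cut vertex to the front.\<close>

lemma noncrossing_rotate:
  assumes "noncrossing E (xs @ ys)" shows "noncrossing E (ys @ xs)"
  unfolding noncrossing_def
proof (intro allI impI)
  fix a b c d assume "subseq [a, b, c, d] (ys @ xs)"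
  then obtain s t where st: "[a, b, c, d] = s @ t" "subseq s ys" "subseq t xs"
    by (rule subseq_appendE)
  then have "subseq (t @ s) (xs @ ys)" by (simp add: list_emb_append_mono)
  with assms have H: "\<not> ({a', c'} \<in> E \<and> {b', d'} \<in> E)" if "t @ s = [a', b', c', d']" for a' b' c' d'
    using that unfolding noncrossing_def by metis
  from four_elements_append [OF st(1)] show "\<not> ({a, c} \<in> E \<and> {b, d} \<in> E)"
  proof cases
    case 1
    then show ?thesis using H [of a b c d] by simp
  next
    case 2
    then show ?thesis using H [of b c d a] by (auto simp: insert_commute)
  next
    case 3
    then show ?thesis using H [of c d a b] by (auto simp: insert_commute)
  next
    case 4
    then show ?thesis using H [of d a b c] by (auto simp: insert_commute)
  next
    case 5
    then show ?thesis using H [of a b c d] by simp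
  qed
qed

text \<open>The prefix \<open>xs\<close> is empty for a disconnected graph and consists of the cut
  vertex otherwise. If the four elements come from both \<open>ys\<close> and \<open>zs\<close>,
  then one of the two crossing pairs joins \<open>ys\<close> to \<open>zs\<close>, so it is not an
  edge.\<close>

lemma noncrossing_glue:
  assumes "noncrossing E (xs @ ys)" "noncrossing E (xs @ zs)"
    and no: "\<And>y z. y \<in> set ys \<Longrightarrow> z \<in> set zs \<Longrightarrow> {y, z} \<notin> E" and xs: "length xs \<le> 1"
  shows "noncrossing E (xs @ ys @ zs)"
  unfolding noncrossing_def
proof (intro allI impI)
  fix a b c d assume "subseq [a, b, c, d] (xs @ ys @ zs)"
  then obtain s t where st: "[a, b, c, d] = s @ t" "subseq s (xs @ ys)" "subseq t zs"
    by (metis append_assoc subseq_appendE)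
  have sub: "set t \<subseteq> set zs" using st(3) by (auto elim: list_emb_set)
  from four_elements_append [OF st(1)] show "\<not> ({a, c} \<in> E \<and> {b, d} \<in> E)"
  proof cases
    case 1
    then have "subseq [a, b, c, d] (xs @ zs)" using st by (simp add: list_emb_append2)
    then show ?thesis using assms(2) by (auto simp: noncrossing_def)
  next
    case 2
    show ?thesis
    proof (cases "subseq [a] xs")
      case True
      then have "subseq ([a] @ [b, c, d]) (xs @ zs)" using st 2 by (intro list_emb_append_mono) auto
      then show ?thesis using assms(2) by (auto simp: noncrossing_def)
    next
      case False
      then have "a \<in> set ys" using st 2 by (metis Un_iff set_append subseq_singleton_left)
      then show ?thesis using no sub 2 by auto
    qed
  next
    case 3
    \<comment> \<open>The prefix supplies at most one element, which can only be
      \<open>a\<close>.\<close>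
    have "b \<in> set ys"
    proof -
      obtain s1 s2 where s: "[a, b] = s1 @ s2" "subseq s1 xs" "subseq s2 ys"
        using st 3 by (metis subseq_appendE)
      then have "length s1 \<le> 1" using xs list_emb_length by fastforce
      then have "b \<in> set s2" using s(1) by (cases s1) (auto simp: Cons_eq_append_conv)
      then show ?thesis using s(3) by (auto elim: list_emb_set)
    qed
    then show ?thesis using no sub 3 by auto
  next
    case 4
    have "b \<in> set ys"
    proof -
      obtain s1 s2 where s: "[a, b, c] = s1 @ s2" "subseq s1 xs" "subseq s2 ys"
        using st 4 by (metis subseq_appendE)
      then have "length s1 \<le> 1" using xs list_emb_length by fastforce
      then have "b \<in> set s2" using s(1) by (cases s1) (auto simp: Cons_eq_append_conv)
      then show ?thesis using s(3) by (auto elim: list_emb_set)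
    qed
    then show ?thesis using no sub 4 by auto
  next
    case 5
    then show ?thesis using assms(1) st by (auto simp: noncrossing_def)
  qed
qed

lemma pedges_take: "pedges (xs @ [y]) \<subseteq> pedges (xs @ y # ys)"
  using pedges_append [of xs y ys] by simp

lemma pedges_drop: "pedges (y # ys) \<subseteq> pedges (xs @ y # ys)"
  using pedges_append [of xs y ys] by simp

lemma distinct_walk:
  assumes "(w, z) \<in> {(x, y). {x, y} \<in> E \<and> y \<in> S}\<^sup>*" "w \<in> S"
  shows "\<exists>l. distinct l \<and> l \<noteq> [] \<and> hd l = w \<and> last l = z \<and> set l \<subseteq> S \<and> pedges l \<subseteq> E"
  using assms
proof (induction rule: rtrancl_induct)
  case base
  then show ?case by (intro exI [of _ "[w]"]) auto
next
  case (step y z)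
  then obtain l where l: "distinct l" "l \<noteq> []" "hd l = w" "last l = y" "set l \<subseteq> S" "pedges l \<subseteq> E"
    by blast
  show ?case
  proof (cases "z \<in> set l")
    case True
    then obtain l1 l2 where s: "l = l1 @ z # l2" by (meson split_list)
    have "pedges (l1 @ [z]) \<subseteq> E" using l s pedges_take [of l1 z l2] by auto
    then show ?thesis using l s by (intro exI [of _ "l1 @ [z]"]) (cases l1; auto)
  next
    case False
    obtain l0 where l0: "l = l0 @ [y]" using l by (metis append_butlast_last_id)
    have "pedges (l @ [z]) = insert {y, z} (pedges l)" using pedges_snoc2 [of l0 y z] l0 by simp
    then show ?thesis using l step False by (intro exI [of _ "l @ [z]"]) auto
  qed
qed

text \<open>Crossing edges are crossing chords of the cycle rotated to start at \<open>a\<close>;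
  the part \<open>P\<close> before \<open>a\<close> moves behind \<open>v\<close>.\<close>

lemma hamiltonian_cycle_noncrossing:
  assumes E: "no_crossing_chords E" and C: "distinct C" "C \<noteq> []" "pedges (C @ [hd C]) \<subseteq> E"
  shows "noncrossing E C"
  unfolding noncrossing_def
proof (intro allI impI notI)
  fix a u b v assume s: "subseq [a, u, b, v] C" and e: "{a, b} \<in> E \<and> {u, v} \<in> E"
  obtain P r1 where 1: "C = P @ a # r1" "subseq [u, b, v] r1"
    using list_emb_ConsD [OF s] by blast
  obtain M1 r2 where 2: "r1 = M1 @ u # r2" "subseq [b, v] r2"
    using list_emb_ConsD [OF 1(2)] by blast
  obtain M1' r3 where 3: "r2 = M1' @ b # r3" "subseq [v] r3"
    using list_emb_ConsD [OF 2(2)] by blast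
  obtain M2 r4 where 4: "r3 = M2 @ v # r4" "subseq [] r4"
    using list_emb_ConsD [OF 3(2)] by blast
  let ?D = "a # M1 @ u # M1' @ b # M2 @ v # r4"
  have CC: "C = P @ ?D" using 1 2 3 4 by simp
  have "pedges (?D @ P @ [a]) \<subseteq> E"
  proof (cases P)
    case Nil
    then show ?thesis using C CC by simp
  next
    case (Cons x P')
    have "pedges (P @ [a]) \<subseteq> E" using C(3) CC pedges_take [of P a "tl ?D @ [hd C]"] by auto
    moreover have "pedges (?D @ [x]) \<subseteq> E" using C(3) CC pedges_drop [of a "tl ?D @ [x]" P] Cons by auto
    moreover have "pedges (?D @ P @ [a]) = pedges (?D @ [x]) \<union> pedges (P @ [a])"
      using pedges_append [of ?D x "P' @ [a]"] Cons by simp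
    ultimately show ?thesis by blast
  qed
  moreover have "distinct (a # M1 @ u # M1' @ b # M2 @ v # (r4 @ P))" using C CC by auto
  ultimately show False using no_crossing_chordsD [OF E, of a M1 u M1' b M2 v "r4 @ P"] e by simp
qed

text \<open>A longest cycle that misses a vertex has a detour through the missed part with two
  different ends on the cycle. Either the detour can replace an edge of the cycle and lengthens it,
  or detour and cycle form a subdivided \<open>K23\<close>.\<close>

lemma cut_or_hamiltonian:
  assumes E: "no_K23_subdivision E" "no_crossing_chords E" and V: "finite V" "card V \<ge> 2"
    and conn: "\<And>A. A \<subset> V \<Longrightarrow> A \<noteq> {} \<Longrightarrow> \<exists>x\<in>A. \<exists>y\<in>V - A. {x, y} \<in> E"
    and nocut: "\<And>x A. x \<in> V \<Longrightarrow> A \<subset> V - {x} \<Longrightarrow> A \<noteq> {} \<Longrightarrow> \<exists>y\<in>A. \<exists>z\<in>V - {x} - A. {y, z} \<in> E"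
  shows "\<exists>C. distinct C \<and> C \<noteq> [] \<and> set C = V \<and> pedges (C @ [hd C]) \<subseteq> E"
proof -
  \<comment> \<open>An edge traversed back and forth counts as a cycle of length 2, so any edge
    provides a first cycle.\<close>
  define P where "P C \<longleftrightarrow> distinct C \<and> length C \<ge> 2 \<and> set C \<subseteq> V \<and> pedges (C @ [hd C]) \<subseteq> E" for C
  obtain x where x: "x \<in> V" using V by fastforce
  have "{x} \<subset> V" using x V by (metis card.empty card.insert empty_iff finite.emptyI insert_subset
      not_less_eq_eq numeral_2_eq_2 psubsetI singleton_iff subset_singleton_iff One_nat_def le_refl Suc_n_not_le_n insert_absorb empty_subsetI)
  then obtain y where y: "y \<in> V" "y \<noteq> x" "{x, y} \<in> E" using conn [of "{x}"] by auto
  have "P [x, y]" using x y by (auto simp: P_def insert_commute)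
  moreover have "\<forall>C. P C \<longrightarrow> length C < Suc (card V)"
    using V unfolding P_def by (metis card_mono distinct_card less_Suc_eq_le)
  ultimately obtain C where C: "P C" and max: "\<And>D. P D \<Longrightarrow> length D \<le> length C"
    using ex_has_greatest_nat [of P "[x, y]" length "Suc (card V)"] by blast
  have "set C = V"
  proof (rule ccontr)
    assume "set C \<noteq> V"
    then have "set C \<subset> V" "set C \<noteq> {}" using C by (auto simp: P_def)
    then obtain c w where cw: "c \<in> set C" "w \<in> V - set C" "{c, w} \<in> E" using conn by blast
    define S where "S = V - set C"
    define R where "R = {(x, y). {x, y} \<in> E \<and> y \<in> S}"
    \<comment> \<open>The component of \<open>w\<close> in the graph outside the cycle.\<close>
    define A where "A = {z. (w, z) \<in> R\<^sup>*}"
    have w: "w \<in> A" by (simp add: A_def)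
    have AS: "A \<subseteq> S"
    proof
      fix z assume "z \<in> A"
      then have "(w, z) \<in> R\<^sup>*" by (simp add: A_def)
      then show "z \<in> S" using cw by (induction) (auto simp: R_def S_def)
    qed
    \<comment> \<open>A second vertex of the cycle makes \<open>A\<close> a proper subset of
      \<open>V - {c}\<close>, as required for using that \<open>c\<close> is no cut vertex. The edge
      found there must return to the cycle, because \<open>A\<close> is a whole component.\<close>
    obtain c' where c': "c' \<in> set C" "c' \<noteq> c"
      using C cw(1) unfolding P_def
      by (metis One_nat_def card_length distinct_card empty_iff insertI1 length_pos_if_in_set not_less_eq_eq
         numeral_2_eq_2 subsetI subset_singletonD card.empty card_1_singleton_iff nat_less_le le_antisym Suc_leI singletonI set_ConsD list.set_cases)
    have "c \<in> V" "c' \<in> V" using c' cw C by (auto simp: P_def)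
    have "A \<subset> V - {c}" using AS cw c' \<open>c' \<in> V\<close> by (auto simp: S_def)
    then obtain z y where zy: "z \<in> A" "y \<in> V - {c} - A" "{z, y} \<in> E"
      using nocut [OF \<open>c \<in> V\<close>] w by blast
    have "y \<in> set C"
    proof (rule ccontr)
      assume "y \<notin> set C"
      then have "(z, y) \<in> R" using zy by (auto simp: R_def S_def)
      then show False using zy by (auto simp: A_def intro: rtrancl_into_rtrancl)
    qed
    obtain L where L: "distinct L" "L \<noteq> []" "hd L = w" "last L = z" "set L \<subseteq> S" "pedges L \<subseteq> E"
      using distinct_walk [of w z E S] zy cw by (auto simp: A_def R_def S_def)
    obtain C1 C2 where C12: "C = C1 @ c # C2" using cw(1) by (meson split_list)
    define B where "B = C2 @ C1"
    have cB: "distinct (c # B)" "set (c # B) = set C" "length (c # B) = length C"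
      using C C12 by (auto simp: P_def B_def)
    have eB: "pedges (c # B @ [c]) \<subseteq> E"
    proof (cases C1)
      case Nil
      then show ?thesis using C C12 by (simp add: P_def B_def)
    next
      case (Cons d C1')
      have "pedges (C1 @ [c]) \<subseteq> E" using C C12 pedges_take [of C1 c "C2 @ [hd C]"] by (auto simp: P_def)
      moreover have "pedges (c # C2 @ [d]) \<subseteq> E"
        using C C12 Cons pedges_drop [of c "C2 @ [d]" C1] by (auto simp: P_def)
      moreover have "pedges (c # B @ [c]) = pedges (c # C2 @ [d]) \<union> pedges (C1 @ [c])"
        using pedges_append [of "c # C2" d "C1' @ [c]"] Cons by (simp add: B_def)
      ultimately show ?thesis by blast
    qed
    have "y \<in> set B" using \<open>y \<in> set C\<close> cB zy by auto
    then obtain A1 A2 where A12: "B = A1 @ y # A2" by (meson split_list)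
    have e1: "pedges (c # A1 @ [y]) \<subseteq> E"
      using eB A12 pedges_take [of "c # A1" y "A2 @ [c]"] by auto
    have e2: "pedges (y # A2 @ [c]) \<subseteq> E"
      using eB A12 pedges_drop [of y "A2 @ [c]" "c # A1"] by auto
    have e3: "pedges (c # L @ [y]) \<subseteq> E"
    proof -
      obtain L1 where L1: "L = w # L1" using L by (cases L) auto
      obtain L0 where L0: "L = L0 @ [z]" using L by (metis append_butlast_last_id)
      have "pedges (L @ [y]) = insert {z, y} (pedges L)" using pedges_snoc2 [of L0 z y] L0 by simp
      then show ?thesis using L zy cw L1 by auto
    qed
    have dis: "set L \<inter> set C = {}" using L by (auto simp: S_def)
    have LV: "set L \<subseteq> V" "set C \<subseteq> V" using L C by (auto simp: S_def P_def)
    have d: "distinct (c # y # A1 @ rev A2 @ L)"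
      using cB A12 dis L(1) by auto
    \<comment> \<open>\<open>A1\<close> and \<open>A2\<close> are the two parts of the cycle between
      \<open>c\<close> and \<open>y\<close>. If one is empty, the detour \<open>L\<close> takes its
      place and yields a longer cycle.\<close>
    consider "A1 \<noteq> []" "A2 \<noteq> []" | "A1 = []" | "A2 = []" by blast
    then show False
    proof cases
      case 1
      have "pedges (c # rev A2 @ [y]) \<subseteq> E" using e2 pedges_rev [of "y # A2 @ [c]"] by simp
      then show False using no_K23_subdivisionD [OF E(1) _ _ _ d] 1 e1 e3 L(2) by simp
    next
      case 2
      have "pedges ((c # L @ y # A2) @ [c]) = pedges (c # L @ [y]) \<union> pedges (y # A2 @ [c])"
        using pedges_append [of "c # L" y "A2 @ [c]"] by simp
      then have "P (c # L @ y # A2)" using e2 e3 d LV cB A12 2 by (auto simp: P_def)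
      from max [OF this] show False using cB(3) A12 2 L(2) by (cases L) auto
    next
      case 3
      have "pedges (y # rev L @ [c]) \<subseteq> E" using e3 pedges_rev [of "c # L @ [y]"] by simp
      moreover have "pedges ((c # A1 @ y # rev L) @ [c]) = pedges (c # A1 @ [y]) \<union> pedges (y # rev L @ [c])"
        using pedges_append [of "c # A1" y "rev L @ [c]"] by simp
      ultimately have "P (c # A1 @ y # rev L)" using e1 d LV cB A12 3 by (auto simp: P_def)
      from max [OF this] show False using cB(3) A12 3 L(2) by (cases L) auto
    qed
  qed
  then show ?thesis using C by (intro exI [of _ C]) (auto simp: P_def)
qed

text \<open>The edge set stays fixed while \<open>V\<close> shrinks, so the forbidden configurations
  need no transfer to subgraphs. \<open>D\<close> describes a union of components and
  \<open>K\<close> a part that is separated by the cut vertex \<open>x\<close>.\<close>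

theorem noncrossing_order:
  assumes E: "no_K23_subdivision E" "no_crossing_chords E" and "finite V"
  shows "\<exists>vs. distinct vs \<and> set vs = V \<and> noncrossing E vs"
  using \<open>finite V\<close>
proof (induction "card V" arbitrary: V rule: less_induct)
  case less
  define D where "D A \<longleftrightarrow> A \<subset> V \<and> A \<noteq> {} \<and> (\<forall>x\<in>A. \<forall>y\<in>V - A. {x, y} \<notin> E)" for A
  define K where "K x A \<longleftrightarrow> x \<in> V \<and> A \<subset> V - {x} \<and> A \<noteq> {} \<and> (\<forall>y\<in>A. \<forall>z\<in>V - {x} - A. {y, z} \<notin> E)" for x A
  consider (small) "card V \<le> 1" | (disc') A where "D A" | (cut') x A where "K x A"
    | (ham) "card V \<ge> 2" "\<And>A. \<not> D A" "\<And>x A. \<not> K x A"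
  proof (cases "card V \<le> 1 \<or> (\<exists>A. D A) \<or> (\<exists>x A. K x A)")
    case True
    then show ?thesis using that(1-3) by blast
  next
    case False
    then have "card V \<ge> 2" by simp
    with False show ?thesis using that(4) by blast
  qed
  then show ?case
  proof cases
    case small
    obtain vs where vs: "distinct vs" "set vs = V" using less.prems finite_distinct_list by blast
    then have "length vs \<le> 1" using small distinct_card by fastforce
    then have "noncrossing E vs" using list_emb_length by (fastforce simp: noncrossing_def)
    then show ?thesis using vs by blast
  next
    case disc'
    then have disc: "A \<subset> V" "A \<noteq> {}" "\<And>x y. x \<in> A \<Longrightarrow> y \<in> V - A \<Longrightarrow> {x, y} \<notin> E"
      by (auto simp: D_def)
    have "card A < card V" using disc less.prems by (simp add: psubset_card_mono)
    then obtain xs where xs: "distinct xs" "set xs = A" "noncrossing E xs"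
      using less.hyps disc less.prems by (metis psubset_imp_subset finite_subset)
    have "card (V - A) < card V" using disc less.prems by (intro psubset_card_mono) auto
    then obtain ys where ys: "distinct ys" "set ys = V - A" "noncrossing E ys"
      using less.hyps less.prems by (metis finite_Diff)
    have "noncrossing E ([] @ xs @ ys)" using xs ys disc by (intro noncrossing_glue) auto
    then show ?thesis using xs ys disc by (intro exI [of _ "xs @ ys"]) auto
  next
    case cut'
    then have cut: "x \<in> V" "A \<subset> V - {x}" "A \<noteq> {}" "\<And>y z. y \<in> A \<Longrightarrow> z \<in> V - {x} - A \<Longrightarrow> {y, z} \<notin> E"
      by (auto simp: K_def)
    \<comment> \<open>Both sides of the cut vertex get an order starting with \<open>x\<close>, so
      that \<open>x\<close> can be their common prefix.\<close>
    have rot: "\<exists>ys. distinct (x # ys) \<and> set ys = B \<and> noncrossing E ([x] @ ys)"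
      if "B \<subset> V - {x}" for B
    proof -
      have B: "insert x B \<subset> V" "x \<notin> B" using that cut(1) by auto
      have "card (insert x B) < card V" using B less.prems by (intro psubset_card_mono) auto
      then obtain xs where xs: "distinct xs" "set xs = insert x B" "noncrossing E xs"
        using less.hyps B less.prems by (metis psubset_imp_subset finite_subset)
      then obtain l1 l2 where l: "xs = l1 @ x # l2" by (metis insertI1 split_list)
      have "noncrossing E ((x # l2) @ l1)" using xs l noncrossing_rotate by blast
      moreover have x: "x \<notin> set (l2 @ l1)" using xs(1) l by simp
      moreover have "insert x (set (l2 @ l1)) = insert x B" using xs(2) unfolding l by auto
      then have "set (l2 @ l1) = B" using x B(2) insert_ident by metis
      moreover have "distinct (l2 @ l1)" using xs(1) l by auto
      ultimately show ?thesis by (intro exI [of _ "l2 @ l1"]) (use B(2) in simp)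
    qed
    obtain ys where ys: "distinct (x # ys)" "set ys = A" "noncrossing E ([x] @ ys)"
      using rot [OF cut(2)] by blast
    obtain zs where zs: "distinct (x # zs)" "set zs = V - {x} - A" "noncrossing E ([x] @ zs)"
    proof -
      have "V - {x} - A \<subset> V - {x}" using cut(2,3) by blast
      from rot [OF this] show ?thesis using that by blast
    qed
    have "noncrossing E ([x] @ ys @ zs)"
      using noncrossing_glue [OF ys(3) zs(3)] cut(4) ys(2) zs(2) by simp
    moreover have "distinct ([x] @ ys @ zs)" using ys(1,2) zs(1,2) by auto
    moreover have "set ([x] @ ys @ zs) = V" using ys(2) zs(2) cut(1,2) by auto
    ultimately show ?thesis by blast
  next
    case ham
    obtain C where C: "distinct C" "C \<noteq> []" "set C = V" "pedges (C @ [hd C]) \<subseteq> E"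
    proof (rule exE [OF cut_or_hamiltonian [OF E less.prems ham(1)]])
      show "\<exists>x\<in>A. \<exists>y\<in>V - A. {x, y} \<in> E" if "A \<subset> V" "A \<noteq> {}" for A
        using ham(2) [of A] that unfolding D_def by blast
      show "\<exists>y\<in>A. \<exists>z\<in>V - {x} - A. {y, z} \<in> E" if "x \<in> V" "A \<subset> V - {x}" "A \<noteq> {}" for x A
        using ham(3) [of x A] that unfolding K_def by blast
    qed (use that in blast)
    then show ?thesis using hamiltonian_cycle_noncrossing [OF E(2) C(1,2,4)] by metis
  qed
qed

section \<open>Counting vertex sets with few components\<close>

definition adj :: "'a set set \<Rightarrow> 'a set \<Rightarrow> ('a \<times> 'a) set" where
  "adj E A = {(x, y). {x, y} \<in> E \<and> x \<in> A \<and> y \<in> A}"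

text \<open>The number of components is bounded through a set that meets all of them: an upper bound
  then only needs a witness.\<close>

definition few_comps :: "nat \<Rightarrow> 'a set set \<Rightarrow> 'a set \<Rightarrow> bool" where
  "few_comps m E A \<longleftrightarrow> (\<exists>Q. finite Q \<and> card Q \<le> m \<and> Q \<subseteq> A \<and> A \<subseteq> (adj E A)\<^sup>* `` Q)"

lemma sym_adj: "sym (adj E A)"
  by (auto simp: sym_def adj_def insert_commute)

lemma adj_rtrancl_sym: "(x, y) \<in> (adj E A)\<^sup>* \<Longrightarrow> (y, x) \<in> (adj E A)\<^sup>*"
  by (metis sym_rtrancl sym_adj symD)

lemma adj_rtrancl_in: "(x, y) \<in> (adj E A)\<^sup>* \<Longrightarrow> x \<in> A \<Longrightarrow> y \<in> A"
  by (induction rule: rtrancl_induct) (auto simp: adj_def)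

lemma adj_rtrancl_image: "Q \<subseteq> A \<Longrightarrow> (adj E A)\<^sup>* `` Q \<subseteq> A"
proof
  fix y assume Q: "Q \<subseteq> A" and "y \<in> (adj E A)\<^sup>* `` Q"
  then obtain x where "x \<in> Q" "(x, y) \<in> (adj E A)\<^sup>*" by blast
  then show "y \<in> A" using adj_rtrancl_in Q by (metis subsetD)
qed

lemma rtrancl_leaves:
  assumes "(x, y) \<in> R\<^sup>*" "x \<in> S" "y \<notin> S"
  shows "\<exists>p q. (x, p) \<in> R\<^sup>* \<and> (p, q) \<in> R \<and> p \<in> S \<and> q \<notin> S"
  using assms by (induction rule: rtrancl_induct) auto

lemma subseq_nth:
  assumes "sorted_wrt (<) is" "\<forall>i\<in>set is. i < length vs"
  shows "subseq (map ((!) vs) is) vs"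
proof -
  have s: "sorted is" "distinct is" using assms(1) strict_sorted_iff by auto
  have "is = filter (\<lambda>i. i \<in> set is) [0..<length vs]"
    using s assms(2) by (intro sorted_distinct_set_unique) (auto intro: sorted_wrt_filter)
  then have "subseq is [0..<length vs]" by (metis subseq_filter_left)
  then have "subseq (map ((!) vs) is) (map ((!) vs) [0..<length vs])" by (rule subseq_map)
  then show ?thesis by (simp add: map_nth)
qed

text \<open>The walk from \<open>b\<close> to \<open>b'\<close> leaves the open interval between
  \<open>a\<close> and \<open>a'\<close>, and the walk from \<open>a\<close> to \<open>a'\<close>
  has to pass the edge on which this happens.\<close>

lemma connected_sets_noncrossing:
  fixes pos :: "'a \<Rightarrow> nat"
  assumes inj: "inj_on pos W" and AB: "A \<subseteq> W" "B \<subseteq> W"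
    and nc: "\<And>a b c d. {a, b, c, d} \<subseteq> W \<Longrightarrow> pos a < pos b \<Longrightarrow> pos b < pos c \<Longrightarrow> pos c < pos d \<Longrightarrow>
               \<not> ({a, c} \<in> E \<and> {b, d} \<in> E)"
    and a: "a \<in> A" "(a, a') \<in> (adj E A)\<^sup>*" and b: "b \<in> B" "(b, b') \<in> (adj E B)\<^sup>*"
    and dis: "(adj E A)\<^sup>* `` {a} \<inter> (adj E B)\<^sup>* `` {b} = {}"
    and ord: "pos a < pos b" "pos b < pos a'" "pos a' < pos b'"
  shows False
proof -
  have W: "a \<in> W" "a' \<in> W" "b \<in> W" "b' \<in> W"
    using adj_rtrancl_in [OF a(2,1)] adj_rtrancl_in [OF b(2,1)] a(1) b(1) AB by auto
  have ne: "pos p \<noteq> pos x" if "(a, p) \<in> (adj E A)\<^sup>*" "(b, x) \<in> (adj E B)\<^sup>*" for p x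
  proof
    assume "pos p = pos x"
    moreover have "p \<in> W" "x \<in> W"
      using adj_rtrancl_in [OF that(1) a(1)] adj_rtrancl_in [OF that(2) b(1)] AB by auto
    ultimately have "p = x" using inj by (auto simp: inj_on_def)
    then show False using that dis by blast
  qed
  \<comment> \<open>The edge by which the walk leaves the interval ends beyond \<open>a'\<close> or
    before \<open>a\<close>, as disjointness excludes \<open>a\<close> and \<open>a'\<close>
    themselves.\<close>
  obtain x y where xy: "(b, x) \<in> (adj E B)\<^sup>*" "(x, y) \<in> adj E B" "pos a < pos x" "pos x < pos a'"
     "\<not> (pos a < pos y \<and> pos y < pos a')"
    using rtrancl_leaves [OF b(2), of "{x. pos a < pos x \<and> pos x < pos a'}"] ord by auto
  have by': "(b, y) \<in> (adj E B)\<^sup>*" using xy by (meson rtrancl_into_rtrancl)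
  have xyW: "x \<in> W" "y \<in> W" "{x, y} \<in> E" using xy AB by (auto simp: adj_def)
  have "pos y \<noteq> pos a" "pos y \<noteq> pos a'" using ne [OF rtrancl_refl by'] ne [OF a(2) by'] by simp_all
  then consider "pos a' < pos y" | "pos y < pos a" using xy(5) by linarith
  then show False
  proof cases
    case 1
    \<comment> \<open>The interval from \<open>x\<close> to \<open>y\<close> contains
      \<open>a'\<close> but not \<open>a\<close>, so some edge of the walk enters it and crosses the
      edge \<open>{x, y}\<close>. In the other case the interval contains \<open>a\<close> but not
      \<open>a'\<close>, and an edge leaves it.\<close>
    obtain p q where pq: "(a, p) \<in> (adj E A)\<^sup>*" "(p, q) \<in> adj E A" "\<not> (pos x < pos p \<and> pos p < pos y)"
      "pos x < pos q" "pos q < pos y"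
      using rtrancl_leaves [OF a(2), of "{z. \<not> (pos x < pos z \<and> pos z < pos y)}"] 1 xy by auto
    have pqW: "p \<in> W" "q \<in> W" "{p, q} \<in> E" "{q, p} \<in> E" using pq AB by (auto simp: adj_def insert_commute)
    have "pos p \<noteq> pos x" "pos p \<noteq> pos y" using ne [OF pq(1)] xy(1) by' by auto
    then consider "pos p < pos x" | "pos y < pos p" using pq(3) by linarith
    then show False
    proof cases
      case 1
      then show False using nc [of p x q y] pq xyW pqW by simp
    next
      case 2
      then show False using nc [of x q y p] pq xyW pqW by simp
    qed
  next
    case 2
    obtain p q where pq: "(a, p) \<in> (adj E A)\<^sup>*" "(p, q) \<in> adj E A" "pos y < pos p" "pos p < pos x"
      "\<not> (pos y < pos q \<and> pos q < pos x)"
      using rtrancl_leaves [OF a(2), of "{z. pos y < pos z \<and> pos z < pos x}"] 2 xy by auto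
    have aq: "(a, q) \<in> (adj E A)\<^sup>*" using pq by (meson rtrancl_into_rtrancl)
    have pqW: "p \<in> W" "q \<in> W" "{p, q} \<in> E" "{q, p} \<in> E" using pq AB by (auto simp: adj_def insert_commute)
    have yx: "{y, x} \<in> E" using xyW by (simp add: insert_commute)
    have "pos q \<noteq> pos x" "pos q \<noteq> pos y" using ne [OF aq] xy(1) by' by auto
    then consider "pos q < pos y" | "pos x < pos q" using pq(5) by linarith
    then show False
    proof cases
      case 1
      then show False using nc [of q y p x] pq xyW pqW yx by simp
    next
      case 2
      then show False using nc [of y p x q] pq xyW pqW yx by simp
    qed
  qed
qed

text \<open>The first \<open>m\<close> intervals belong to the set that is encoded, the other \<open>m\<close> to its complement.  An empty
  class is encoded by the empty interval from 1 to 0.\<close>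

definition span_decode :: "'a set \<Rightarrow> ('a \<Rightarrow> nat) \<Rightarrow> nat \<Rightarrow> (nat \<Rightarrow> nat \<times> nat) \<Rightarrow> 'a set" where
  "span_decode W pos m h = {x \<in> W. \<exists>l<m. fst (h l) \<le> pos x \<and> pos x \<le> snd (h l) \<and>
     (\<forall>l'<2 * m. fst (h l') \<le> pos x \<and> pos x \<le> snd (h l') \<longrightarrow> fst (h l') \<le> fst (h l))}"

text \<open>Empty classes fill the list up to exactly \<open>m\<close>; a component that the witness
  meets twice is repeated.\<close>

lemma few_comps_classes:
  assumes "few_comps m E A"
  shows "\<exists>K. A = (\<Union>l<m. K l) \<and> (\<forall>l<m. K l = {} \<or> (\<exists>r\<in>A. K l = (adj E A)\<^sup>* `` {r}))"
proof -
  obtain Q where Q: "finite Q" "card Q \<le> m" "Q \<subseteq> A" "A \<subseteq> (adj E A)\<^sup>* `` Q"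
    using assms by (auto simp: few_comps_def)
  obtain rs where rs: "distinct rs" "set rs = Q" using Q(1) finite_distinct_list by blast
  have len: "length rs \<le> m" using rs Q(2) distinct_card by metis
  define K where "K l = (if l < length rs then (adj E A)\<^sup>* `` {rs ! l} else {})" for l
  have "A = (\<Union>l<m. K l)"
  proof
    show "A \<subseteq> (\<Union>l<m. K l)"
    proof
      fix x assume "x \<in> A"
      then obtain r where "r \<in> set rs" "(r, x) \<in> (adj E A)\<^sup>*" using Q rs by blast
      then obtain l where "l < length rs" "(rs ! l, x) \<in> (adj E A)\<^sup>*" by (metis in_set_conv_nth)
      then show "x \<in> (\<Union>l<m. K l)" using len by (intro UN_I [of l]) (auto simp: K_def)
    qed
    show "(\<Union>l<m. K l) \<subseteq> A"
      using adj_rtrancl_image [OF Q(3)] rs by (fastforce simp: K_def split: if_splits)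
  qed
  moreover have "K l = {} \<or> (\<exists>r\<in>A. K l = (adj E A)\<^sup>* `` {r})" for l
    using rs Q(3) nth_mem [of l rs] by (auto simp: K_def)
  ultimately show ?thesis by blast
qed

text \<open>The components of \<open>A\<close> and of \<open>B\<close> partition \<open>W\<close>,
  and disjoint ones do not interleave, so their spans are nested or disjoint. Hence the class of a
  vertex is the one whose span contains it and starts last.\<close>

lemma few_comps_decode:
  fixes pos :: "'a \<Rightarrow> nat"
  assumes fin: "finite W" and inj: "inj_on pos W" and bd: "\<And>x. x \<in> W \<Longrightarrow> pos x < N" and "N \<ge> 1"
    and nc: "\<And>a b c d. {a, b, c, d} \<subseteq> W \<Longrightarrow> pos a < pos b \<Longrightarrow> pos b < pos c \<Longrightarrow> pos c < pos d \<Longrightarrow>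
               \<not> ({a, c} \<in> E \<and> {b, d} \<in> E)"
    and AB: "A \<union> B = W" "A \<inter> B = {}" and few: "few_comps m E A" "few_comps m E B"
  shows "\<exists>h \<in> {..<2 * m} \<rightarrow>\<^sub>E {0..N} \<times> {0..N}. A = span_decode W pos m h"
proof -
  obtain K1 where K1: "A = (\<Union>l<m. K1 l)" "\<And>l. l < m \<Longrightarrow> K1 l = {} \<or> (\<exists>r\<in>A. K1 l = (adj E A)\<^sup>* `` {r})"
    using few_comps_classes [OF few(1)] by metis
  obtain K2 where K2: "B = (\<Union>l<m. K2 l)" "\<And>l. l < m \<Longrightarrow> K2 l = {} \<or> (\<exists>r\<in>B. K2 l = (adj E B)\<^sup>* `` {r})"
    using few_comps_classes [OF few(2)] by metis
  define K where "K l = (if l < m then K1 l else K2 (l - m))" for l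
  define D where "D l = (if l < m then A else B)" for l
  have DW: "D l \<subseteq> W" for l using AB by (auto simp: D_def)
  have Kr: "K l = {} \<or> (\<exists>r\<in>D l. K l = (adj E (D l))\<^sup>* `` {r})" if "l < 2 * m" for l
    using that K1(2) [of l] K2(2) [of "l - m"] by (auto simp: K_def D_def)
  have KD: "K l \<subseteq> D l" if "l < 2 * m" for l
    using Kr [OF that] adj_rtrancl_image [of "{r}" "D l" E for r] by auto
  have Kx: "K l = (adj E (D l))\<^sup>* `` {x}" if l: "l < 2 * m" and x: "x \<in> K l" for l x
  proof -
    obtain r where r: "K l = (adj E (D l))\<^sup>* `` {r}" using Kr [OF l] x by auto
    then have "(r, x) \<in> (adj E (D l))\<^sup>*" using that by blast
    then show ?thesis unfolding r using adj_rtrancl_sym [of r x] by (auto intro: rtrancl_trans)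
  qed
  have Keq: "K l = K l'" if "l < 2 * m" "l' < 2 * m" "x \<in> K l" "x \<in> K l'" for l l' x
  proof -
    have "x \<in> D l" "x \<in> D l'" using that KD by blast+
    then have "D l = D l'" using AB unfolding D_def by (auto split: if_splits)
    then show ?thesis using Kx that by metis
  qed
  \<comment> \<open>The pair \<open>(1, 0)\<close> is an interval without positions. Restricting
    \<open>h\<close> to its index range makes it a member of a finite function space that can be
    counted.\<close>
  define h where "h = (\<lambda>l\<in>{..<2 * m}. if K l = {} then (1, 0) else (Min (pos ` K l), Max (pos ` K l)))"
  have KW: "K l \<subseteq> W" if "l < 2 * m" for l using KD [OF that] DW by blast
  have finK: "finite (pos ` K l)" if "l < 2 * m" for l using KW [OF that] fin finite_subset by blast
  have ends: "\<exists>u\<in>K l. \<exists>v\<in>K l. fst (h l) = pos u \<and> snd (h l) = pos v \<and> (\<forall>x\<in>K l. pos u \<le> pos x \<and> pos x \<le> pos v)"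
    if l: "l < 2 * m" and n: "K l \<noteq> {}" for l
  proof -
    have "Min (pos ` K l) \<in> pos ` K l" "Max (pos ` K l) \<in> pos ` K l" using finK [OF l] n by auto
    then obtain u v where "u \<in> K l" "v \<in> K l" "Min (pos ` K l) = pos u" "Max (pos ` K l) = pos v" by blast
    moreover have "\<forall>x\<in>K l. Min (pos ` K l) \<le> pos x \<and> pos x \<le> Max (pos ` K l)" using finK [OF l] by auto
    ultimately show ?thesis using l n by (auto simp: h_def)
  qed
  have emp: "K l \<noteq> {}" if "l < 2 * m" "fst (h l) \<le> i" "i \<le> snd (h l)" for l i
    using that by (auto simp: h_def split: if_splits)
  have "h l \<in> {0..N} \<times> {0..N}" if l: "l < 2 * m" for l
  proof (cases "K l = {}")
    case True
    then show ?thesis using l \<open>N \<ge> 1\<close> by (simp add: h_def)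
  next
    case False
    obtain u v where "u \<in> K l" "v \<in> K l" "fst (h l) = pos u" "snd (h l) = pos v" using ends [OF l False] by blast
    moreover have "pos u \<le> N" "pos v \<le> N" using bd KW [OF l] calculation by (meson less_imp_le subsetD)+
    ultimately show ?thesis by (cases "h l") auto
  qed
  then have hE: "h \<in> {..<2 * m} \<rightarrow>\<^sub>E {0..N} \<times> {0..N}" by (auto simp: h_def)
  \<comment> \<open>A span of another class that contains \<open>x\<close> but starts later would
    have \<open>u < u' < x < v'\<close> in position, which is an interleaving.\<close>
  have inner: "fst (h l') \<le> fst (h l)"
    if l: "l < 2 * m" "x \<in> K l" and l': "l' < 2 * m" "fst (h l') \<le> pos x" "pos x \<le> snd (h l')" for l l' x
  proof (cases "x \<in> K l'")
    case True
    then show ?thesis using Keq [OF l(1) l'(1) l(2)] l l' by (simp add: h_def)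
  next
    case False
    show ?thesis
    proof (rule ccontr)
      assume less: "\<not> fst (h l') \<le> fst (h l)"
      obtain u v where uv: "u \<in> K l" "v \<in> K l" "fst (h l) = pos u" using ends [OF l(1)] l(2) by blast
      obtain u' v' where uv': "u' \<in> K l'" "v' \<in> K l'" "fst (h l') = pos u'" "snd (h l') = pos v'"
        using ends [OF l'(1) emp [OF l']] by blast
      have "x \<in> W" "u' \<in> W" "v' \<in> W" using KW l l' uv' by blast+
      then have "pos u' \<noteq> pos x" "pos v' \<noteq> pos x"
        using inj False uv' by (metis inj_onD)+
      then have ord: "pos u < pos u'" "pos u' < pos x" "pos x < pos v'" using less uv uv' l' by linarith+
      have dis: "K l \<inter> K l' = {}" using Keq [OF l(1) l'(1)] l(2) False by blast
      have k1: "K l = (adj E (D l))\<^sup>* `` {u}" and k2: "K l' = (adj E (D l'))\<^sup>* `` {u'}"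
        using Kx [OF l(1) uv(1)] Kx [OF l'(1) uv'(1)] by simp_all
      show False
      proof (rule connected_sets_noncrossing [OF inj DW DW nc])
        show "u \<in> D l" "u' \<in> D l'" using uv uv' KD l l' by blast+
        show "(u, x) \<in> (adj E (D l))\<^sup>*" using k1 l(2) by blast
        show "(u', v') \<in> (adj E (D l'))\<^sup>*" using k2 uv'(2) by blast
        show "(adj E (D l))\<^sup>* `` {u} \<inter> (adj E (D l'))\<^sup>* `` {u'} = {}" using dis k1 k2 by simp
      qed (use ord in simp_all)
    qed
  qed
  have inK: "fst (h l) \<le> pos x \<and> pos x \<le> snd (h l)" if "l < 2 * m" "x \<in> K l" for l x
    using ends [OF that(1)] that(2) by fastforce
  have cover: "\<exists>l<2 * m. x \<in> K l" if "x \<in> W" for x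
  proof (cases "x \<in> A")
    case True
    then obtain l where "l < m" "x \<in> K1 l" using K1(1) by blast
    then show ?thesis by (intro exI [of _ l]) (auto simp: K_def)
  next
    case False
    then have "x \<in> B" using AB that by blast
    then obtain l where "l < m" "x \<in> K2 l" using K2(1) by blast
    then show ?thesis by (intro exI [of _ "l + m"]) (auto simp: K_def)
  qed
  have "A = span_decode W pos m h"
  proof
    show "A \<subseteq> span_decode W pos m h"
    proof
      fix x assume x: "x \<in> A"
      then obtain l where l: "l < m" "x \<in> K1 l" using K1(1) by blast
      then have "l < 2 * m" "x \<in> K l" by (auto simp: K_def)
      then show "x \<in> span_decode W pos m h" unfolding span_decode_def
        using l x AB inner [of l x] inK by blast
    qed
    show "span_decode W pos m h \<subseteq> A"
    proof
      fix x assume "x \<in> span_decode W pos m h"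
      then obtain l where x: "x \<in> W" and l: "l < m" "fst (h l) \<le> pos x" "pos x \<le> snd (h l)"
        and mx: "\<And>l'. l' < 2 * m \<Longrightarrow> fst (h l') \<le> pos x \<Longrightarrow> pos x \<le> snd (h l') \<Longrightarrow> fst (h l') \<le> fst (h l)"
        by (auto simp: span_decode_def)
      have l2: "l < 2 * m" using l by simp
      obtain l0 where l0: "l0 < 2 * m" "x \<in> K l0" using cover [OF x] by blast
      \<comment> \<open>\<open>l0\<close> is the true class of \<open>x\<close> and \<open>l\<close>
        the one chosen by decoding. Equal left ends mean the same first vertex, since positions are
        injective, hence the same class.\<close>
      have "fst (h l0) = fst (h l)"
        using mx [OF l0(1)] inK [OF l0] inner [OF l0 l2 l(2,3)] by (meson le_antisym)
      moreover obtain u where u: "u \<in> K l" "fst (h l) = pos u" using ends [OF l2 emp [OF l2 l(2,3)]] by blast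
      moreover obtain u0 where u0: "u0 \<in> K l0" "fst (h l0) = pos u0" using ends [OF l0(1)] l0(2) by blast
      ultimately have "u = u0" using inj KW [OF l2] KW [OF l0(1)] by (metis inj_onD subsetD)
      then have "K l0 = K l" using Keq [OF l0(1) l2 u0(1)] u by simp
      then show "x \<in> A" using l0(2) KD [OF l2] l(1) by (auto simp: D_def)
    qed
  qed
  then show ?thesis using hE by blast
qed

text \<open>Outside \<open>T\<close> the set is decoded from \<open>2 * m\<close> intervals, each
  given by two of \<open>card V + 1\<close> numbers, which accounts for the exponent
  \<open>4 * m\<close>; inside \<open>T\<close> it is arbitrary.\<close>

theorem few_comps_count:
  fixes V :: "'a set"
  assumes V: "finite V" "T \<subseteq> V" "V \<noteq> {}"
    and ord: "distinct vs" "set vs = V - T" "noncrossing E vs"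
  shows "finite {X. X \<subseteq> V \<and> few_comps m E (X - T) \<and> few_comps m E (V - X - T)}"
    and "card {X. X \<subseteq> V \<and> few_comps m E (X - T) \<and> few_comps m E (V - X - T)}
       \<le> (card V + 1) ^ (4 * m) * 2 ^ card T"
proof -
  let ?F = "{X. X \<subseteq> V \<and> few_comps m E (X - T) \<and> few_comps m E (V - X - T)}"
  let ?N = "card V"
  let ?H = "({..<2 * m} \<rightarrow>\<^sub>E {0..?N} \<times> {0..?N}) \<times> Pow T"
  show "finite ?F" using V(1) by simp
  define pos where "pos x = (THE i. i < length vs \<and> vs ! i = x)" for x
  have pos: "pos x < length vs \<and> vs ! pos x = x" if "x \<in> set vs" for x
    unfolding pos_def
    by (rule theI') (use that ord(1) in \<open>metis distinct_Ex1\<close>)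
  have inj: "inj_on pos (V - T)" by (rule inj_onI) (metis pos ord(2))
  have len: "length vs \<le> ?N"
    using ord V distinct_card [of vs] card_mono [of V "V - T"] by auto
  have bd: "pos x < ?N" if "x \<in> V - T" for x using pos [of x] that ord len by auto
  have nc: "\<not> ({a, c} \<in> E \<and> {b, d} \<in> E)"
    if "{a, b, c, d} \<subseteq> V - T" "pos a < pos b" "pos b < pos c" "pos c < pos d" for a b c d
  proof -
    have m: "{a, b, c, d} \<subseteq> set vs" using that ord by simp
    have "subseq (map ((!) vs) [pos a, pos b, pos c, pos d]) vs"
      using that pos m by (intro subseq_nth) auto
    then have "subseq [a, b, c, d] vs" using pos m by simp
    then show ?thesis using ord(3) unfolding noncrossing_def by blast
  qed
  have N: "?N \<ge> 1" using V card_gt_0_iff by (metis One_nat_def Suc_leI)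
  have "?F \<subseteq> (\<lambda>(h, Y). span_decode (V - T) pos m h \<union> Y) ` ?H"
  proof
    fix X assume X: "X \<in> ?F"
    have "X - T \<union> (V - X - T) = V - T" "(X - T) \<inter> (V - X - T) = {}" using X by auto
    with few_comps_decode [of "V - T" pos ?N E "X - T" "V - X - T" m, OF _ inj bd N nc] X V
    obtain h where "h \<in> {..<2 * m} \<rightarrow>\<^sub>E {0..?N} \<times> {0..?N}" "X - T = span_decode (V - T) pos m h"
      by blast
    then show "X \<in> (\<lambda>(h, Y). span_decode (V - T) pos m h \<union> Y) ` ?H"
      by (intro image_eqI [of _ _ "(h, X \<inter> T)"]) auto
  qed
  moreover have finH: "finite ?H" using V finite_subset [of T V] by (auto intro!: finite_PiE)
  ultimately have "card ?F \<le> card ?H" by (rule surj_card_le [rotated])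
  also have "card ?H = ((?N + 1) * (?N + 1)) ^ (2 * m) * 2 ^ card T"
    using V finite_subset [of T V] by (simp add: card_cartesian_product card_PiE card_Pow)
  also have "((?N + 1) * (?N + 1)) ^ (2 * m) = (?N + 1) ^ (4 * m)"
    by (simp only: power2_eq_square [symmetric] power_mult [symmetric]) simp
  finally show "card ?F \<le> (?N + 1) ^ (4 * m) * 2 ^ card T" .
qed

section \<open>Dynamic programming over partial paths\<close>

lemma pedges_conv_nth: "pedges l \<subseteq> E \<longleftrightarrow> (\<forall>i. Suc i < length l \<longrightarrow> {l ! i, l ! Suc i} \<in> E)"
proof (induction l rule: pedges.induct)
  case (3 x y l)
  have "(\<forall>i. Suc i < length (x # y # l) \<longrightarrow> {(x # y # l) ! i, (x # y # l) ! Suc i} \<in> E) \<longleftrightarrow>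
     {x, y} \<in> E \<and> (\<forall>i. Suc i < length (y # l) \<longrightarrow> {(y # l) ! i, (y # l) ! Suc i} \<in> E)" (is "?L \<longleftrightarrow> ?R")
  proof
    assume L: ?L
    show ?R using L [rule_format, of 0] L [rule_format, of "Suc i" for i] by simp
  next
    assume R: ?R
    show ?L
    proof (intro allI impI)
      fix i assume "Suc i < length (x # y # l)"
      then show "{(x # y # l) ! i, (x # y # l) ! Suc i} \<in> E" using R by (cases i) auto
    qed
  qed
  then show ?case using 3 by simp
qed auto

text \<open>A component can begin only at the head of the path or directly behind a vertex of
  \<open>T\<close>. Charging the head separately is what makes the induction go through.\<close>

lemma few_comps_path:
  assumes "distinct q" "pedges q \<subseteq> E"
  shows "\<exists>Q. Q \<subseteq> set q - T \<and> set q - T \<subseteq> (adj E (set q - T))\<^sup>* `` Q \<and>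
     card Q \<le> card (set q \<inter> T) + (if q \<noteq> [] \<and> hd q \<notin> T then 1 else 0)"
  using assms
proof (induction q rule: pedges.induct)
  case 1
  show ?case by simp
next
  case (2 x)
  show ?case
  proof (cases "x \<in> T")
    case True
    then show ?thesis by simp
  next
    case False
    then show ?thesis by (intro exI [of _ "{x}"]) auto
  qed
next
  case (3 x y l)
  let ?q = "y # l"
  obtain Q where Q: "Q \<subseteq> set ?q - T" "set ?q - T \<subseteq> (adj E (set ?q - T))\<^sup>* `` Q"
    "card Q \<le> card (set ?q \<inter> T) + (if y \<notin> T then 1 else 0)" using 3 by auto
  have xq: "x \<notin> set ?q" and xy: "{x, y} \<in> E" using 3 by auto
  show ?case
  proof (cases "x \<in> T")
    case True
    then have "set (x # ?q) - T = set ?q - T" "set (x # ?q) \<inter> T = insert x (set ?q \<inter> T)" by auto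
    moreover have "card (insert x (set ?q \<inter> T)) = Suc (card (set ?q \<inter> T))" using xq by simp
    ultimately show ?thesis using Q True by (intro exI [of _ Q]) (auto split: if_splits)
  next
    case False
    let ?A = "set ?q - T" and ?B = "set (x # ?q) - T"
    have B: "?B = insert x ?A" "set (x # ?q) \<inter> T = set ?q \<inter> T" using False by auto
    have "adj E ?A \<subseteq> adj E ?B" by (auto simp: adj_def)
    then have mono: "(adj E ?A)\<^sup>* \<subseteq> (adj E ?B)\<^sup>*" by (rule rtrancl_mono)
    show ?thesis
    proof (cases "y \<in> T")
      case True
      have "finite Q" using Q(1) finite_subset by blast
      then have "card (insert x Q) \<le> card (set ?q \<inter> T) + 1" using Q(3) True card_insert_le_m1
        by (simp add: card_insert_if)
      moreover have "?B \<subseteq> (adj E ?B)\<^sup>* `` insert x Q" using Q(2) mono B by blast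
      moreover have "insert x Q \<subseteq> ?B" using Q(1) B by blast
      ultimately show ?thesis using B False by (intro exI [of _ "insert x Q"]) simp
    next
      case yT: False
      then obtain r where r: "r \<in> Q" "(r, y) \<in> (adj E ?A)\<^sup>*" using Q(2) by auto
      have "(y, x) \<in> adj E ?B" using xy False yT by (auto simp: adj_def insert_commute)
      then have "(r, x) \<in> (adj E ?B)\<^sup>*" using r(2) mono by (meson rtrancl_into_rtrancl subsetD)
      then have "x \<in> (adj E ?B)\<^sup>* `` Q" using r(1) by blast
      moreover have "?A \<subseteq> (adj E ?B)\<^sup>* `` Q" using Q(2) mono by blast
      ultimately have "?B \<subseteq> (adj E ?B)\<^sup>* `` Q" using B(1) by simp
      moreover have "Q \<subseteq> ?B" using Q(1) B by blast
      ultimately show ?thesis using Q(3) B False yT by (intro exI [of _ Q]) simp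
    qed
  qed
qed

lemma few_comps_path_minus:
  assumes "distinct q" "pedges q \<subseteq> E" "finite T"
  shows "few_comps (card T + 1) E (set q - T)"
proof -
  obtain Q where Q: "Q \<subseteq> set q - T" "set q - T \<subseteq> (adj E (set q - T))\<^sup>* `` Q"
     "card Q \<le> card (set q \<inter> T) + (if q \<noteq> [] \<and> hd q \<notin> T then 1 else 0)"
    using few_comps_path [OF assms(1,2), of T] by blast
  have "card (set q \<inter> T) \<le> card T" using assms(3) by (intro card_mono) auto
  then have "card Q \<le> card T + 1" using Q(3) by (auto split: if_splits)
  moreover have "finite Q" using Q(1) finite_subset by blast
  ultimately show ?thesis using Q unfolding few_comps_def by blast
qed

lemma path_cost_snoc:
  assumes "q \<noteq> []" shows "path_cost c (q @ [u]) = path_cost c q + c {last q, u}"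
proof -
  obtain m where m: "length q = Suc m" using assms by (cases q) auto
  have "path_cost c (q @ [u]) = (\<Sum>i<Suc m. c {(q @ [u]) ! i, (q @ [u]) ! Suc i})"
    using m by (simp add: path_cost_def)
  also have "\<dots> = (\<Sum>i<m. c {q ! i, q ! Suc i}) + c {q ! m, u}"
    using m by (simp add: nth_append)
  also have "q ! m = last q" using m assms by (simp add: last_conv_nth)
  finally show ?thesis using m by (simp add: path_cost_def)
qed

text \<open>Set and last vertex decide which extensions are possible; the first vertex fixes the
  closing edge of a cycle.\<close>

definition key :: "nat list \<Rightarrow> nat set \<times> nat \<times> nat" where
  "key q = (set q, last q, hd q)"

lemma key_snoc: "q \<noteq> [] \<Longrightarrow> key (q @ [u]) = (insert u (set q), u, hd q)"
  by (simp add: key_def)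

locale dp =
  fixes n :: nat and E :: "nat set set" and \<pi> :: "(nat \<times> nat) set" and c :: "nat set \<Rightarrow> real" and T :: "nat set"
  assumes n: "n \<ge> 1" and sg: "sgraph {0..<n} E" and po: "partial_order_on {0..<n} \<pi>" and T: "T \<subseteq> {0..<n}"
begin

abbreviation "V \<equiv> {0..<n}"

definition partial_path :: "nat list \<Rightarrow> bool" where
  "partial_path q \<longleftrightarrow> q \<noteq> [] \<and> distinct q \<and> set q \<subseteq> V \<and> pedges q \<subseteq> E \<and> extending \<pi> q"

definition ext :: "nat list \<Rightarrow> nat \<Rightarrow> bool" where
  "ext q u \<longleftrightarrow> u < n \<and> u \<notin> set q \<and> {last q, u} \<in> E \<and> (\<forall>w\<in>set q. (u, w) \<notin> \<pi>)"

definition good :: "nat set \<Rightarrow> bool" where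
  "good X \<longleftrightarrow> few_comps (card T + 1) E (V - X - T)"

lemma finT: "finite T"
  using T finite_subset by blast

lemma extending_snoc:
  "extending \<pi> (q @ [u]) \<longleftrightarrow> extending \<pi> q \<and> (\<forall>w\<in>set q. (u, w) \<notin> \<pi>)"
proof
  assume e: "extending \<pi> (q @ [u])"
  have "extending \<pi> q" unfolding extending_def
  proof (intro allI impI)
    fix i j assume "i < length q" "j < length q" "(q ! i, q ! j) \<in> \<pi>"
    then show "i \<le> j" using e [unfolded extending_def, rule_format, of i j] by (simp add: nth_append)
  qed
  moreover have "(u, w) \<notin> \<pi>" if w: "w \<in> set q" for w
  proof
    assume uw: "(u, w) \<in> \<pi>"
    obtain j where "j < length q" "w = q ! j" using w by (metis in_set_conv_nth)
    then show False using e [unfolded extending_def, rule_format, of "length q" j] uw by (simp add: nth_append)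
  qed
  ultimately show "extending \<pi> q \<and> (\<forall>w\<in>set q. (u, w) \<notin> \<pi>)" by blast
next
  assume e: "extending \<pi> q \<and> (\<forall>w\<in>set q. (u, w) \<notin> \<pi>)"
  show "extending \<pi> (q @ [u])" unfolding extending_def
  proof (intro allI impI)
    fix i j assume ij: "i < length (q @ [u])" "j < length (q @ [u])" "((q @ [u]) ! i, (q @ [u]) ! j) \<in> \<pi>"
    show "i \<le> j"
    proof (cases "j < length q")
      case True
      then have "i \<noteq> length q" using e ij by (auto simp: nth_append)
      then have "i < length q" using ij by auto
      then show ?thesis using e ij True by (auto simp: extending_def nth_append)
    next
      case False
      then show ?thesis using ij by auto
    qed
  qed
qed

lemma pre_snoc:
  assumes "q \<noteq> []" shows "partial_path (q @ [u]) \<longleftrightarrow> partial_path q \<and> ext q u"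
proof -
  obtain q' where q': "q = q' @ [last q]" using assms by (metis append_butlast_last_id)
  have "pedges (q @ [u]) = insert {last q, u} (pedges q)"
    using pedges_snoc2 [of q' "last q" u] q' by (metis append.assoc append_Cons append_Nil)
  then show ?thesis using assms unfolding partial_path_def ext_def extending_snoc by auto
qed

lemma pre_singleton: "f < n \<Longrightarrow> partial_path [f]"
  by (simp add: partial_path_def extending_def)

lemma POHP_iff: "POHP V E \<pi> vs \<longleftrightarrow> partial_path vs \<and> length vs = n"
proof
  assume "POHP V E \<pi> vs"
  then have h: "distinct vs" "set vs = V" "pedges vs \<subseteq> E" "extending \<pi> vs"
    by (auto simp: POHP_def ordered_ham_path_def pedges_conv_nth)
  then have "length vs = n" using distinct_card by fastforce
  then show "partial_path vs \<and> length vs = n" using h n by (auto simp: partial_path_def)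
next
  assume p: "partial_path vs \<and> length vs = n"
  then have "set vs = V" using card_subset_eq [of V "set vs"] distinct_card [of vs] by (auto simp: partial_path_def)
  then show "POHP V E \<pi> vs" using p by (auto simp: POHP_def ordered_ham_path_def pedges_conv_nth partial_path_def)
qed

text \<open>An extension has to be represented only by some state with the same key at no greater
  cost, a property that later improvements of states preserve.\<close>

definition served :: "nat list list \<Rightarrow> nat \<Rightarrow> nat \<Rightarrow> bool" where
  "served ps i u \<longleftrightarrow> (good (set (ps ! i)) \<longrightarrow> ext (ps ! i) u \<longrightarrow>
     (\<exists>j<length ps. key (ps ! j) = key (ps ! i @ [u]) \<and> path_cost c (ps ! j) \<le> path_cost c (ps ! i @ [u])))"

text \<open>The states before \<open>i\<close> are completely processed, and state \<open>i\<close> has been tried with the vertices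
  below \<open>u\<close>.  Because states are sorted by length, an improvement never touches a processed state.\<close>

definition search_inv :: "nat \<Rightarrow> nat \<Rightarrow> nat list list \<Rightarrow> bool" where
  "search_inv i u ps \<longleftrightarrow>
     (\<forall>j<length ps. partial_path (ps ! j) \<and> (length (ps ! j) = 1 \<or> good (set (butlast (ps ! j))))) \<and>
     (\<forall>j<length ps. \<forall>j'<length ps. key (ps ! j) = key (ps ! j') \<longrightarrow> j = j') \<and>
     (\<forall>f<n. f < length ps \<and> ps ! f = [f]) \<and>
     (\<forall>j<length ps. \<forall>j'<length ps. j \<le> j' \<longrightarrow> length (ps ! j) \<le> length (ps ! j')) \<and>
     (i < length ps \<longrightarrow> (\<forall>j<length ps. length (ps ! j) \<le> length (ps ! i) + 1)) \<and>
     (\<forall>i'<length ps. \<forall>u'. (i' < i \<or> i' = i \<and> u' < u) \<longrightarrow> served ps i' u')"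

lemma inv_served:
  assumes "search_inv i u ps" "i' < length ps" "i' < i \<or> i' = i \<and> u' < u" "good (set (ps ! i'))" "ext (ps ! i') u'"
  obtains j where "j < length ps" "key (ps ! j) = key (ps ! i' @ [u'])"
    "path_cost c (ps ! j) \<le> path_cost c (ps ! i' @ [u'])"
proof -
  have "\<forall>i'<length ps. \<forall>u'. (i' < i \<or> i' = i \<and> u' < u) \<longrightarrow> served ps i' u'"
    using assms(1) unfolding search_inv_def by (elim conjE)
  then have "served ps i' u'" using assms(2,3) by blast
  then show thesis using assms(4,5) that unfolding served_def by blast
qed

lemma inv_singleton: "search_inv i u ps \<Longrightarrow> f < n \<Longrightarrow> f < length ps \<and> ps ! f = [f]"
  by (simp add: search_inv_def)

lemma inv_init: "search_inv 0 0 (map (\<lambda>f. [f]) [0..<n])"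
  by (auto simp: search_inv_def pre_singleton key_def)

lemma inv_next:
  assumes "search_inv i n ps" shows "search_inv (Suc i) 0 ps"
proof -
  have 1: "length (ps ! j) \<le> length (ps ! Suc i) + 1" if "Suc i < length ps" "j < length ps" for j
    using assms that unfolding search_inv_def by (meson Suc_lessD le_trans lessI less_imp_le add_le_mono1)
  \<comment> \<open>Numbers from \<open>n\<close> on are no vertices and hence no extensions, so
    \<open>n\<close> trials settle all of them.\<close>
  have 2: "served ps i' u'" if "i' < length ps" "i' < Suc i" for i' u'
  proof (cases "i' = i \<and> \<not> u' < n")
    case True
    then show ?thesis by (auto simp: served_def ext_def)
  next
    case False
    then have "i' < i \<or> i' = i \<and> u' < n" using that by auto
    moreover have "\<forall>i'<length ps. \<forall>u'. (i' < i \<or> i' = i \<and> u' < n) \<longrightarrow> served ps i' u'"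
      using assms unfolding search_inv_def by (elim conjE)
    ultimately show ?thesis using that(1) by blast
  qed
  show ?thesis using assms unfolding search_inv_def
    by (intro conjI allI impI) (use 1 2 in \<open>auto simp: search_inv_def\<close>)
qed

lemma inv_serve:
  assumes "search_inv i u ps" "served ps i u" shows "search_inv i (Suc u) ps"
  using assms unfolding search_inv_def less_Suc_eq by auto

lemma inv_skip_all:
  assumes "search_inv i 0 ps" "\<not> good (set (ps ! i))" shows "search_inv i n ps"
proof -
  have "search_inv i u ps" for u
  proof (induction u)
    case (Suc u)
    then show ?case using assms(2) by (intro inv_serve) (auto simp: served_def)
  qed (use assms in simp)
  then show ?thesis .
qed

lemma inv_skip:
  assumes "search_inv i u ps" "\<not> ext (ps ! i) u" shows "search_inv i (Suc u) ps"
  using assms by (intro inv_serve) (auto simp: served_def)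

lemma inv_keep:
  assumes "search_inv i u ps" "j < length ps" "key (ps ! j) = key (ps ! i @ [u])"
    "path_cost c (ps ! j) \<le> path_cost c (ps ! i @ [u])"
  shows "search_inv i (Suc u) ps"
  using assms by (intro inv_serve) (auto simp: served_def)

text \<open>The new path is one longer than state \<open>i\<close>, which by the invariant is the
  maximal length; the end of the list is therefore the right place for it.\<close>

lemma inv_append:
  assumes I: "search_inv i u ps" and i: "i < length ps" "good (set (ps ! i))" "ext (ps ! i) u"
    and new: "\<And>j. j < length ps \<Longrightarrow> key (ps ! j) \<noteq> key (ps ! i @ [u])"
  shows "search_inv i (Suc u) (ps @ [ps ! i @ [u]])"
proof -
  let ?q = "ps ! i @ [u]"
  have p: "partial_path (ps ! i)" using I i(1) by (simp add: search_inv_def)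
  then have ne: "ps ! i \<noteq> []" by (simp add: partial_path_def)
  have q: "partial_path ?q" using p i(3) pre_snoc [OF ne] by blast
  have nth: "(ps @ [?q]) ! j = (if j < length ps then ps ! j else ?q)" if "j < length (ps @ [?q])" for j
    using that by (auto simp: nth_append less_Suc_eq)
  show ?thesis unfolding search_inv_def served_def
  proof (intro conjI allI impI)
    fix j assume j: "j < length (ps @ [?q])"
    show "partial_path ((ps @ [?q]) ! j)" using I q j by (auto simp: nth search_inv_def)
    show "length ((ps @ [?q]) ! j) = 1 \<or> good (set (butlast ((ps @ [?q]) ! j)))"
      using I i j by (auto simp: nth search_inv_def)
    show "length ((ps @ [?q]) ! j) \<le> length ((ps @ [?q]) ! i) + 1"
      using I i j by (auto simp: nth search_inv_def)
    fix j' assume j': "j' < length (ps @ [?q])"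
    show "j = j'" if "key ((ps @ [?q]) ! j) = key ((ps @ [?q]) ! j')"
    proof (cases "j < length ps"; cases "j' < length ps")
      assume "j < length ps" "j' < length ps"
      then show ?thesis using I that by (auto simp: nth_append search_inv_def)
    next
      assume "j < length ps" "\<not> j' < length ps"
      then show ?thesis using new [of j] that j' by (auto simp: nth_append less_Suc_eq)
    next
      assume "\<not> j < length ps" "j' < length ps"
      then show ?thesis using new [of j'] that j by (auto simp: nth_append less_Suc_eq)
    qed (use j j' in auto)
    show "length ((ps @ [?q]) ! j) \<le> length ((ps @ [?q]) ! j')" if "j \<le> j'"
      using I i j j' that by (auto simp: nth search_inv_def)
  next
    fix f assume "f < n"
    then show "f < length (ps @ [?q])" "(ps @ [?q]) ! f = [f]" using I by (auto simp: nth_append search_inv_def)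
  next
    fix i' u' assume i': "i' < length (ps @ [?q])" and or: "i' < i \<or> i' = i \<and> u' < Suc u"
      and g: "good (set ((ps @ [?q]) ! i'))" "ext ((ps @ [?q]) ! i') u'"
    have l: "i' < length ps" and e: "(ps @ [?q]) ! i' = ps ! i'" using or i(1) by (auto simp: nth_append)
    show "\<exists>j<length (ps @ [?q]). key ((ps @ [?q]) ! j) = key ((ps @ [?q]) ! i' @ [u']) \<and>
            path_cost c ((ps @ [?q]) ! j) \<le> path_cost c ((ps @ [?q]) ! i' @ [u'])"
    proof (cases "i' = i \<and> u' = u")
      case True
      then show ?thesis using e by (intro exI [of _ "length ps"]) simp
    next
      case False
      then have "i' < i \<or> i' = i \<and> u' < u" using or by auto
      then obtain j where "j < length ps" "key (ps ! j) = key (ps ! i' @ [u'])"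
        "path_cost c (ps ! j) \<le> path_cost c (ps ! i' @ [u'])" using inv_served [OF I l] g e by metis
      then show ?thesis using e by (intro exI [of _ j]) (simp add: nth_append)
    qed
  qed
qed

lemma pre_length: "partial_path q \<Longrightarrow> length q = card (set q)"
  by (simp add: partial_path_def distinct_card)

text \<open>Equal keys imply equal lengths, so the improved state is longer than state
  \<open>i\<close> and comes after it. Lengths and keys of all states stay as they were and costs
  only fall.\<close>

lemma inv_replace:
  assumes I: "search_inv i u ps" and i: "i < length ps" "good (set (ps ! i))" "ext (ps ! i) u"
    and j: "j < length ps" "key (ps ! j) = key (ps ! i @ [u])" "path_cost c (ps ! i @ [u]) < path_cost c (ps ! j)"
  shows "search_inv i (Suc u) (ps[j := ps ! i @ [u]])"
proof -
  let ?q = "ps ! i @ [u]"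
  let ?ps = "ps[j := ?q]"
  have p: "partial_path (ps ! i)" using I i(1) by (simp add: search_inv_def)
  then have ne: "ps ! i \<noteq> []" by (simp add: partial_path_def)
  have q: "partial_path ?q" using p i(3) pre_snoc [OF ne] by blast
  have pj: "partial_path (ps ! j)" using I j(1) by (simp add: search_inv_def)
  have len: "length (ps ! j) = length ?q" using pre_length [OF q] pre_length [OF pj] j(2) by (simp add: key_def)
  then have gt: "length (ps ! i) < length (ps ! j)" by simp
  have ji: "i < j"
  proof (rule ccontr)
    assume "\<not> i < j"
    then have "length (ps ! j) \<le> length (ps ! i)" using I i(1) j(1) unfolding search_inv_def by (meson not_less)
    then show False using gt by simp
  qed
  have L: "length ?ps = length ps" by simp
  have len': "length (?ps ! k) = length (ps ! k)" if "k < length ps" for k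
    using that len by (cases "k = j") auto
  have key': "key (?ps ! k) = key (ps ! k)" if "k < length ps" for k
    using that j(2) by (cases "k = j") auto
  have cost': "path_cost c (?ps ! k) \<le> path_cost c (ps ! k)" if "k < length ps" for k
    using that j(3) by (cases "k = j") auto
  show ?thesis unfolding search_inv_def served_def L
  proof (intro conjI allI impI)
    fix k assume k: "k < length ps"
    show "partial_path (?ps ! k)" using I q k by (cases "k = j") (auto simp: search_inv_def)
    show "length (?ps ! k) = 1 \<or> good (set (butlast (?ps ! k)))"
      using I i k by (cases "k = j") (auto simp: search_inv_def)
    show "length (?ps ! k) \<le> length (?ps ! i) + 1"
      using I i k unfolding search_inv_def len' [OF k] len' [OF i(1)] by blast
    fix k' assume k': "k' < length ps"
    show "k = k'" if "key (?ps ! k) = key (?ps ! k')"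
      using I that k k' unfolding key' [OF k] key' [OF k'] search_inv_def by blast
    show "length (?ps ! k) \<le> length (?ps ! k')" if "k \<le> k'"
      using I that k k' unfolding len' [OF k] len' [OF k'] search_inv_def by blast
  next
    fix f assume f: "f < n"
    then have "f < length ps" "ps ! f = [f]" using I by (auto simp: search_inv_def)
    moreover have "f \<noteq> j" using calculation gt ne by auto
    ultimately show "f < length ps" "?ps ! f = [f]" by auto
  next
    fix i' u' assume i': "i' < length ps" and or: "i' < i \<or> i' = i \<and> u' < Suc u"
      and g: "good (set (?ps ! i'))" "ext (?ps ! i') u'"
    have e: "?ps ! i' = ps ! i'" using or ji by auto
    show "\<exists>k<length ps. key (?ps ! k) = key (?ps ! i' @ [u']) \<and>
            path_cost c (?ps ! k) \<le> path_cost c (?ps ! i' @ [u'])"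
    proof (cases "i' = i \<and> u' = u")
      case True
      then show ?thesis using e j(1) by (intro exI [of _ j]) simp
    next
      case False
      then have "i' < i \<or> i' = i \<and> u' < u" using or by auto
      then obtain k where k: "k < length ps" "key (ps ! k) = key (ps ! i' @ [u'])"
        "path_cost c (ps ! k) \<le> path_cost c (ps ! i' @ [u'])" using inv_served [OF I i'] g e by metis
      then show ?thesis using e key' [OF k(1)] cost' [OF k(1)] by (intro exI [of _ k]) auto
    qed
  qed
qed

lemma good_path:
  assumes "POHP V E \<pi> vs" "l \<le> length vs"
  shows "good (set (take l vs))"
proof -
  have vs: "distinct vs" "set vs = V" "pedges vs \<subseteq> E"
    using assms(1) by (auto simp: POHP_def ordered_ham_path_def pedges_conv_nth)
  have d: "distinct (take l vs @ drop l vs)" using vs(1) by simp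
  then have "V - set (take l vs) = set (drop l vs)"
    using vs(2) by (metis Diff_cancel Un_Diff Un_empty_left append_take_drop_id distinct_append set_append
        Diff_triv Int_commute)
  moreover have "pedges (drop l vs) \<subseteq> E"
  proof (cases "drop l vs")
    case (Cons y ys)
    then show ?thesis using vs(3) pedges_drop [of y ys "take l vs"] append_take_drop_id [of l vs] by auto
  qed simp
  ultimately show ?thesis using few_comps_path_minus [OF _ _ finT, of "drop l vs" E] vs(1)
    by (simp add: good_def)
qed

text \<open>By induction on the prefix, a state with the same key is at least as cheap. No prefix is
  lost to pruning, because the rest of \<open>vs\<close> is a path through the unvisited
  vertices.\<close>

lemma inv_optimal:
  assumes I: "search_inv (length ps) 0 ps" and vs: "POHP V E \<pi> vs" and l: "1 \<le> l" "l \<le> length vs"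
  shows "\<exists>j<length ps. key (ps ! j) = key (take l vs) \<and> path_cost c (ps ! j) \<le> path_cost c (take l vs)"
  using l
proof (induction l rule: dec_induct)
  case base
  have "hd vs < n" using vs n by (cases vs) (auto simp: POHP_iff partial_path_def)
  moreover have "take 1 vs = [hd vs]" using vs n by (cases vs) (auto simp: POHP_iff partial_path_def)
  ultimately show ?case using inv_singleton [OF I] by (intro exI [of _ "hd vs"]) simp
next
  case (step l)
  obtain j where j: "j < length ps" "key (ps ! j) = key (take l vs)" "path_cost c (ps ! j) \<le> path_cost c (take l vs)"
    using step by auto
  let ?u = "vs ! l"
  have tk: "take (Suc l) vs = take l vs @ [?u]" using step by (simp add: take_Suc_conv_app_nth)
  have ne: "take l vs \<noteq> []" using step by auto
  have pn: "ps ! j \<noteq> []" using I j(1) by (simp add: search_inv_def partial_path_def)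
  \<comment> \<open>Prefixes are reached from the full path by removing one vertex at a time;
    \<open>d\<close> counts the removed ones.\<close>
  have pre_take: "partial_path (take k vs)" if "1 \<le> k" "k \<le> length vs" for k
  proof -
    have *: "1 \<le> length vs - d \<Longrightarrow> partial_path (take (length vs - d) vs)" for d
    proof (induction d)
      case 0
      then show ?case using vs by (simp add: POHP_iff)
    next
      case (Suc d)
      then have "partial_path (take (length vs - d) vs)" by simp
      moreover have "take (length vs - d) vs = take (length vs - Suc d) vs @ [vs ! (length vs - Suc d)]"
      proof -
        have "Suc (length vs - Suc d) = length vs - d" "length vs - Suc d < length vs"
          using Suc.prems by simp_all
        then show ?thesis using take_Suc_conv_app_nth [of "length vs - Suc d" vs] by simp
      qed
      moreover have "take (length vs - Suc d) vs \<noteq> []" using Suc.prems by auto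
      ultimately show ?case using pre_snoc by metis
    qed
    show ?thesis using * [of "length vs - k"] that by simp
  qed
  have "partial_path (take l vs @ [?u])" using pre_take [of "Suc l"] tk step by simp
  then have "ext (take l vs) ?u" using pre_snoc [OF ne] by blast
  \<comment> \<open>Whether an extension is allowed depends on the path only through its key, so it
    carries over from the prefix to the recorded state.\<close>
  then have ex: "ext (ps ! j) ?u" using j(2) by (simp add: ext_def key_def)
  have g: "good (set (ps ! j))" using good_path [OF vs, of l] j(2) step by (simp add: key_def)
  obtain k where k: "k < length ps" "key (ps ! k) = key (ps ! j @ [?u])"
     "path_cost c (ps ! k) \<le> path_cost c (ps ! j @ [?u])"
    by (rule inv_served [OF I j(1) disjI1 [OF j(1)] g ex])
  have "key (ps ! j @ [?u]) = key (take (Suc l) vs)"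
    using j(2) unfolding tk key_snoc [OF ne] key_snoc [OF pn] by (simp add: key_def)
  moreover have "path_cost c (ps ! j @ [?u]) \<le> path_cost c (take (Suc l) vs)"
    using j(2,3) unfolding tk path_cost_snoc [OF ne] path_cost_snoc [OF pn] by (simp add: key_def)
  ultimately show ?case using k by (intro exI [of _ k]) auto
qed

text \<open>Keys are distinct, so counting keys suffices. Without its last vertex, a longer state
  visits a set that was expanded: the complement passed the test, and the set itself has few
  components as it is traversed by a path.\<close>

lemma inv_length:
  assumes I: "search_inv i u ps"
  shows "length ps \<le> n + n * n * card {X. X \<subseteq> V \<and> few_comps (card T + 1) E (X - T) \<and> few_comps (card T + 1) E (V - X - T)}"
    (is "_ \<le> n + n * n * card ?G")
proof -
  let ?S = "(\<lambda>f. ({f}, f, f)) ` V \<union> (\<lambda>((u, f), Y). (insert u Y, u, f)) ` ((V \<times> V) \<times> ?G)"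
  have finG: "finite ?G" by simp
  have fS: "finite ?S" using finG by simp
  have inj: "inj_on (\<lambda>j. key (ps ! j)) {0..<length ps}" using I by (auto simp: inj_on_def search_inv_def)
  have sub: "(\<lambda>j. key (ps ! j)) ` {0..<length ps} \<subseteq> ?S"
  proof
    fix x assume "x \<in> (\<lambda>j. key (ps ! j)) ` {0..<length ps}"
    then obtain j where j: "j < length ps" "x = key (ps ! j)" by auto
    have p: "partial_path (ps ! j)" and g: "length (ps ! j) = 1 \<or> good (set (butlast (ps ! j)))"
      using I j(1) by (auto simp: search_inv_def)
    show "x \<in> ?S"
    proof (cases "length (ps ! j) = 1")
      case True
      then obtain f where "ps ! j = [f]" by (metis One_nat_def length_0_conv length_Suc_conv)
      then show ?thesis using p j(2) by (auto simp: key_def partial_path_def)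
    next
      case False
      let ?b = "butlast (ps ! j)" and ?u = "last (ps ! j)"
      have s: "ps ! j = ?b @ [?u]" using p by (simp add: partial_path_def)
      have bn: "?b \<noteq> []" using False s p by (metis One_nat_def append_Nil length_Cons list.size(3))
      then have pb: "partial_path ?b" and e: "ext ?b ?u" using p pre_snoc [OF bn] s by metis+
      have "few_comps (card T + 1) E (set ?b - T)"
        using pb finT by (intro few_comps_path_minus) (auto simp: partial_path_def)
      then have "set ?b \<in> ?G" using g False pb by (auto simp: good_def partial_path_def)
      moreover have "?u \<in> V" using e by (simp add: ext_def)
      moreover have "hd ?b \<in> set ?b" using bn by simp
      then have "hd ?b \<in> V" using pb unfolding partial_path_def by blast
      moreover have "x = (insert ?u (set ?b), ?u, hd ?b)" using j(2) s key_snoc [OF bn] by metis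
      ultimately show ?thesis by (intro UnI2 image_eqI [of _ _ "((?u, hd ?b), set ?b)"]) auto
    qed
  qed
  have "length ps \<le> card ?S" using card_inj_on_le [OF inj sub fS] by simp
  also have "\<dots> \<le> card ((\<lambda>f. ({f}, f, f)) ` V) + card ((\<lambda>((u, f), Y). (insert u Y, u, f)) ` ((V \<times> V) \<times> ?G))"
    by (rule card_Un_le)
  also have "card ((\<lambda>f. ({f}, f, f)) ` V) \<le> n" using card_image_le [of V "\<lambda>f. ({f}, f, f)"] by simp
  also have "card ((\<lambda>((u, f), Y). (insert u Y, u, f)) ` ((V \<times> V) \<times> ?G)) \<le> card ((V \<times> V) \<times> ?G)"
    using finG by (intro card_image_le) auto
  also have "card ((V \<times> V) \<times> ?G) = n * n * card ?G" by (simp add: card_cartesian_product)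
  finally show ?thesis by simp
qed

end

section \<open>Program logic\<close>

text \<open>A weakest precondition for total correctness whose postcondition also sees the number of
  steps. Its equations for loop-free commands let the simplifier execute straight-line code.\<close>

definition runs :: "com \<Rightarrow> state \<Rightarrow> (nat \<Rightarrow> state \<Rightarrow> bool) \<Rightarrow> bool" where
  "runs c s Q \<longleftrightarrow> (\<exists>t s'. exec c s t s' \<and> Q t s')"

lemma upd_cell_apply [simp]:
  "upd_cell m x i j v y a b = (if y = x \<and> a = i \<and> b = j then v else m y a b)"
  by (auto simp: upd_cell_def)

lemma runs_Skip [simp]: "runs Skip s Q \<longleftrightarrow> Q 1 s"
  unfolding runs_def by (auto intro: exec_Skip [unfolded One_nat_def] elim: exec_SkipE)

lemma runs_NAssign [simp]:
  "runs (NAssign x a b e) s Q \<longleftrightarrow>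
     Q 1 (s\<lparr>nmem := upd_cell (nmem s) x (nval a s) (nval b s) (nval e s)\<rparr>)"
  unfolding runs_def by (auto intro: exec_NAssign [unfolded One_nat_def] elim: exec_NAssignE)

lemma runs_RAssign [simp]:
  "runs (RAssign x a b e) s Q \<longleftrightarrow>
     Q 1 (s\<lparr>rmem := upd_cell (rmem s) x (nval a s) (nval b s) (rval e s)\<rparr>)"
  unfolding runs_def by (auto intro: exec_RAssign [unfolded One_nat_def] elim: exec_RAssignE)

lemma runs_Seq [simp]:
  "runs (Seq c\<^sub>1 c\<^sub>2) s Q \<longleftrightarrow> runs c\<^sub>1 s (\<lambda>t\<^sub>1 s\<^sub>1. runs c\<^sub>2 s\<^sub>1 (\<lambda>t\<^sub>2 s\<^sub>2. Q (t\<^sub>1 + t\<^sub>2) s\<^sub>2))"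
  unfolding runs_def by (blast intro: exec_Seq elim: exec_SeqE)

lemma runs_Cond [simp]:
  "runs (Cond b c\<^sub>1 c\<^sub>2) s Q \<longleftrightarrow>
     (if bval b s then runs c\<^sub>1 s (\<lambda>t. Q (1 + t)) else runs c\<^sub>2 s (\<lambda>t. Q (1 + t)))"
proof (cases "bval b s")
  case True
  then show ?thesis unfolding runs_def
    by (auto elim!: exec_CondE intro: exec_CondTrue [of b s, simplified])
next
  case False
  then show ?thesis unfolding runs_def
    by (auto elim!: exec_CondE intro: exec_CondFalse [of b s, simplified])
qed

lemma runs_mono: "runs c s Q \<Longrightarrow> (\<And>t s'. Q t s' \<Longrightarrow> Q' t s') \<Longrightarrow> runs c s Q'"
  unfolding runs_def by blast

text \<open>The index of the invariant bounds the number of iterations still to come.\<close>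
lemma runs_While:
  assumes I: "I k s"
    and step: "\<And>k s. I k s \<Longrightarrow> bval b s \<Longrightarrow> \<exists>k'. k = Suc k' \<and> runs c s (\<lambda>t s'. t \<le> tb \<and> I k' s')"
  shows "runs (While b c) s (\<lambda>t s'. t \<le> k * (tb + 1) + 1 \<and> (\<exists>k'. I k' s') \<and> \<not> bval b s')"
  using I
proof (induction k arbitrary: s rule: less_induct)
  case (less k)
  show ?case
  proof (cases "bval b s")
    case False
    then show ?thesis unfolding runs_def using exec_WhileFalse [OF False] less.prems by fastforce
  next
    case True
    obtain k' where k': "k = Suc k'" "runs c s (\<lambda>t s'. t \<le> tb \<and> I k' s')"
      using step [OF less.prems True] by blast
    then obtain t1 s1 where 1: "exec c s t1 s1" "t1 \<le> tb" "I k' s1" by (auto simp: runs_def)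
    obtain t2 s2 where 2: "exec (While b c) s1 t2 s2" "t2 \<le> k' * (tb + 1) + 1" "\<exists>k'. I k' s2" "\<not> bval b s2"
      using less.IH [OF _ 1(3)] k'(1) by (auto simp: runs_def)
    have "exec (While b c) s (1 + t1 + t2) s2" using exec_WhileTrue [OF True 1(1) 2(1)] .
    moreover have "1 + t1 + t2 \<le> k * (tb + 1) + 1" using 1(2) 2(2) k'(1) by simp
    ultimately show ?thesis unfolding runs_def using 2 by blast
  qed
qed

section \<open>Frame conditions and counting loops\<close>

primrec nw :: "com \<Rightarrow> string set" where
  "nw Skip = {}"
| "nw (NAssign x a b e) = {x}"
| "nw (RAssign x a b e) = {}"
| "nw (Seq c d) = nw c \<union> nw d"
| "nw (Cond b c d) = nw c \<union> nw d"
| "nw (While b c) = nw c"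

primrec rw :: "com \<Rightarrow> string set" where
  "rw Skip = {}"
| "rw (NAssign x a b e) = {}"
| "rw (RAssign x a b e) = {x}"
| "rw (Seq c d) = rw c \<union> rw d"
| "rw (Cond b c d) = rw c \<union> rw d"
| "rw (While b c) = rw c"

definition frame :: "string set \<Rightarrow> string set \<Rightarrow> state \<Rightarrow> state \<Rightarrow> bool" where
  "frame A B s s' \<longleftrightarrow> (\<forall>x. x \<notin> A \<longrightarrow> nmem s' x = nmem s x) \<and> (\<forall>x. x \<notin> B \<longrightarrow> rmem s' x = rmem s x)"

lemma frame_refl: "frame A B s s"
  by (simp add: frame_def)

lemma frame_trans: "frame A B s s' \<Longrightarrow> frame A B s' s'' \<Longrightarrow> frame A B s s''"
  by (simp add: frame_def)

lemma frame_mono: "frame A B s s' \<Longrightarrow> A \<subseteq> A' \<Longrightarrow> B \<subseteq> B' \<Longrightarrow> frame A' B' s s'"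
  by (auto simp: frame_def)

lemma frameN: "frame A B s s' \<Longrightarrow> x \<notin> A \<Longrightarrow> nmem s' x = nmem s x"
  and frameR: "frame A B s s' \<Longrightarrow> x \<notin> B \<Longrightarrow> rmem s' x = rmem s x"
  by (simp_all add: frame_def)

lemma frame_upd:
  "x \<in> A \<Longrightarrow> frame A B s (s\<lparr>nmem := upd_cell (nmem s) x i j v\<rparr>)"
  "x \<in> B \<Longrightarrow> frame A B s (s\<lparr>rmem := upd_cell (rmem s) x i j v'\<rparr>)"
  by (auto simp: frame_def upd_cell_def)

lemma exec_frame: "exec c s t s' \<Longrightarrow> frame (nw c) (rw c) s s'"
proof (induction rule: exec.induct)
  case (exec_Seq c\<^sub>1 s t\<^sub>1 s' c\<^sub>2 t\<^sub>2 s'')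
  then show ?case by (simp add: frame_def)
next
  case (exec_WhileTrue b s c t\<^sub>1 s' t\<^sub>2 s'')
  then show ?case by (simp add: frame_def)
qed (simp_all add: frame_refl frame_upd, simp_all add: frame_def)

lemma runs_frame:
  "runs c s Q \<Longrightarrow> runs c s (\<lambda>t s'. Q t s' \<and> frame (nw c) (rw c) s s')"
  unfolding runs_def using exec_frame by blast

abbreviation sc :: "string \<Rightarrow> nexp" where
  "sc x \<equiv> NCell x (NConst 0) (NConst 0)"

abbreviation assign :: "string \<Rightarrow> nexp \<Rightarrow> com" where
  "assign x e \<equiv> NAssign x (NConst 0) (NConst 0) e"

definition NEq :: "nexp \<Rightarrow> nexp \<Rightarrow> bexp" where
  "NEq a b = BAnd (BNot (NLess a b)) (BNot (NLess b a))"

lemma bval_NEq [simp]: "bval (NEq a b) s \<longleftrightarrow> nval a s = nval b s"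
  by (auto simp: NEq_def)

definition FOR :: "string \<Rightarrow> nexp \<Rightarrow> com \<Rightarrow> com" where
  "FOR x e c = Seq (assign x (NConst 0)) (While (NLess (sc x) e) (Seq c (assign x (NAdd (sc x) (NConst 1)))))"

lemma nw_FOR [simp]: "nw (FOR x e c) = insert x (nw c)" and rw_FOR [simp]: "rw (FOR x e c) = rw c"
  by (auto simp: FOR_def)

text \<open>The bound is evaluated anew at every test, so it must be stable under everything the
  loop writes. Each pass pays for a test and an increment besides the body, whence
  \<open>tb + 2\<close>; the final 2 is the initialisation and the last test.\<close>

lemma runs_FOR:
  assumes e: "\<And>s'. frame (insert x (nw c)) (rw c) s s' \<Longrightarrow> nval e s' = N"
    and I0: "I 0 (s\<lparr>nmem := upd_cell (nmem s) x 0 0 0\<rparr>)"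
    and step: "\<And>i s'. i < N \<Longrightarrow> I i s' \<Longrightarrow> nmem s' x 0 0 = i \<Longrightarrow> frame (insert x (nw c)) (rw c) s s' \<Longrightarrow>
      runs c s' (\<lambda>t s''. t \<le> tb \<and> nmem s'' x 0 0 = i \<and>
        I (Suc i) (s''\<lparr>nmem := upd_cell (nmem s'') x 0 0 (Suc i)\<rparr>))"
    and fin: "\<And>t s'. I N s' \<Longrightarrow> t \<le> N * (tb + 2) + 2 \<Longrightarrow> frame (insert x (nw c)) (rw c) s s' \<Longrightarrow> Q t s'"
  shows "runs (FOR x e c) s Q"
proof -
  let ?F = "frame (insert x (nw c)) (rw c)"
  let ?s0 = "s\<lparr>nmem := upd_cell (nmem s) x 0 0 0\<rparr>"
  let ?body = "Seq c (assign x (NAdd (sc x) (NConst 1)))"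
  define J where "J k s' \<longleftrightarrow> k + nmem s' x 0 0 = N \<and> I (nmem s' x 0 0) s' \<and> ?F s s'" for k s'
  have "runs (While (NLess (sc x) e) ?body) ?s0
     (\<lambda>t s'. t \<le> N * ((tb + 1) + 1) + 1 \<and> (\<exists>k. J k s') \<and> \<not> bval (NLess (sc x) e) s')"
  proof (rule runs_While)
    show "J N ?s0" using I0 by (simp add: J_def frame_upd)
    fix k s' assume J: "J k s'" and b: "bval (NLess (sc x) e) s'"
    have lt: "nmem s' x 0 0 < N" using b J e by (simp add: J_def)
    then obtain k' where k': "k = Suc k'" using J by (cases k) (auto simp: J_def)
    have fr: "?F s s'" and i: "I (nmem s' x 0 0) s'" using J by (simp_all add: J_def)
    have "runs c s' (\<lambda>t s''. (t \<le> tb \<and> nmem s'' x 0 0 = nmem s' x 0 0 \<and>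
        I (Suc (nmem s' x 0 0)) (s''\<lparr>nmem := upd_cell (nmem s'') x 0 0 (Suc (nmem s' x 0 0))\<rparr>)) \<and> frame (nw c) (rw c) s' s'')"
      by (rule runs_frame) (rule step [OF lt i refl fr])
    then have "runs c s' (\<lambda>t s''. 1 + t \<le> tb + 1 \<and> J k' (s''\<lparr>nmem := upd_cell (nmem s'') x 0 0 (Suc (nmem s'' x 0 0))\<rparr>))"
    proof (rule runs_mono, elim conjE, intro conjI)
      fix t s'' assume a: "t \<le> tb" "nmem s'' x 0 0 = nmem s' x 0 0"
        "I (Suc (nmem s' x 0 0)) (s''\<lparr>nmem := upd_cell (nmem s'') x 0 0 (Suc (nmem s' x 0 0))\<rparr>)"
        "frame (nw c) (rw c) s' s''"
      show "1 + t \<le> tb + 1" using a by simp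
      have "?F s' s''" using a(4) by (rule frame_mono) auto
      then have "?F s (s''\<lparr>nmem := upd_cell (nmem s'') x 0 0 (Suc (nmem s'' x 0 0))\<rparr>)"
        using fr frame_trans frame_upd(1) by (metis insertI1)
      then show "J k' (s''\<lparr>nmem := upd_cell (nmem s'') x 0 0 (Suc (nmem s'' x 0 0))\<rparr>)"
        using a J k' by (simp add: J_def)
    qed
    then show "\<exists>k'. k = Suc k' \<and> runs ?body s' (\<lambda>t s'. t \<le> tb + 1 \<and> J k' s')"
      using k' by simp
  qed
  then show ?thesis unfolding FOR_def runs_Seq runs_NAssign nval.simps
  proof (rule runs_mono, elim conjE exE)
    fix t s' k assume t: "t \<le> N * ((tb + 1) + 1) + 1" and J: "J k s'" and b: "\<not> bval (NLess (sc x) e) s'"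
    have fr: "?F s s'" using J by (simp add: J_def)
    have "nmem s' x 0 0 = N" using b J e [OF fr] by (simp add: J_def)
    then have "I N s'" using J by (simp add: J_def)
    then show "Q (1 + t) s'" using fin fr t by simp
  qed
qed

text \<open>As \<open>m < Z\<close>, one multiple of \<open>a * Z ^ k\<close> is to spare and
  absorbs the overhead of the loop. Each level of nesting thus costs a factor \<open>Z\<close> and
  leaves the constant \<open>a\<close> unchanged.\<close>

lemma for_time:
  assumes "tb \<le> a * Z ^ k" "2 \<le> a" "1 \<le> k" "m < (Z :: nat)"
  shows "m * (tb + 2) + 2 \<le> a * Z ^ Suc k"
proof -
  have "Z \<le> Z ^ k" using assms self_le_power [of Z k] by simp
  then have "2 * Z \<le> a * Z ^ k" using assms by (meson mult_le_mono)
  have "m * (tb + 2) + 2 \<le> m * (a * Z ^ k) + 2 * (m + 1)" using assms by (simp add: algebra_simps)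
  also have "\<dots> \<le> m * (a * Z ^ k) + 2 * Z" using assms by simp
  also have "\<dots> \<le> m * (a * Z ^ k) + a * Z ^ k" using \<open>2 * Z \<le> a * Z ^ k\<close> by simp
  also have "\<dots> = (m + 1) * (a * Z ^ k)" by simp
  also have "\<dots> \<le> Z * (a * Z ^ k)" using assms by (intro mult_le_mono1) simp
  finally show ?thesis by (simp add: algebra_simps)
qed

lemma for_time0:
  assumes "m < (Z :: nat)"
  shows "m * (tb + 2) + 2 \<le> (tb + 2) * Z"
proof -
  have "m * (tb + 2) + 2 \<le> (m + 1) * (tb + 2)" by simp
  also have "\<dots> \<le> Z * (tb + 2)" using assms by (intro mult_le_mono1) simp
  finally show ?thesis by (simp add: mult.commute)
qed

section \<open>Counting components on the machine\<close>

text \<open>Pairwise unconnected vertices are reached from different members of the witness. A set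
  that is independent and also meets all components therefore has the least possible size, and
  comparing its size with \<open>m\<close> decides \<open>few_comps\<close>.\<close>

lemma independent_card:
  assumes "few_comps m E A" "Q \<subseteq> A" "finite Q"
    and ind: "\<And>x y. x \<in> Q \<Longrightarrow> y \<in> Q \<Longrightarrow> (x, y) \<in> (adj E A)\<^sup>* \<Longrightarrow> x = y"
  shows "card Q \<le> m"
proof -
  obtain Q' where Q': "finite Q'" "card Q' \<le> m" "A \<subseteq> (adj E A)\<^sup>* `` Q'"
    using assms(1) by (auto simp: few_comps_def)
  have "\<exists>y\<in>Q'. (y, x) \<in> (adj E A)\<^sup>*" if "x \<in> Q" for x
  proof -
    have "x \<in> (adj E A)\<^sup>* `` Q'" using that assms(2) Q'(3) by (meson subsetD)
    then show ?thesis by auto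
  qed
  then obtain f where f: "\<And>x. x \<in> Q \<Longrightarrow> f x \<in> Q' \<and> (f x, x) \<in> (adj E A)\<^sup>*" by metis
  have "inj_on f Q"
  proof (rule inj_onI)
    fix x y assume xy: "x \<in> Q" "y \<in> Q" "f x = f y"
    have "(x, f x) \<in> (adj E A)\<^sup>*" "(f x, y) \<in> (adj E A)\<^sup>*" using f xy adj_rtrancl_sym by metis+
    then have "(x, y) \<in> (adj E A)\<^sup>*" by (rule rtrancl_trans)
    then show "x = y" using ind xy by blast
  qed
  moreover have "f ` Q \<subseteq> Q'" using f by auto
  ultimately have "card Q \<le> card Q'" using Q'(1) by (intro card_inj_on_le [of f]) auto
  then show ?thesis using Q'(2) by simp
qed

lemma rtrancl_Image_closed:
  assumes "R `` S \<subseteq> S" shows "R\<^sup>* `` S \<subseteq> S"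
proof
  fix y assume "y \<in> R\<^sup>* `` S"
  then obtain x where "(x, y) \<in> R\<^sup>*" "x \<in> S" by auto
  then show "y \<in> S" by (induction) (use assms in auto)
qed

text \<open>In the array \<open>D\<close>, 0 stands for an undeleted vertex not yet reached, 1 for a reached one and 2 for
  a deleted one; \<open>q\<close> counts the components found and \<open>g\<close> is the number allowed.\<close>

definition RELAX :: com where
  "RELAX = Cond (BAnd (BAnd (NEq (NCell ''D'' (NConst 0) (sc ''a'')) (NConst 1))
                       (NEq (NCell ''D'' (NConst 0) (sc ''b'')) (NConst 0)))
                 (NEq (NCell ''edge'' (sc ''a'') (sc ''b'')) (NConst 1)))
        (NAssign ''D'' (NConst 0) (sc ''b'') (NConst 1)) Skip"

definition SWEEP1 :: com where
  "SWEEP1 = FOR ''b'' (sc ''n'') RELAX"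

definition SWEEP :: com where
  "SWEEP = FOR ''a'' (sc ''n'') SWEEP1"

definition MARK :: com where
  "MARK = Seq (Cond (NEq (NCell ''D'' (NConst 0) (sc ''w'')) (NConst 0))
       (Seq (NAssign ''D'' (NConst 0) (sc ''w'') (NConst 1)) (assign ''q'' (NAdd (sc ''q'') (NConst 1)))) Skip)
     (FOR ''t'' (sc ''n'') SWEEP)"

definition ALIVE1 :: com where
  "ALIVE1 = Seq (Cond (NEq (NCell ''T'' (sc ''r'') (sc ''a'')) (NConst 1)) (assign ''g'' (NAdd (sc ''g'') (NConst 1))) Skip)
       (Cond (BAnd (BNot (NEq (NCell ''M'' (sc ''i'') (sc ''a'')) (NConst 1)))
                   (BNot (NEq (NCell ''T'' (sc ''r'') (sc ''a'')) (NConst 1))))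
         (NAssign ''D'' (NConst 0) (sc ''a'') (NConst 0)) (NAssign ''D'' (NConst 0) (sc ''a'') (NConst 2)))"

definition ALIVE :: com where
  "ALIVE = FOR ''a'' (sc ''n'') ALIVE1"

definition CHECK :: com where
  "CHECK = Seq (assign ''g'' (NConst 1)) (Seq (assign ''q'' (NConst 0)) (Seq ALIVE
     (Seq (FOR ''w'' (sc ''n'') MARK)
       (Cond (NLess (sc ''g'') (sc ''q'')) (assign ''h'' (NConst 0)) (assign ''h'' (NConst 1))))))"

lemma nw_RELAX [simp]: "nw RELAX = {''D''}" "rw RELAX = {}"
  by (auto simp: RELAX_def)

lemma nw_SWEEP1 [simp]: "nw SWEEP1 = {''b'', ''D''}" "rw SWEEP1 = {}"
  by (auto simp: SWEEP1_def)

lemma nw_SWEEP [simp]: "nw SWEEP = {''a'', ''b'', ''D''}" "rw SWEEP = {}"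
  by (auto simp: SWEEP_def)

lemma nw_MARK [simp]: "nw MARK = {''a'', ''b'', ''D'', ''q'', ''t''}" "rw MARK = {}"
  by (auto simp: MARK_def)

lemma nw_ALIVE1 [simp]: "nw ALIVE1 = {''g'', ''D''}" "rw ALIVE1 = {}"
  by (auto simp: ALIVE1_def)

lemma nw_ALIVE [simp]: "nw ALIVE = {''a'', ''g'', ''D''}" "rw ALIVE = {}"
  by (auto simp: ALIVE_def)

lemma nw_CHECK [simp]: "nw CHECK = {''a'', ''b'', ''D'', ''q'', ''t'', ''g'', ''w'', ''h''}" "rw CHECK = {}"
  by (auto simp: CHECK_def)

section \<open>Correctness of the component count\<close>

definition marking :: "nat \<Rightarrow> nat set \<Rightarrow> nat set \<Rightarrow> state \<Rightarrow> bool" where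
  "marking n A M s \<longleftrightarrow> (\<forall>a<n. nmem s ''D'' 0 a = (if a \<in> M then 1 else if a \<in> A then 0 else 2))"

context dp
begin

definition env :: "state \<Rightarrow> bool" where
  "env s \<longleftrightarrow> nmem s ''n'' 0 0 = n \<and> (\<forall>i j. nmem s ''edge'' i j = (if {i, j} \<in> E then 1 else 0)) \<and>
     (\<forall>i j. nmem s ''order'' i j = (if (i, j) \<in> \<pi> then 1 else 0)) \<and>
     (\<forall>i j. rmem s ''cost'' i j = (if {i, j} \<in> E then c {i, j} else 0)) \<and>
     (\<forall>t<2 * n. nmem s ''W'' 0 t = 2 ^ t)"

lemma env_frame:
  assumes "env s" "frame A B s s'" "''n'' \<notin> A" "''edge'' \<notin> A" "''order'' \<notin> A" "''W'' \<notin> A" "''cost'' \<notin> B"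
  shows "env s'"
  using assms by (simp add: env_def frameN frameR)

lemma envD:
  assumes "env s"
  shows "nmem s ''n'' 0 0 = n" "nmem s ''edge'' i j = (if {i, j} \<in> E then 1 else 0)"
    "nmem s ''order'' i j = (if (i, j) \<in> \<pi> then 1 else 0)"
    "rmem s ''cost'' i j = (if {i, j} \<in> E then c {i, j} else 0)"
    "t < 2 * n \<Longrightarrow> nmem s ''W'' 0 t = 2 ^ t"
  using assms by (simp_all add: env_def)

lemma runs_FORn:
  assumes env: "env s" and nf: "{''n'', ''edge'', ''order'', ''W''} \<inter> insert x (nw b) = {}" "''cost'' \<notin> rw b"
    and I0: "I 0 (s\<lparr>nmem := upd_cell (nmem s) x 0 0 0\<rparr>)"
    and step: "\<And>i s'. i < n \<Longrightarrow> I i s' \<Longrightarrow> nmem s' x 0 0 = i \<Longrightarrow> env s' \<Longrightarrow>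
      frame (insert x (nw b)) (rw b) s s' \<Longrightarrow>
      runs b s' (\<lambda>t s''. t \<le> tb \<and> nmem s'' x 0 0 = i \<and>
        I (Suc i) (s''\<lparr>nmem := upd_cell (nmem s'') x 0 0 (Suc i)\<rparr>))"
    and fin: "\<And>t s'. I n s' \<Longrightarrow> t \<le> n * (tb + 2) + 2 \<Longrightarrow> env s' \<Longrightarrow>
      frame (insert x (nw b)) (rw b) s s' \<Longrightarrow> Q t s'"
  shows "runs (FOR x (sc ''n'') b) s Q"
proof -
  have e: "env s'" if "frame (insert x (nw b)) (rw b) s s'" for s'
    using env_frame [OF env that] nf by auto
  show ?thesis
  proof (rule runs_FOR [where N = n and I = I and tb = tb])
    show "nval (sc ''n'') s' = n" if "frame (insert x (nw b)) (rw b) s s'" for s'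
      using e [OF that] by (simp add: env_def)
  qed (use I0 step fin e in blast)+
qed

text \<open>Marks set during the sweep may spread further in the same sweep, depending on the order
  of the vertices. Only two bounds are claimed: all neighbours of \<open>M\<close> are reached, and
  nothing outside its components.\<close>

lemma runs_SWEEP:
  assumes env: "env s" and d: "marking n A M s" and MA: "M \<subseteq> A" "A \<subseteq> V" and Z: "n < Z"
  shows "runs SWEEP s (\<lambda>t s'. t \<le> 4 * Z ^ 2 \<and>
     (\<exists>M'. M \<subseteq> M' \<and> M' \<subseteq> (adj E A)\<^sup>* `` M \<and> adj E A `` M \<subseteq> M' \<and> marking n A M' s'))"
proof -
  let ?R = "adj E A"
  define J where "J i j s' \<longleftrightarrow> (\<exists>M'. M \<subseteq> M' \<and> M' \<subseteq> ?R\<^sup>* `` M \<and> marking n A M' s' \<and>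
     (\<forall>a b. (a, b) \<in> ?R \<longrightarrow> a \<in> M \<longrightarrow> (a < i \<or> a = i \<and> b < j) \<longrightarrow> b \<in> M'))" for i j :: nat and s'
  have Jcong: "J i j (s'\<lparr>nmem := upd_cell (nmem s') x 0 0 v\<rparr>) = J i j s'" if "x \<noteq> ''D''" for i j s' x v
    using that unfolding J_def marking_def by simp
  have R: "x \<in> A \<and> y \<in> A \<and> x < n \<and> y < n \<and> {x, y} \<in> E" if "(x, y) \<in> ?R" for x y
    using that MA by (auto simp: adj_def)
  have Rt: "?R\<^sup>* `` M \<subseteq> A" using adj_rtrancl_image [OF MA(1)] .
  have relax: "runs RELAX s' (\<lambda>t s''. t \<le> 2 \<and> nmem s'' ''b'' 0 0 = j \<and> nmem s'' ''a'' 0 0 = i \<and> J i (Suc j) s'')"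
    if J: "J i j s'" and ij: "i < n" "j < n" and v: "nmem s' ''a'' 0 0 = i" "nmem s' ''b'' 0 0 = j" and e: "env s'" for i j s'
  proof -
    obtain M' where M': "M \<subseteq> M'" "M' \<subseteq> ?R\<^sup>* `` M" "marking n A M' s'"
      "\<And>a b. (a, b) \<in> ?R \<Longrightarrow> a \<in> M \<Longrightarrow> (a < i \<or> a = i \<and> b < j) \<Longrightarrow> b \<in> M'"
      using J unfolding J_def by blast
    have D: "nmem s' ''D'' 0 i = (if i \<in> M' then 1 else if i \<in> A then 0 else 2)"
      "nmem s' ''D'' 0 j = (if j \<in> M' then 1 else if j \<in> A then 0 else 2)"
      using M'(3) ij by (auto simp: marking_def)
    show ?thesis
    proof (cases "i \<in> M' \<and> j \<in> A \<and> j \<notin> M' \<and> {i, j} \<in> E")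
      case True
      have iA: "i \<in> A" using True M'(2) Rt by blast
      have "(i, j) \<in> ?R" using True iA by (auto simp: adj_def)
      moreover have "i \<in> ?R\<^sup>* `` M" using True M'(2) by blast
      ultimately have "j \<in> ?R\<^sup>* `` M" by (auto intro: rtrancl_into_rtrancl)
      then have "insert j M' \<subseteq> ?R\<^sup>* `` M" using M'(2) by blast
      moreover have "marking n A (insert j M') (s'\<lparr>nmem := upd_cell (nmem s') ''D'' 0 j 1\<rparr>)"
        using M'(3) by (simp add: marking_def)
      ultimately have "J i (Suc j) (s'\<lparr>nmem := upd_cell (nmem s') ''D'' 0 j 1\<rparr>)"
        using M'(1,4) unfolding J_def by (intro exI [of _ "insert j M'"]) (auto simp: less_Suc_eq)
      then show ?thesis using True D v envD(2) [OF e, of i j] by (simp add: RELAX_def)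
    next
      case False
      have "J i (Suc j) s'" unfolding J_def
      proof (intro exI [of _ M'] conjI allI impI M'(1-3))
        fix a b assume ab: "(a, b) \<in> ?R" "a \<in> M" "a < i \<or> a = i \<and> b < Suc j"
        show "b \<in> M'"
        proof (cases "a = i \<and> b = j")
          case True
          then show ?thesis using False ab M'(1) R [OF ab(1)] by auto
        next
          case False
          then show ?thesis using M'(4) [OF ab(1,2)] ab(3) by (auto simp: less_Suc_eq)
        qed
      qed
      then show ?thesis using False D v envD(2) [OF e, of i j] by (auto simp: RELAX_def)
    qed
  qed
  have sweep1: "runs SWEEP1 s' (\<lambda>t s''. t \<le> 4 * Z \<and> nmem s'' ''a'' 0 0 = i \<and> J (Suc i) 0 s'')"
    if J: "J i 0 s'" and i: "i < n" and v: "nmem s' ''a'' 0 0 = i" and e: "env s'" for i s'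
    unfolding SWEEP1_def
  proof (rule runs_FORn [OF e, where I = "\<lambda>j s''. J i j s''" and tb = 2], goal_cases)
    case 3
    then show ?case using J by (simp add: Jcong)
  next
    case (4 j s'')
    have "nmem s'' ''a'' = nmem s' ''a''" by (rule frameN [OF 4(5)]) simp
    then show ?case using relax [OF 4(2) i 4(1) _ 4(3) 4(4)] v by (auto simp: Jcong elim!: runs_mono)
  next
    case (5 t s'')
    have "nmem s'' ''a'' = nmem s' ''a''" by (rule frameN [OF 5(4)]) simp
    moreover have "J (Suc i) 0 s''" using 5(1) R unfolding J_def by (metis less_Suc_eq not_less_zero)
    ultimately show ?case using 5(2) v for_time0 [OF Z, of 2] by simp
  qed auto
  show ?thesis unfolding SWEEP_def
  proof (rule runs_FORn [OF env, where I = "\<lambda>i s'. J i 0 s'" and tb = "4 * Z"], goal_cases)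
    case 3
    have "J 0 0 s" unfolding J_def using d by (intro exI [of _ M]) auto
    then show ?case by (simp add: Jcong)
  next
    case (4 i s')
    show ?case using sweep1 [OF 4(2,1,3,4)] by (auto simp: Jcong elim!: runs_mono)
  next
    case (5 t s')
    obtain M' where M': "M \<subseteq> M'" "M' \<subseteq> ?R\<^sup>* `` M" "marking n A M' s'"
      "\<And>a b. (a, b) \<in> ?R \<Longrightarrow> a \<in> M \<Longrightarrow> (a < n \<or> a = n \<and> b < 0) \<Longrightarrow> b \<in> M'"
      using 5(1) unfolding J_def by blast
    have "?R `` M \<subseteq> M'" using M'(4) R by blast
    moreover have "t \<le> 4 * Z ^ 2"
      using 5(2) for_time [of "4 * Z" 4 Z 1 n] Z by (simp add: eval_nat_numeral)
    ultimately show ?case using M' by blast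
  qed auto
qed

text \<open>A sweep that starts from a set not yet closed adds at least one vertex. After
  \<open>n\<close> sweeps the marked set is closed or has \<open>n\<close> elements, and in the
  latter case it is all of \<open>V\<close> and closed as well.\<close>

lemma runs_CLOSE:
  assumes env: "env s" and d: "marking n A M s" and MA: "M \<subseteq> A" "A \<subseteq> V" and Z: "n < Z"
  shows "runs (FOR ''t'' (sc ''n'') SWEEP) s (\<lambda>t s'. t \<le> 4 * Z ^ 3 \<and>
     marking n A ((adj E A)\<^sup>* `` M) s')"
proof -
  let ?R = "adj E A"
  define J where "J i s' \<longleftrightarrow> (\<exists>M'. M \<subseteq> M' \<and> M' \<subseteq> ?R\<^sup>* `` M \<and> marking n A M' s' \<and>
     (?R `` M' \<subseteq> M' \<or> i \<le> card M'))" for i :: nat and s'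
  have Jcong: "J i (s'\<lparr>nmem := upd_cell (nmem s') x 0 0 v\<rparr>) = J i s'" if "x \<noteq> ''D''" for i s' x v
    using that unfolding J_def marking_def by simp
  have Rt: "?R\<^sup>* `` M \<subseteq> A" using adj_rtrancl_image [OF MA(1)] .
  show ?thesis
  proof (rule runs_FORn [OF env, where I = J and tb = "4 * Z ^ 2"], goal_cases)
    case 3
    have "J 0 s" unfolding J_def using d by (intro exI [of _ M]) auto
    then show ?case by (simp add: Jcong)
  next
    case (4 i s')
    obtain M' where M': "M \<subseteq> M'" "M' \<subseteq> ?R\<^sup>* `` M" "marking n A M' s'" "?R `` M' \<subseteq> M' \<or> i \<le> card M'"
      using 4(2) unfolding J_def by blast
    have M'A: "M' \<subseteq> A" using M'(2) Rt by blast
    have J': "J (Suc i) s''"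
      if M2: "M' \<subseteq> M2" "M2 \<subseteq> ?R\<^sup>* `` M'" "?R `` M' \<subseteq> M2" "marking n A M2 s''" for M2 s''
    proof -
      have "?R\<^sup>* `` M' \<subseteq> ?R\<^sup>* `` M"
      proof
        fix z assume "z \<in> ?R\<^sup>* `` M'"
        then obtain y where y: "(y, z) \<in> ?R\<^sup>*" "y \<in> M'" by auto
        then obtain x where "(x, y) \<in> ?R\<^sup>*" "x \<in> M" using M'(2) by auto
        then show "z \<in> ?R\<^sup>* `` M" using y(1) rtrancl_trans [of x y ?R z] by auto
      qed
      then have sub: "M2 \<subseteq> ?R\<^sup>* `` M" using M2(2) by blast
      have "?R `` M2 \<subseteq> M2 \<or> Suc i \<le> card M2"
      proof (cases "?R `` M' \<subseteq> M'")
        case True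
        then have "?R\<^sup>* `` M' \<subseteq> M'" by (rule rtrancl_Image_closed)
        then have "M2 = M'" using M2(1,2) by blast
        then show ?thesis using True by simp
      next
        case False
        then have "M' \<subset> M2" using M2(1,3) by blast
        moreover have "finite M2" using sub Rt MA(2) finite_subset by (metis finite_atLeastLessThan)
        ultimately have "card M' < card M2" by (simp add: psubset_card_mono)
        then show ?thesis using M'(4) False by linarith
      qed
      moreover have "M \<subseteq> M2" using M2(1) M'(1) by blast
      ultimately show ?thesis unfolding J_def using sub M2(4) by (intro exI [of _ M2] conjI)
    qed
    show ?case
    proof (rule runs_mono [OF runs_frame [OF runs_SWEEP [OF 4(4) M'(3) M'A MA(2) Z]]], goal_cases)
      case (1 t s'')
      then obtain M2 where M2: "M' \<subseteq> M2" "M2 \<subseteq> ?R\<^sup>* `` M'" "?R `` M' \<subseteq> M2" "marking n A M2 s''"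
        and t: "t \<le> 4 * Z ^ 2" and f: "frame (nw SWEEP) (rw SWEEP) s' s''" by auto
      have "nmem s'' ''t'' = nmem s' ''t''" by (rule frameN [OF f]) simp
      then show ?case using J' [OF M2] t 4(3) by (simp add: Jcong)
    qed
  next
    case (5 t s')
    obtain M' where M': "M \<subseteq> M'" "M' \<subseteq> ?R\<^sup>* `` M" "marking n A M' s'" "?R `` M' \<subseteq> M' \<or> n \<le> card M'"
      using 5(1) unfolding J_def by blast
    have M'A: "M' \<subseteq> A" using M'(2) Rt by blast
    have "?R `` M' \<subseteq> M'"
    proof (rule ccontr)
      assume "\<not> ?R `` M' \<subseteq> M'"
      then have "card V \<le> card M'" using M'(4) by simp
      then have "M' = V" using M'A MA(2) by (intro card_seteq) auto
      then have "?R `` M' \<subseteq> M'" using MA(2) by (auto simp: adj_def)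
      then show False using \<open>\<not> ?R `` M' \<subseteq> M'\<close> by blast
    qed
    then have "?R\<^sup>* `` M' \<subseteq> M'" by (rule rtrancl_Image_closed)
    then have "M' = ?R\<^sup>* `` M" using M'(1,2) by blast
    moreover have "t \<le> 4 * Z ^ 3"
      using 5(2) for_time [of "4 * Z ^ 2" 4 Z 2 n] Z by (simp add: eval_nat_numeral)
    ultimately show ?case using M'(3) by simp
  qed auto
qed

text \<open>\<open>Q\<close> holds one representative of each component found so far, and exactly
  these components are marked.\<close>

definition roots :: "nat set \<Rightarrow> nat set \<Rightarrow> state \<Rightarrow> bool" where
  "roots A Q s \<longleftrightarrow> Q \<subseteq> A \<and> finite Q \<and> (\<forall>x\<in>Q. \<forall>y\<in>Q. (x, y) \<in> (adj E A)\<^sup>* \<longrightarrow> x = y) \<and>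
     marking n A ((adj E A)\<^sup>* `` Q) s \<and> nmem s ''q'' 0 0 = card Q"

lemma roots_upd: "x \<noteq> ''D'' \<Longrightarrow> x \<noteq> ''q'' \<Longrightarrow>
   roots A Q (s\<lparr>nmem := upd_cell (nmem s) x i j v\<rparr>) = roots A Q s"
  unfolding roots_def marking_def by simp

text \<open>An unmarked vertex of \<open>A\<close> is connected to no earlier root, in either
  direction by symmetry, so it can become a root itself.\<close>

lemma runs_MARK:
  assumes env: "env s" and A: "A \<subseteq> V" and Z: "n < Z" and Q: "roots A Q s" and w: "nmem s ''w'' 0 0 = w" "w < n"
  shows "runs MARK s (\<lambda>t s'. t \<le> 7 * Z ^ 3 \<and>
     (\<exists>Q'. Q \<subseteq> Q' \<and> roots A Q' s' \<and> (w \<in> A \<longrightarrow> w \<in> (adj E A)\<^sup>* `` Q')))"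
proof -
  let ?R = "adj E A"
  let ?M = "?R\<^sup>* `` Q"
  have QA: "Q \<subseteq> A" "finite Q" and ind: "\<And>x y. x \<in> Q \<Longrightarrow> y \<in> Q \<Longrightarrow> (x, y) \<in> ?R\<^sup>* \<Longrightarrow> x = y"
    and d: "marking n A ?M s" and q: "nmem s ''q'' 0 0 = card Q" using Q by (auto simp: roots_def)
  have MA: "?M \<subseteq> A" using adj_rtrancl_image [OF QA(1)] .
  have Dw: "nmem s ''D'' 0 w = (if w \<in> ?M then 1 else if w \<in> A then 0 else 2)"
    using d w(2) by (simp add: marking_def)
  have Z3: "1 \<le> Z ^ 3" using Z by simp
  show ?thesis
  proof (cases "w \<in> A \<and> w \<notin> ?M")
    case True
    let ?s = "s\<lparr>nmem := upd_cell (upd_cell (nmem s) ''D'' 0 w (Suc 0)) ''q'' 0 0 (Suc (card Q))\<rparr>"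
    have e: "env ?s" by (rule env_frame [OF env, of "{''D'', ''q''}" "{}"]) (auto simp: frame_def upd_cell_def)
    have d': "marking n A (insert w ?M) ?s" using d by (simp add: marking_def)
    have i: "insert w ?M \<subseteq> A" using True MA by blast
    have M': "?R\<^sup>* `` insert w ?M = ?R\<^sup>* `` insert w Q"
      by (auto intro: rtrancl_trans)
    have "w \<notin> Q" using True by auto
    have ind': "x = y" if "x \<in> insert w Q" "y \<in> insert w Q" "(x, y) \<in> ?R\<^sup>*" for x y
      using that ind True adj_rtrancl_sym [OF that(3)] by (metis ImageI insertE)
    have run: "runs (FOR ''t'' (sc ''n'') SWEEP) ?s (\<lambda>t s'. (t \<le> 4 * Z ^ 3 \<and> marking n A (?R\<^sup>* `` insert w Q) s') \<and>
        frame (nw (FOR ''t'' (sc ''n'') SWEEP)) (rw (FOR ''t'' (sc ''n'') SWEEP)) ?s s')"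
      using runs_frame [OF runs_CLOSE [OF e d' i A Z]] unfolding M' .
    have "bval (NEq (NCell ''D'' (NConst 0) (sc ''w'')) (NConst 0)) s" using True Dw w by simp
    then show ?thesis unfolding MARK_def using w q
    proof (simp, rule_tac runs_mono [OF run], goal_cases)
      case (1 t s')
      then have f: "frame (nw (FOR ''t'' (sc ''n'') SWEEP)) (rw (FOR ''t'' (sc ''n'') SWEEP)) ?s s'"
        and d': "marking n A (?R\<^sup>* `` insert w Q) s'" and t: "t \<le> 4 * Z ^ 3" by blast+
      have "nmem s' ''q'' = nmem ?s ''q''" by (rule frameN [OF f]) simp
      then have "nmem s' ''q'' 0 0 = card (insert w Q)" using \<open>w \<notin> Q\<close> QA(2) by simp
      then have "roots A (insert w Q) s'" using True QA ind' d' unfolding roots_def by blast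
      then show ?case using t Z3 by (intro conjI exI [of _ "insert w Q"]) auto
    qed
  next
    case False
    \<comment> \<open>Without a new root the marked set is already closed, and the sweeps change
      nothing.\<close>
    have M': "?R\<^sup>* `` ?M = ?M" by (auto intro: rtrancl_trans)
    have run: "runs (FOR ''t'' (sc ''n'') SWEEP) s (\<lambda>t s'. (t \<le> 4 * Z ^ 3 \<and> marking n A ?M s') \<and>
        frame (nw (FOR ''t'' (sc ''n'') SWEEP)) (rw (FOR ''t'' (sc ''n'') SWEEP)) s s')"
      using runs_frame [OF runs_CLOSE [OF env d MA A Z]] unfolding M' .
    have "\<not> bval (NEq (NCell ''D'' (NConst 0) (sc ''w'')) (NConst 0)) s" using False Dw w by auto
    then show ?thesis unfolding MARK_def
    proof (simp, rule_tac runs_mono [OF run], goal_cases)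
      case (1 t s')
      then have f: "frame (nw (FOR ''t'' (sc ''n'') SWEEP)) (rw (FOR ''t'' (sc ''n'') SWEEP)) s s'"
        and d': "marking n A ?M s'" and t: "t \<le> 4 * Z ^ 3" by blast+
      have "nmem s' ''q'' = nmem s ''q''" by (rule frameN [OF f]) simp
      then have "roots A Q s'" using QA ind d' q unfolding roots_def by auto
      then show ?case using t Z3 False by (intro conjI exI [of _ Q]) auto
    qed
  qed
qed

text \<open>In the end the roots are independent and meet every component, so \<open>q\<close> is
  the exact number of components.\<close>

lemma runs_MARKS:
  assumes env: "env s" and A: "A \<subseteq> V" and Z: "n < Z" and d: "marking n A {} s" "nmem s ''q'' 0 0 = 0"
  shows "runs (FOR ''w'' (sc ''n'') MARK) s (\<lambda>t s'. t \<le> 7 * Z ^ 4 \<and>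
     (few_comps m E A \<longleftrightarrow> nmem s' ''q'' 0 0 \<le> m))"
proof (rule runs_FORn [OF env, where I = "\<lambda>i s'. \<exists>Q. roots A Q s' \<and> (\<forall>w\<in>A. w < i \<longrightarrow> w \<in> (adj E A)\<^sup>* `` Q)"
     and tb = "7 * Z ^ 3"], goal_cases)
  case 3
  have "roots A {} s" using d by (simp add: roots_def)
  then show ?case by (intro exI [of _ "{}"]) (simp add: roots_upd)
next
  case (4 i s')
  obtain Q where Q: "roots A Q s'" "\<And>w. w \<in> A \<Longrightarrow> w < i \<Longrightarrow> w \<in> (adj E A)\<^sup>* `` Q" using 4(2) by blast
  show ?case
  proof (rule runs_mono [OF runs_frame [OF runs_MARK [OF 4(4) A Z Q(1) 4(3,1)]]], goal_cases)
    case (1 t s'')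
    then obtain Q' where Q': "Q \<subseteq> Q'" "roots A Q' s''" "i \<in> A \<longrightarrow> i \<in> (adj E A)\<^sup>* `` Q'"
      and t: "t \<le> 7 * Z ^ 3" and f: "frame (nw MARK) (rw MARK) s' s''" by blast
    have "nmem s'' ''w'' = nmem s' ''w''" by (rule frameN [OF f]) simp
    moreover have "w \<in> (adj E A)\<^sup>* `` Q'" if "w \<in> A" "w < Suc i" for w
    proof (cases "w = i")
      case False
      then have "w \<in> (adj E A)\<^sup>* `` Q" using Q(2) that by simp
      then show ?thesis using Q'(1) by blast
    qed (use Q' that in blast)
    ultimately show ?case using t Q'(2) 4(3) by (auto simp: roots_upd)
  qed
next
  case (5 t s')
  obtain Q where Q: "roots A Q s'" "\<And>w. w \<in> A \<Longrightarrow> w < n \<Longrightarrow> w \<in> (adj E A)\<^sup>* `` Q" using 5(1) by blast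
  have cov: "A \<subseteq> (adj E A)\<^sup>* `` Q" using Q(2) A by (auto simp: subset_iff)
  have "card Q \<le> m" if "few_comps m E A"
    using independent_card [OF that] Q(1) by (simp add: roots_def)
  moreover have "few_comps m E A" if "card Q \<le> m"
    using that Q(1) cov unfolding few_comps_def roots_def by blast
  ultimately show ?case using 5(2) for_time [of "7 * Z ^ 3" 7 Z 3 n] Z Q(1) by (auto simp: roots_def eval_nat_numeral)
qed auto

definition deletion_row :: "state \<Rightarrow> bool" where
  "deletion_row s \<longleftrightarrow> (\<forall>a<n. nmem s ''T'' (nmem s ''r'' 0 0) a = (if a \<in> T then 1 else 0))"

lemma runs_ALIVE:
  assumes env: "env s" and Z: "n < Z" and t: "deletion_row s" and g: "nmem s ''g'' 0 0 = 1"
    and X: "\<And>a. a < n \<Longrightarrow> nmem s ''M'' (nmem s ''i'' 0 0) a = (if a \<in> X then 1 else 0)"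
  shows "runs ALIVE s (\<lambda>t s'. t \<le> 6 * Z \<and> marking n (V - X - T) {} s' \<and> nmem s' ''g'' 0 0 = card T + 1)"
  unfolding ALIVE_def
proof (rule runs_FORn [OF env, where I = "\<lambda>i s'. nmem s' ''g'' 0 0 = 1 + card (T \<inter> {..<i}) \<and>
     (\<forall>a<i. nmem s' ''D'' 0 a = (if a \<in> V - X - T then 0 else 2))" and tb = 4], goal_cases)
  case 3
  then show ?case using g by simp
next
  case (4 i s')
  have fr: "nmem s' ''M'' = nmem s ''M''" "nmem s' ''T'' = nmem s ''T''" "nmem s' ''r'' = nmem s ''r''"
    "nmem s' ''i'' = nmem s ''i''" by (rule frameN [OF 4(5)], simp)+
  have "T \<inter> {..<Suc i} = (if i \<in> T then insert i (T \<inter> {..<i}) else T \<inter> {..<i})" by (auto simp: less_Suc_eq)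
  then have c: "card (T \<inter> {..<Suc i}) = (if i \<in> T then 1 else 0) + card (T \<inter> {..<i})" by simp
  have Ti: "nmem s ''T'' (nmem s ''r'' 0 0) i = (if i \<in> T then 1 else 0)" using t 4(1) by (simp add: deletion_row_def)
  have Mi: "nmem s ''M'' (nmem s ''i'' 0 0) i = (if i \<in> X then 1 else 0)" using X 4(1) by simp
  show ?case using 4(1,2,3) c Ti Mi unfolding ALIVE1_def by (simp add: fr less_Suc_eq)
next
  case (5 t s')
  have "T \<inter> {..<n} = T" using T by auto
  then show ?case using 5(1,2) for_time0 [OF Z, of 4] by (auto simp: marking_def)
qed auto

lemma runs_CHECK:
  assumes env: "env s" and Z: "n < Z" and t: "deletion_row s"
    and X: "\<And>a. a < n \<Longrightarrow> nmem s ''M'' (nmem s ''i'' 0 0) a = (if a \<in> X then 1 else 0)"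
  shows "runs CHECK s (\<lambda>t s'. t \<le> 17 * Z ^ 4 \<and> nmem s' ''h'' 0 0 = (if good X then 1 else 0))"
proof -
  let ?s = "s\<lparr>nmem := upd_cell (upd_cell (nmem s) ''g'' 0 0 (Suc 0)) ''q'' 0 0 0\<rparr>"
  have fr: "frame {''g'', ''q''} {} s ?s" by (auto simp: frame_def upd_cell_def)
  have e: "env ?s" by (rule env_frame [OF env fr]) auto
  have t': "deletion_row ?s" using t by (simp add: deletion_row_def)
  have A: "V - X - T \<subseteq> V" by auto
  have Z4: "1 \<le> Z ^ 4" "Z \<le> Z ^ 4" using Z self_le_power [of Z 4] by auto
  have 1: "runs ALIVE ?s (\<lambda>t s'. (t \<le> 6 * Z \<and> marking n (V - X - T) {} s' \<and> nmem s' ''g'' 0 0 = card T + 1) \<and>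
     frame (nw ALIVE) (rw ALIVE) ?s s')"
    by (rule runs_frame, rule runs_ALIVE [OF e Z t']) (use X in auto)
  have "runs ALIVE ?s (\<lambda>t1 s1. runs (FOR ''w'' (sc ''n'') MARK) s1 (\<lambda>t2 s2.
     runs (Cond (NLess (sc ''g'') (sc ''q'')) (assign ''h'' (NConst 0)) (assign ''h'' (NConst 1))) s2
       (\<lambda>t3 s'. 1 + (1 + (t1 + (t2 + t3))) \<le> 17 * Z ^ 4 \<and> nmem s' ''h'' 0 0 = (if good X then 1 else 0))))"
  proof (rule runs_mono [OF 1], goal_cases)
    case (1 t1 s1)
    then have f1: "frame (nw ALIVE) (rw ALIVE) ?s s1" and d1: "marking n (V - X - T) {} s1"
      and t1: "t1 \<le> 6 * Z" and g1: "nmem s1 ''g'' 0 0 = card T + 1" by blast+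
    have e1: "env s1" by (rule env_frame [OF e f1]) auto
    have "nmem s1 ''q'' = nmem ?s ''q''" by (rule frameN [OF f1]) simp
    then have q1: "nmem s1 ''q'' 0 0 = 0" by simp
    have 2: "runs (FOR ''w'' (sc ''n'') MARK) s1 (\<lambda>t s'. (t \<le> 7 * Z ^ 4 \<and>
       (few_comps (card T + 1) E (V - X - T) \<longleftrightarrow> nmem s' ''q'' 0 0 \<le> card T + 1)) \<and>
       frame (nw (FOR ''w'' (sc ''n'') MARK)) (rw (FOR ''w'' (sc ''n'') MARK)) s1 s')"
      by (rule runs_frame, rule runs_MARKS [OF e1 A Z d1 q1])
    show ?case
    proof (rule runs_mono [OF 2], goal_cases)
      case (1 t2 s2)
      then have f2: "frame (nw (FOR ''w'' (sc ''n'') MARK)) (rw (FOR ''w'' (sc ''n'') MARK)) s1 s2"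
        and t2: "t2 \<le> 7 * Z ^ 4"
        and q2: "few_comps (card T + 1) E (V - X - T) \<longleftrightarrow> nmem s2 ''q'' 0 0 \<le> card T + 1" by blast+
      have "nmem s2 ''g'' = nmem s1 ''g''" by (rule frameN [OF f2]) simp
      then show ?case using q2 t1 t2 g1 Z4 by (auto simp: good_def)
    qed
  qed
  then show ?thesis unfolding CHECK_def by (simp cong: if_cong)
qed

end

section \<open>The search for a fixed deletion set\<close>

lemma upd_cell_other [simp]: "y \<noteq> x \<Longrightarrow> upd_cell m x i j v y = m y"
  by (simp add: upd_cell_def)

abbreviation cell :: "string \<Rightarrow> nexp \<Rightarrow> nexp" where
  "cell x e \<equiv> NCell x (NConst 0) e"

abbreviation end_of :: "string \<Rightarrow> nexp" where
  "end_of x \<equiv> NCell ''P'' (sc x) (NSub (cell ''L'' (sc x)) (NConst 1))"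

text \<open>A state \<open>j\<close> of the search is a partial path, kept in row \<open>j\<close> of \<open>P\<close>.  The same row of \<open>M\<close> is the
  characteristic function of its vertex set, and \<open>L\<close>, \<open>C\<close> and \<open>K\<close> hold its length, its cost and a code
  for its vertex set together with its first vertex \<open>f\<close>, which enters as the element \<open>n + f\<close>.  The scalar
  \<open>l\<close> is the number of states, and \<open>W\<close> is the table of powers of 2.\<close>

definition TEST1 :: com where
  "TEST1 = Cond (BAnd (NEq (NCell ''M'' (sc ''i'') (sc ''w'')) (NConst 1)) (NEq (NCell ''order'' (sc ''u'') (sc ''w'')) (NConst 1)))
     (assign ''y'' (NConst 0)) Skip"

definition TEST :: com where
  "TEST = Seq (Cond (BAnd (BNot (NEq (NCell ''M'' (sc ''i'') (sc ''u'')) (NConst 1)))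
       (NEq (NCell ''edge'' (end_of ''i'') (sc ''u'')) (NConst 1))) (assign ''y'' (NConst 1)) (assign ''y'' (NConst 0)))
     (FOR ''w'' (sc ''n'') TEST1)"

definition SCAN1 :: com where
  "SCAN1 = Cond (BAnd (NEq (cell ''K'' (sc ''j'')) (sc ''z'')) (NEq (end_of ''j'') (sc ''u''))) (assign ''x'' (sc ''j'')) Skip"

definition SCAN :: com where
  "SCAN = FOR ''j'' (sc ''l'') SCAN1"

definition WRITE1 :: com where
  "WRITE1 = Seq (NAssign ''P'' (sc ''x'') (sc ''w'') (NCell ''P'' (sc ''i'') (sc ''w'')))
     (NAssign ''M'' (sc ''x'') (sc ''w'') (NCell ''M'' (sc ''i'') (sc ''w'')))"

definition WRITE :: com where
  "WRITE = Seq (FOR ''w'' (sc ''n'') WRITE1)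
     (Seq (NAssign ''P'' (sc ''x'') (cell ''L'' (sc ''i'')) (sc ''u''))
     (Seq (NAssign ''M'' (sc ''x'') (sc ''u'') (NConst 1))
     (Seq (NAssign ''L'' (NConst 0) (sc ''x'') (NAdd (cell ''L'' (sc ''i'')) (NConst 1)))
     (Seq (NAssign ''K'' (NConst 0) (sc ''x'') (sc ''z''))
       (RAssign ''C'' (NConst 0) (sc ''x'') (RCell ''Z'' (NConst 0) (NConst 0)))))))"

text \<open>The value \<open>l\<close> of \<open>x\<close> means that the scan found no state with
  this key, and it is at the same time the number of the next free row.\<close>

definition STORE :: com where
  "STORE = Cond (NEq (sc ''x'') (sc ''l'')) (Seq WRITE (assign ''l'' (NAdd (sc ''l'') (NConst 1))))
     (Cond (RLess (RCell ''Z'' (NConst 0) (NConst 0)) (RCell ''C'' (NConst 0) (sc ''x''))) WRITE Skip)"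

definition UPDATE :: com where
  "UPDATE = Seq (assign ''z'' (NAdd (cell ''K'' (sc ''i'')) (cell ''W'' (sc ''u''))))
     (Seq (RAssign ''Z'' (NConst 0) (NConst 0) (RAdd (RCell ''C'' (NConst 0) (sc ''i'')) (RCell ''cost'' (end_of ''i'') (sc ''u''))))
     (Seq (assign ''x'' (sc ''l'')) (Seq SCAN STORE)))"

definition TRY :: com where
  "TRY = Seq TEST (Cond (NEq (sc ''y'') (NConst 1)) UPDATE Skip)"

definition NODE :: com where
  "NODE = Seq CHECK (Seq (Cond (NEq (sc ''h'') (NConst 1)) (FOR ''u'' (sc ''n'') TRY) Skip)
     (assign ''i'' (NAdd (sc ''i'') (NConst 1))))"

text \<open>The budget \<open>r\<close> is tested only between nodes. A node adds at most
  \<open>n\<close> states, so the number of states never exceeds \<open>r + n\<close>.\<close>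

definition QUEUE :: com where
  "QUEUE = While (BAnd (NLess (sc ''i'') (sc ''l'')) (BNot (NLess (sc ''r'') (sc ''l'')))) NODE"

definition START1 :: com where
  "START1 = Seq (FOR ''w'' (sc ''n'') (NAssign ''M'' (sc ''f'') (sc ''w'') (NConst 0)))
     (Seq (NAssign ''M'' (sc ''f'') (sc ''f'') (NConst 1))
     (Seq (NAssign ''P'' (sc ''f'') (NConst 0) (sc ''f''))
     (Seq (NAssign ''L'' (NConst 0) (sc ''f'') (NConst 1))
     (Seq (NAssign ''K'' (NConst 0) (sc ''f'') (NAdd (cell ''W'' (sc ''f'')) (cell ''W'' (NAdd (sc ''n'') (sc ''f'')))))
       (RAssign ''C'' (NConst 0) (sc ''f'') (RConst 0))))))"

definition START :: com where
  "START = Seq (FOR ''f'' (sc ''n'') START1) (Seq (assign ''l'' (sc ''n'')) (assign ''i'' (NConst 0)))"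

lemma nw_TEST1 [simp]: "nw TEST1 = {''y''}" "rw TEST1 = {}"
  and nw_SCAN1 [simp]: "nw SCAN1 = {''x''}" "rw SCAN1 = {}"
  and nw_WRITE1 [simp]: "nw WRITE1 = {''P'', ''M''}" "rw WRITE1 = {}"
  by (auto simp: TEST1_def SCAN1_def WRITE1_def)

lemma nw_TEST [simp]: "nw TEST = {''w'', ''y''}" "rw TEST = {}"
  and nw_SCAN [simp]: "nw SCAN = {''j'', ''x''}" "rw SCAN = {}"
  and nw_WRITE [simp]: "nw WRITE = {''w'', ''P'', ''M'', ''L'', ''K''}" "rw WRITE = {''C''}"
  by (auto simp: TEST_def SCAN_def WRITE_def)

lemma nw_STORE [simp]: "nw STORE = {''w'', ''P'', ''M'', ''L'', ''K'', ''l''}" "rw STORE = {''C''}"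
  by (auto simp: STORE_def)

lemma nw_UPDATE [simp]: "nw UPDATE = {''w'', ''P'', ''M'', ''L'', ''K'', ''l'', ''z'', ''x'', ''j''}" "rw UPDATE = {''C'', ''Z''}"
  by (auto simp: UPDATE_def)

lemma nw_TRY [simp]: "nw TRY = {''w'', ''P'', ''M'', ''L'', ''K'', ''l'', ''z'', ''x'', ''j'', ''y''}" "rw TRY = {''C'', ''Z''}"
  by (auto simp: TRY_def)

lemma nw_NODE [simp]:
  "nw NODE = {''a'', ''b'', ''D'', ''q'', ''t'', ''g'', ''w'', ''h'', ''P'', ''M'', ''L'', ''K'', ''l'', ''z'', ''x'', ''j'', ''y'', ''u'', ''i''}"
  "rw NODE = {''C'', ''Z''}"
  by (auto simp: NODE_def)

lemma nw_QUEUE [simp]: "nw QUEUE = nw NODE" "rw QUEUE = {''C'', ''Z''}"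
  by (auto simp: QUEUE_def)

lemma nw_START1 [simp]: "nw START1 = {''w'', ''M'', ''P'', ''L'', ''K''}" "rw START1 = {''C''}"
  by (auto simp: START1_def)

lemma nw_START [simp]: "nw START = {''w'', ''M'', ''P'', ''L'', ''K'', ''f'', ''l'', ''i''}" "rw START = {''C''}"
  by (auto simp: START_def)

section \<open>Partial paths in memory\<close>

definition rows_eq :: "state \<Rightarrow> state \<Rightarrow> nat \<Rightarrow> bool" where
  "rows_eq s s' j \<longleftrightarrow> nmem s' ''P'' j = nmem s ''P'' j \<and> nmem s' ''M'' j = nmem s ''M'' j \<and>
     nmem s' ''L'' 0 j = nmem s ''L'' 0 j \<and> nmem s' ''K'' 0 j = nmem s ''K'' 0 j \<and> rmem s' ''C'' 0 j = rmem s ''C'' 0 j"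

context dp
begin

definition code :: "nat list \<Rightarrow> nat" where
  "code q = set_encode (insert (n + hd q) (set q))"

lemma code_inject:
  assumes "partial_path q" "partial_path q'"
  shows "code q = code q' \<longleftrightarrow> set q = set q' \<and> hd q = hd q'"
proof
  assume "code q = code q'"
  then have e: "insert (n + hd q) (set q) = insert (n + hd q') (set q')"
    unfolding code_def by (subst (asm) set_encode_eq) auto
  have V: "set q \<subseteq> V" "set q' \<subseteq> V" using assms by (auto simp: partial_path_def)
  have "insert (n + hd p) (set p) \<inter> V = set p \<and> insert (n + hd p) (set p) - V = {n + hd p}"
    if "set p \<subseteq> V" for p using that by auto
  from this [OF V(1)] this [OF V(2)] have "set q = set q'" "{n + hd q} = {n + hd q'}" using e by metis+
  then show "set q = set q' \<and> hd q = hd q'" by simp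
qed (simp add: code_def)

text \<open>Inserting a new element into a binary code is a single addition, and the first vertex
  stays the same. This makes the key of an extension available without touching its
  elements.\<close>

lemma code_snoc:
  assumes "partial_path q" "ext q u"
  shows "code (q @ [u]) = code q + 2 ^ u"
proof -
  have "q \<noteq> []" using assms by (simp add: partial_path_def)
  then have "insert (n + hd (q @ [u])) (set (q @ [u])) = insert u (insert (n + hd q) (set q))" by auto
  moreover have "u \<notin> insert (n + hd q) (set q)" using assms by (auto simp: ext_def)
  ultimately show ?thesis unfolding code_def by (simp add: set_encode_insert)
qed

lemma key_eq_code:
  assumes "partial_path q" "partial_path q'"
  shows "key q = key q' \<longleftrightarrow> code q = code q' \<and> last q = last q'"
  using code_inject [OF assms] by (auto simp: key_def)

definition node :: "state \<Rightarrow> nat \<Rightarrow> nat list \<Rightarrow> bool" where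
  "node s j q \<longleftrightarrow> (\<forall>t<length q. nmem s ''P'' j t = q ! t) \<and>
     (\<forall>w<n. nmem s ''M'' j w = (if w \<in> set q then 1 else 0)) \<and>
     nmem s ''L'' 0 j = length q \<and> nmem s ''K'' 0 j = code q \<and> rmem s ''C'' 0 j = path_cost c q"

lemma node_rows: "rows_eq s s' j \<Longrightarrow> node s' j q = node s j q"
  by (simp add: node_def rows_eq_def)

lemma node_last:
  assumes "node s j q" "q \<noteq> []"
  shows "nmem s ''P'' j (nmem s ''L'' 0 j - Suc 0) = last q"
  using assms by (simp add: node_def last_conv_nth)

text \<open>Only rows below \<open>l\<close> are constrained, so what earlier rounds left in other
  rows does not have to be cleared.\<close>

definition rep :: "state \<Rightarrow> nat list list \<Rightarrow> bool" where
  "rep s ps \<longleftrightarrow> nmem s ''l'' 0 0 = length ps \<and> (\<forall>j<length ps. node s j (ps ! j))"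

lemma rep_frame:
  assumes "rep s ps" "frame A B s s'" "''P'' \<notin> A" "''M'' \<notin> A" "''L'' \<notin> A" "''K'' \<notin> A" "''l'' \<notin> A" "''C'' \<notin> B"
  shows "rep s' ps"
  using assms by (simp add: rep_def node_def frameN [OF assms(2)] frameR [OF assms(2)])

lemma runs_TEST:
  assumes env: "env s" and Z: "n < Z" and q: "node s i q" "partial_path q" and i: "nmem s ''i'' 0 0 = i"
    and u: "nmem s ''u'' 0 0 = u" "u < n"
  shows "runs TEST s (\<lambda>t s'. t \<le> 6 * Z \<and> nmem s' ''y'' 0 0 = (if ext q u then 1 else 0))"
proof -
  let ?y = "if u \<notin> set q \<and> {last q, u} \<in> E then Suc 0 else 0"
  let ?s = "s\<lparr>nmem := upd_cell (nmem s) ''y'' 0 0 ?y\<rparr>"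
  have fr: "frame {''y''} {} s ?s" by (auto simp: frame_def upd_cell_def)
  have e: "env ?s" by (rule env_frame [OF env fr]) auto
  have M: "nmem s ''M'' i w = (if w \<in> set q then 1 else 0)" if "w < n" for w
    using q(1) that by (simp add: node_def)
  have lst: "nmem s ''P'' i (nmem s ''L'' 0 i - Suc 0) = last q" using node_last [OF q(1)] q(2) by (simp add: partial_path_def)
  have ne: "w \<in> set q \<Longrightarrow> w < n" for w using q(2) by (auto simp: partial_path_def)
  have run: "runs (FOR ''w'' (sc ''n'') TEST1) ?s (\<lambda>t s'. t \<le> 4 * Z \<and> nmem s' ''y'' 0 0 = (if ext q u then 1 else 0))"
  proof (rule runs_FORn [OF e, where I = "\<lambda>k s'. nmem s' ''y'' 0 0 =
      (if u \<notin> set q \<and> {last q, u} \<in> E \<and> (\<forall>w<k. w \<in> set q \<longrightarrow> (u, w) \<notin> \<pi>) then 1 else 0)" and tb = 2], goal_cases)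
    case (4 k s')
    have f: "nmem s' ''M'' = nmem s ''M''" "nmem s' ''i'' = nmem s ''i''" "nmem s' ''u'' = nmem s ''u''"
      using frameN [OF 4(5), of "''M''"] frameN [OF 4(5), of "''i''"] frameN [OF 4(5), of "''u''"] by simp_all
    show ?case using 4(2,3) M [OF 4(1)] i u envD(3) [OF 4(4), of u k] unfolding TEST1_def
      by (auto simp: f less_Suc_eq)
  next
    case (5 t s')
    have "ext q u \<longleftrightarrow> u \<notin> set q \<and> {last q, u} \<in> E \<and> (\<forall>w<n. w \<in> set q \<longrightarrow> (u, w) \<notin> \<pi>)"
      using u(2) ne by (auto simp: ext_def)
    then show ?case using 5(1,2) for_time0 [OF Z, of 2] by auto
  qed auto
  have c: "bval (BAnd (BNot (NEq (NCell ''M'' (sc ''i'') (sc ''u'')) (NConst 1)))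
       (NEq (NCell ''edge'' (end_of ''i'') (sc ''u'')) (NConst 1))) s \<longleftrightarrow> u \<notin> set q \<and> {last q, u} \<in> E"
    using M [OF u(2)] i u lst envD(2) [OF env, of "last q" u] by simp
  have "runs (Cond (BAnd (BNot (NEq (NCell ''M'' (sc ''i'') (sc ''u'')) (NConst 1)))
       (NEq (NCell ''edge'' (end_of ''i'') (sc ''u'')) (NConst 1))) (assign ''y'' (NConst 1)) (assign ''y'' (NConst 0))) s
       (\<lambda>t s'. t = 2 \<and> s' = ?s)"
    unfolding runs_Cond c by simp
  then show ?thesis unfolding TEST_def runs_Seq
  proof (rule runs_mono, goal_cases)
    case (1 t s')
    then have t: "t = 2" and s': "s' = ?s" by auto
    show ?case unfolding s' by (rule runs_mono [OF run]) (use t Z in auto)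
  qed
qed

lemma runs_SCAN:
  assumes rep: "rep s ps" and Z: "length ps < Z" and q: "partial_path q" and partial_path: "\<And>j. j < length ps \<Longrightarrow> partial_path (ps ! j)"
    and z: "nmem s ''z'' 0 0 = code q" and u: "nmem s ''u'' 0 0 = last q" and x: "nmem s ''x'' 0 0 = length ps"
  shows "runs SCAN s (\<lambda>t s'. t \<le> 4 * Z \<and>
     (nmem s' ''x'' 0 0 = length ps \<and> (\<forall>j<length ps. key (ps ! j) \<noteq> key q) \<or>
      nmem s' ''x'' 0 0 < length ps \<and> key (ps ! (nmem s' ''x'' 0 0)) = key q))"
  unfolding SCAN_def
proof (rule runs_FOR [where N = "length ps" and tb = 2 and I = "\<lambda>k s'.
     nmem s' ''x'' 0 0 = length ps \<and> (\<forall>j<k. key (ps ! j) \<noteq> key q) \<or>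
      nmem s' ''x'' 0 0 < length ps \<and> key (ps ! (nmem s' ''x'' 0 0)) = key q"], goal_cases)
  case (1 s')
  then show ?case using rep by (simp add: frameN rep_def)
next
  case 2
  then show ?case using x by simp
next
  case (3 k s')
  have f: "nmem s' ''P'' = nmem s ''P''" "nmem s' ''L'' = nmem s ''L''" "nmem s' ''K'' = nmem s ''K''"
    "nmem s' ''z'' = nmem s ''z''" "nmem s' ''u'' = nmem s ''u''"
    using frameN [OF 3(4), of "''P''"] frameN [OF 3(4), of "''L''"] frameN [OF 3(4), of "''K''"]
      frameN [OF 3(4), of "''z''"] frameN [OF 3(4), of "''u''"] by simp_all
  have nd: "node s k (ps ! k)" using rep 3(1) by (simp add: rep_def)
  have pk: "partial_path (ps ! k)" using partial_path 3(1) by simp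
  have l: "nmem s ''P'' k (nmem s ''L'' 0 k - Suc 0) = last (ps ! k)" using node_last [OF nd] pk by (simp add: partial_path_def)
  have K: "nmem s ''K'' 0 k = code (ps ! k)" using nd by (simp add: node_def)
  have c: "bval (BAnd (NEq (cell ''K'' (sc ''j'')) (sc ''z'')) (NEq (end_of ''j'') (sc ''u''))) s' \<longleftrightarrow> key (ps ! k) = key q"
    unfolding key_eq_code [OF pk q] using 3(3) l K z u by (simp add: f)
  show ?case
  proof (cases "key (ps ! k) = key q")
    case True
    then show ?thesis unfolding SCAN1_def runs_Cond c using 3(1,3) by simp
  next
    case False
    then show ?thesis unfolding SCAN1_def runs_Cond c using 3(2,3) by (auto simp: less_Suc_eq)
  qed
next
  case (4 t s')
  then show ?case using for_time0 [OF Z, of 2] by auto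
qed

text \<open>All \<open>n\<close> cells of a row are copied, although only the first
  \<open>length q\<close> of \<open>P\<close> are meaningful; the next one is then set to
  \<open>u\<close>. The condition \<open>x \<noteq> i\<close> keeps the source row intact.\<close>

lemma runs_WRITE:
  assumes env: "env s" and Z: "n < Z" and q: "node s i q" "partial_path q" and i: "nmem s ''i'' 0 0 = i"
    and u: "nmem s ''u'' 0 0 = u" "ext q u" and x: "nmem s ''x'' 0 0 = x" "x \<noteq> i"
    and z: "nmem s ''z'' 0 0 = code (q @ [u])" "rmem s ''Z'' 0 0 = path_cost c (q @ [u])"
  shows "runs WRITE s (\<lambda>t s'. t \<le> 9 * Z \<and> node s' x (q @ [u]) \<and> (\<forall>j. j \<noteq> x \<longrightarrow> rows_eq s s' j))"
proof -
  have run: "runs (FOR ''w'' (sc ''n'') WRITE1) s (\<lambda>t s'. t \<le> 4 * Z \<and>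
     (\<forall>w<n. nmem s' ''P'' x w = nmem s ''P'' i w \<and> nmem s' ''M'' x w = nmem s ''M'' i w) \<and>
     (\<forall>j. j \<noteq> x \<longrightarrow> nmem s' ''P'' j = nmem s ''P'' j \<and> nmem s' ''M'' j = nmem s ''M'' j) \<and>
     frame {''w'', ''P'', ''M''} {} s s')"
  proof (rule runs_FORn [OF env, where tb = 2 and I = "\<lambda>k s'.
     (\<forall>w<k. nmem s' ''P'' x w = nmem s ''P'' i w \<and> nmem s' ''M'' x w = nmem s ''M'' i w) \<and>
     (\<forall>j. j \<noteq> x \<longrightarrow> nmem s' ''P'' j = nmem s ''P'' j \<and> nmem s' ''M'' j = nmem s ''M'' j)"], goal_cases)
    case (4 k s')
    have f: "nmem s' ''i'' = nmem s ''i''" "nmem s' ''x'' = nmem s ''x''"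
      using frameN [OF 4(5), of "''i''"] frameN [OF 4(5), of "''x''"] by simp_all
    have r: "nmem s' ''P'' i = nmem s ''P'' i" "nmem s' ''M'' i = nmem s ''M'' i" using 4(2) x(2) by auto
    show ?case using 4(2,3) i x r unfolding WRITE1_def by (auto simp: f less_Suc_eq fun_eq_iff)
  next
    case (5 t s')
    then show ?case using for_time0 [OF Z, of 2] by auto
  qed auto
  have len: "length q \<le> n"
    using q(2) card_mono [of V "set q"] by (auto simp: partial_path_def distinct_card)
  have un: "u < n" using u(2) by (simp add: ext_def)
  have nd: "\<And>t. t < length q \<Longrightarrow> nmem s ''P'' i t = q ! t"
    "\<And>w. w < n \<Longrightarrow> nmem s ''M'' i w = (if w \<in> set q then 1 else 0)"
    "nmem s ''L'' 0 i = length q"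
    using q(1) by (auto simp: node_def)
  show ?thesis unfolding WRITE_def runs_Seq
  proof (rule runs_mono [OF run], goal_cases)
    case (1 t s')
    then have t: "t \<le> 4 * Z" and a: "\<And>w. w < n \<Longrightarrow> nmem s' ''P'' x w = nmem s ''P'' i w \<and> nmem s' ''M'' x w = nmem s ''M'' i w"
      and b: "\<And>j. j \<noteq> x \<Longrightarrow> nmem s' ''P'' j = nmem s ''P'' j \<and> nmem s' ''M'' j = nmem s ''M'' j"
      and fr: "frame {''w'', ''P'', ''M''} {} s s'" by auto
    have f: "nmem s' ''i'' = nmem s ''i''" "nmem s' ''x'' = nmem s ''x''" "nmem s' ''u'' = nmem s ''u''"
      "nmem s' ''L'' = nmem s ''L''" "nmem s' ''K'' = nmem s ''K''" "nmem s' ''z'' = nmem s ''z''" "rmem s' = rmem s"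
      using fr by (auto simp: frame_def)
    show ?case
      using t Z i u x z nd a b len un
      by (auto simp: f node_def rows_eq_def nth_append fun_eq_iff less_Suc_eq)
  qed
qed

text \<open>The three outcomes of the scan and the cost comparison correspond to
  \<open>inv_append\<close>, \<open>inv_replace\<close> and \<open>inv_keep\<close>.\<close>

lemma runs_STORE:
  assumes env: "env s" and Z: "n < Z" and rep: "rep s ps" and I: "search_inv i u ps" and il: "i < length ps"
    and g: "good (set (ps ! i))" and e: "ext (ps ! i) u" and i: "nmem s ''i'' 0 0 = i" and u: "nmem s ''u'' 0 0 = u"
    and z: "nmem s ''z'' 0 0 = code (ps ! i @ [u])" "rmem s ''Z'' 0 0 = path_cost c (ps ! i @ [u])"
    and x: "nmem s ''x'' 0 0 = x" and xl: "x = length ps \<and> (\<forall>j<length ps. key (ps ! j) \<noteq> key (ps ! i @ [u])) \<or>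
      x < length ps \<and> key (ps ! x) = key (ps ! i @ [u])"
  shows "runs STORE s (\<lambda>t s'. t \<le> 11 * Z \<and> (\<exists>ps'. rep s' ps' \<and> search_inv i (Suc u) ps' \<and>
     length ps \<le> length ps' \<and> length ps' \<le> Suc (length ps) \<and> ps' ! i = ps ! i))"
proof -
  have nd: "node s i (ps ! i)" and l: "nmem s ''l'' 0 0 = length ps" using rep il by (simp_all add: rep_def)
  have p: "partial_path (ps ! i)" using I il by (simp add: search_inv_def)
  have "u \<notin> set (ps ! i)" using e by (simp add: ext_def)
  then have ne: "key (ps ! i) \<noteq> key (ps ! i @ [u])" by (auto simp: key_def)
  then have xi: "x \<noteq> i" using xl il by auto
  note W = runs_frame [OF runs_WRITE [OF env Z nd p i u e x xi z]]
  show ?thesis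
  proof (cases "x = length ps")
    case True
    then have new: "\<And>j. j < length ps \<Longrightarrow> key (ps ! j) \<noteq> key (ps ! i @ [u])" using xl by auto
    have "runs WRITE s (\<lambda>t s'. runs (assign ''l'' (NAdd (sc ''l'') (NConst 1))) s'
       (\<lambda>t' s''. 1 + (t + t') \<le> 11 * Z \<and> (\<exists>ps'. rep s'' ps' \<and> search_inv i (Suc u) ps' \<and>
     length ps \<le> length ps' \<and> length ps' \<le> Suc (length ps) \<and> ps' ! i = ps ! i)))"
    proof (rule runs_mono [OF W], goal_cases)
      case (1 t s')
      then have t: "t \<le> 9 * Z" and n1: "node s' x (ps ! i @ [u])" and n2: "\<And>j. j \<noteq> x \<Longrightarrow> rows_eq s s' j"
        and fr: "frame (nw WRITE) (rw WRITE) s s'" by auto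
      have l': "nmem s' ''l'' = nmem s ''l''" by (rule frameN [OF fr]) simp
      let ?s = "s'\<lparr>nmem := upd_cell (nmem s') ''l'' 0 0 (Suc (length ps))\<rparr>"
      have "node ?s j ((ps @ [ps ! i @ [u]]) ! j)" if "j < Suc (length ps)" for j
      proof -
        have "node s' j ((ps @ [ps ! i @ [u]]) ! j)"
          using that n1 n2 [of j] True rep by (cases "j = length ps") (auto simp: nth_append node_rows rep_def)
        then show ?thesis by (simp add: node_def)
      qed
      then have "rep ?s (ps @ [ps ! i @ [u]])" by (simp add: rep_def)
      moreover have "search_inv i (Suc u) (ps @ [ps ! i @ [u]])" by (rule inv_append [OF I il g e new])
      ultimately show ?case using t Z l l' il
        by (auto simp: nth_append intro!: exI [of _ "ps @ [ps ! i @ [u]]"])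
    qed
    then show ?thesis using True l x by (simp add: STORE_def)
  next
    case False
    then have xl': "x < length ps" and k: "key (ps ! x) = key (ps ! i @ [u])" using xl by auto
    have C: "rmem s ''C'' 0 x = path_cost c (ps ! x)" using rep xl' by (simp add: rep_def node_def)
    show ?thesis
    proof (cases "path_cost c (ps ! i @ [u]) < path_cost c (ps ! x)")
      case True
      have "runs WRITE s (\<lambda>t s'. 1 + (1 + t) \<le> 11 * Z \<and> (\<exists>ps'. rep s' ps' \<and> search_inv i (Suc u) ps' \<and>
     length ps \<le> length ps' \<and> length ps' \<le> Suc (length ps) \<and> ps' ! i = ps ! i))"
      proof (rule runs_mono [OF W], goal_cases)
        case (1 t s')
        then have t: "t \<le> 9 * Z" and n1: "node s' x (ps ! i @ [u])" and n2: "\<And>j. j \<noteq> x \<Longrightarrow> rows_eq s s' j"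
          and fr: "frame (nw WRITE) (rw WRITE) s s'" by auto
        have l': "nmem s' ''l'' = nmem s ''l''" by (rule frameN [OF fr]) simp
        have "node s' j (ps[x := ps ! i @ [u]] ! j)" if "j < length ps" for j
          using that n1 n2 [of j] rep xl' by (cases "j = x") (auto simp: node_rows rep_def)
        then have "rep s' (ps[x := ps ! i @ [u]])" using l l' by (simp add: rep_def)
        moreover have "search_inv i (Suc u) (ps[x := ps ! i @ [u]])" by (rule inv_replace [OF I il g e xl' k True])
        ultimately show ?case using t Z xi
          by (intro conjI exI [of _ "ps[x := ps ! i @ [u]]"]) auto
      qed
      then show ?thesis using False True l x z C by (simp add: STORE_def)
    next
      case 2: False
      have "search_inv i (Suc u) ps" by (rule inv_keep [OF I xl' k]) (use 2 in simp)
      then show ?thesis using False 2 l x z C rep Z by (auto simp: STORE_def)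
    qed
  qed
qed

lemma runs_UPDATE:
  assumes env: "env s" and Z: "n < Z" "length ps < Z" and rep: "rep s ps" and I: "search_inv i u ps" and il: "i < length ps"
    and g: "good (set (ps ! i))" and e: "ext (ps ! i) u" and i: "nmem s ''i'' 0 0 = i" and u: "nmem s ''u'' 0 0 = u"
  shows "runs UPDATE s (\<lambda>t s'. t \<le> 18 * Z \<and> (\<exists>ps'. rep s' ps' \<and> search_inv i (Suc u) ps' \<and>
     length ps \<le> length ps' \<and> length ps' \<le> Suc (length ps) \<and> ps' ! i = ps ! i))"
proof -
  have nd: "node s i (ps ! i)" and l: "nmem s ''l'' 0 0 = length ps" using rep il by (simp_all add: rep_def)
  have p: "partial_path (ps ! i)" using I il by (simp add: search_inv_def)
  then have ne: "ps ! i \<noteq> []" by (simp add: partial_path_def)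
  have un: "u < n" "{last (ps ! i), u} \<in> E" using e by (auto simp: ext_def)
  let ?q = "ps ! i @ [u]"
  have pq: "partial_path ?q" using p e pre_snoc [OF ne] by blast
  let ?s = "s\<lparr>rmem := upd_cell (rmem s) ''Z'' 0 0 (path_cost c ?q),
     nmem := upd_cell (upd_cell (nmem s) ''z'' 0 0 (code ?q)) ''x'' 0 0 (length ps)\<rparr>"
  have fr: "frame {''z'', ''x''} {''Z''} s ?s" by (auto simp: frame_def upd_cell_def)
  have e1: "env ?s" by (rule env_frame [OF env fr]) auto
  have r1: "rep ?s ps" by (rule rep_frame [OF rep fr]) auto
  have K: "nmem s ''K'' 0 i = code (ps ! i)" "rmem s ''C'' 0 i = path_cost c (ps ! i)"
    using nd by (simp_all add: node_def)
  have z: "nmem s ''K'' 0 i + nmem s ''W'' 0 u = code ?q"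
    using K code_snoc [OF p e] envD(5) [OF env, of u] un by simp
  have zz: "rmem s ''C'' 0 i + rmem s ''cost'' (nmem s ''P'' i (nmem s ''L'' 0 i - Suc 0)) u = path_cost c ?q"
    using K node_last [OF nd ne] envD(4) [OF env, of "last (ps ! i)" u] un path_cost_snoc [OF ne] by simp
  have S: "runs SCAN ?s (\<lambda>t s'. (t \<le> 4 * Z \<and>
     (nmem s' ''x'' 0 0 = length ps \<and> (\<forall>j<length ps. key (ps ! j) \<noteq> key ?q) \<or>
      nmem s' ''x'' 0 0 < length ps \<and> key (ps ! (nmem s' ''x'' 0 0)) = key ?q)) \<and> frame (nw SCAN) (rw SCAN) ?s s')"
    by (rule runs_frame, rule runs_SCAN [OF r1 Z(2) pq]) (use I u in \<open>auto simp: search_inv_def\<close>)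
  have "runs SCAN ?s (\<lambda>t s1. runs STORE s1 (\<lambda>t' s'. 1 + (1 + (1 + (t + t'))) \<le> 18 * Z \<and> (\<exists>ps'. rep s' ps' \<and> search_inv i (Suc u) ps' \<and>
     length ps \<le> length ps' \<and> length ps' \<le> Suc (length ps) \<and> ps' ! i = ps ! i)))"
  proof (rule runs_mono [OF S], goal_cases)
    case (1 t s1)
    then have t: "t \<le> 4 * Z" and x: "nmem s1 ''x'' 0 0 = length ps \<and> (\<forall>j<length ps. key (ps ! j) \<noteq> key ?q) \<or>
      nmem s1 ''x'' 0 0 < length ps \<and> key (ps ! (nmem s1 ''x'' 0 0)) = key ?q"
      and f: "frame (nw SCAN) (rw SCAN) ?s s1" by auto
    have e2: "env s1" by (rule env_frame [OF e1 f]) auto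
    have r2: "rep s1 ps" by (rule rep_frame [OF r1 f]) auto
    have i': "nmem s1 ''i'' 0 0 = i" using frameN [OF f, of "''i''"] i by simp
    have u': "nmem s1 ''u'' 0 0 = u" using frameN [OF f, of "''u''"] u by simp
    have z': "nmem s1 ''z'' 0 0 = code ?q" using frameN [OF f, of "''z''"] by simp
    have zz': "rmem s1 ''Z'' 0 0 = path_cost c ?q" using frameR [OF f, of "''Z''"] by simp
    show ?case
      by (rule runs_mono [OF runs_STORE [OF e2 Z(1) r2 I il g e i' u' z' zz' refl x]]) (use t Z in auto)
  qed
  then show ?thesis using z zz i u l by (simp add: UPDATE_def)
qed

lemma runs_TRY:
  assumes env: "env s" and Z: "n < Z" "length ps < Z" and rep: "rep s ps" and I: "search_inv i u ps" and il: "i < length ps"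
    and g: "good (set (ps ! i))" and i: "nmem s ''i'' 0 0 = i" and u: "nmem s ''u'' 0 0 = u" "u < n"
  shows "runs TRY s (\<lambda>t s'. t \<le> 26 * Z \<and> (\<exists>ps'. rep s' ps' \<and> search_inv i (Suc u) ps' \<and>
     length ps \<le> length ps' \<and> length ps' \<le> Suc (length ps) \<and> ps' ! i = ps ! i))"
proof -
  have nd: "node s i (ps ! i)" using rep il by (simp add: rep_def)
  have p: "partial_path (ps ! i)" using I il by (simp add: search_inv_def)
  show ?thesis unfolding TRY_def runs_Seq
  proof (rule runs_mono [OF runs_frame [OF runs_TEST [OF env Z(1) nd p i u]]], goal_cases)
    case (1 t s1)
    then have t: "t \<le> 6 * Z" and y: "nmem s1 ''y'' 0 0 = (if ext (ps ! i) u then 1 else 0)"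
      and f: "frame (nw TEST) (rw TEST) s s1" by auto
    have e2: "env s1" by (rule env_frame [OF env f]) auto
    have r2: "rep s1 ps" by (rule rep_frame [OF rep f]) auto
    have i': "nmem s1 ''i'' 0 0 = i" using frameN [OF f, of "''i''"] i by simp
    have u': "nmem s1 ''u'' 0 0 = u" using frameN [OF f, of "''u''"] u by simp
    show ?case
    proof (cases "ext (ps ! i) u")
      case True
      have b: "bval (NEq (sc ''y'') (NConst 1)) s1" using y True by simp
      show ?thesis unfolding runs_Cond if_P [OF b]
        by (rule runs_mono [OF runs_UPDATE [OF e2 Z r2 I il g True i' u']]) (use t Z in auto)
    next
      case False
      have b: "\<not> bval (NEq (sc ''y'') (NConst 1)) s1" using y False by simp
      show ?thesis unfolding runs_Cond if_not_P [OF b] runs_Skip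
        using t Z r2 inv_skip [OF I False] by (intro conjI exI [of _ ps]) auto
    qed
  qed
qed

lemma deletion_row_frame:
  assumes "deletion_row s" "frame A B s s'" "''T'' \<notin> A" "''r'' \<notin> A"
  shows "deletion_row s'"
  using assms by (simp add: deletion_row_def frameN [OF assms(2)])

text \<open>The list may grow by one state for every \<open>u\<close> while the node is processed;
  the bound \<open>Z\<close> leaves room for these \<open>n\<close> additional states.\<close>

lemma runs_NODE:
  assumes env: "env s" and tr: "deletion_row s" and Z: "length ps + n < Z" and rep: "rep s ps" and I: "search_inv i 0 ps"
    and il: "i < length ps" and i: "nmem s ''i'' 0 0 = i"
  shows "runs NODE s (\<lambda>t s'. t \<le> 45 * Z ^ 4 \<and> (\<exists>ps'. rep s' ps' \<and> search_inv (Suc i) 0 ps' \<and>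
     length ps \<le> length ps' \<and> length ps' \<le> length ps + n) \<and> nmem s' ''i'' 0 0 = Suc i)"
proof -
  have Zn: "n < Z" using Z by simp
  have Z4: "1 \<le> Z ^ 4" "Z ^ 2 \<le> Z ^ 4" using Zn power_increasing [of 2 4 Z] by auto
  have M: "nmem s ''M'' (nmem s ''i'' 0 0) a = (if a \<in> set (ps ! i) then 1 else 0)" if "a < n" for a
    using rep il i that by (simp add: rep_def node_def)
  have fin: "runs (assign ''i'' (NAdd (sc ''i'') (NConst 1))) s2
     (\<lambda>t3 s'. t1 + ((1 + t2) + t3) \<le> 45 * Z ^ 4 \<and> (\<exists>ps'. rep s' ps' \<and> search_inv (Suc i) 0 ps' \<and>
     length ps \<le> length ps' \<and> length ps' \<le> length ps + n) \<and> nmem s' ''i'' 0 0 = Suc i)"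
    if "t1 \<le> 17 * Z ^ 4" "t2 \<le> 26 * Z ^ 2" "rep s2 ps2" "search_inv i n ps2" "length ps \<le> length ps2" "length ps2 \<le> length ps + n"
      "nmem s2 ''i'' 0 0 = i" for t1 t2 s2 ps2
  proof -
    let ?s = "s2\<lparr>nmem := upd_cell (nmem s2) ''i'' 0 0 (Suc i)\<rparr>"
    have "rep ?s ps2" by (rule rep_frame [OF that(3) frame_upd(1) [of "''i''" "{''i''}" "{}"]]) auto
    moreover have "search_inv (Suc i) 0 ps2" using that(4) by (rule inv_next)
    ultimately show ?thesis using that Z4 by auto
  qed
  show ?thesis unfolding NODE_def runs_Seq
  proof (rule runs_mono [OF runs_frame [OF runs_CHECK [OF env Zn tr M]]], goal_cases)
    case (2 t1 s1)
    then have t1: "t1 \<le> 17 * Z ^ 4" and h: "nmem s1 ''h'' 0 0 = (if good (set (ps ! i)) then 1 else 0)"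
      and f: "frame (nw CHECK) (rw CHECK) s s1" by auto
    have e1: "env s1" by (rule env_frame [OF env f]) auto
    have r1: "rep s1 ps" by (rule rep_frame [OF rep f]) auto
    have i1: "nmem s1 ''i'' 0 0 = i" using frameN [OF f, of "''i''"] i by simp
    show ?case
    proof (cases "good (set (ps ! i))")
      case True
      have b: "bval (NEq (sc ''h'') (NConst 1)) s1" using h True by simp
      \<comment> \<open>The component test is made once, before the loop. Keeping row
        \<open>i\<close> unchanged is what lets its result remain valid for every
        \<open>u\<close>.\<close>
      let ?J = "\<lambda>u s'. \<exists>ps'. rep s' ps' \<and> search_inv i u ps' \<and> length ps \<le> length ps' \<and> length ps' \<le> length ps + u \<and> ps' ! i = ps ! i"
      have J: "?J u (s'\<lparr>nmem := upd_cell (nmem s') ''u'' 0 0 v\<rparr>) = ?J u s'" for u s' v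
      proof -
        have "rep (s'\<lparr>nmem := upd_cell (nmem s') ''u'' 0 0 v\<rparr>) p = rep s' p" for p
          by (simp add: rep_def node_def)
        then show ?thesis by simp
      qed
      have loop: "runs (FOR ''u'' (sc ''n'') TRY) s1 (\<lambda>t s'. t \<le> 26 * Z ^ 2 \<and> ?J n s' \<and> nmem s' ''i'' 0 0 = i)"
      proof (rule runs_FORn [OF e1, where I = ?J and tb = "26 * Z"], goal_cases)
        case 3
        show ?case unfolding J using r1 I by (intro exI [of _ ps]) auto
      next
        case (4 u s')
        obtain ps' where p: "rep s' ps'" "search_inv i u ps'" "length ps \<le> length ps'" "length ps' \<le> length ps + u" "ps' ! i = ps ! i"
          using 4(2) by blast
        have i': "nmem s' ''i'' 0 0 = i" using frameN [OF 4(5), of "''i''"] i1 by simp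
        have Z': "length ps' < Z" using p(4) 4(1) Z by simp
        have il': "i < length ps'" using il p(3) by simp
        have g': "good (set (ps' ! i))" using True p(5) by simp
        show ?case
        proof (rule runs_mono [OF runs_frame [OF runs_TRY [OF 4(4) Zn Z' p(1,2) il' g' i' 4(3,1)]]], goal_cases)
          case (1 t s'')
          then obtain ps'' where p'': "rep s'' ps''" "search_inv i (Suc u) ps''" "length ps' \<le> length ps''"
              "length ps'' \<le> Suc (length ps')" "ps'' ! i = ps' ! i"
            and t: "t \<le> 26 * Z" and f: "frame (nw TRY) (rw TRY) s' s''" by blast
          have "nmem s'' ''u'' = nmem s' ''u''" by (rule frameN [OF f]) simp
          moreover have "?J (Suc u) s''" using p'' p(3-5) by (intro exI [of _ ps'']) auto
          ultimately show ?case unfolding J using t 4(3) by simp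
        qed
      next
        case (5 t s')
        have "t \<le> 26 * Z ^ 2" using 5(2) for_time [of "26 * Z" 26 Z 1 n] Zn by (simp add: eval_nat_numeral)
        moreover have "nmem s' ''i'' 0 0 = i" using frameN [OF 5(4), of "''i''"] i1 by simp
        ultimately show ?case using 5(1) by blast
      qed auto
      show ?thesis unfolding runs_Cond if_P [OF b]
      proof (rule runs_mono [OF loop], goal_cases)
        case (1 t2 s2)
        then show ?case using fin [OF t1] by blast
      qed
    next
      case False
      have b: "\<not> bval (NEq (sc ''h'') (NConst 1)) s1" using h False by simp
      have "search_inv i n ps" using I False by (rule inv_skip_all)
      then show ?thesis unfolding runs_Cond if_not_P [OF b] runs_Skip
        by (intro fin [OF t1 _ r1 _ _ _ i1]) (use Zn in \<open>auto simp: power2_eq_square\<close>)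
    qed
  qed
qed

lemma runs_QUEUE:
  assumes env: "env s" and tr: "deletion_row s" and Z: "r + n + n < Z" and rep: "rep s ps" and I: "search_inv 0 0 ps"
    and i: "nmem s ''i'' 0 0 = 0" and r: "nmem s ''r'' 0 0 = r" and l: "length ps \<le> r + n"
  shows "runs QUEUE s (\<lambda>t s'. t \<le> 47 * Z ^ 5 \<and> (\<exists>ps' i. rep s' ps' \<and> search_inv i 0 ps' \<and>
     nmem s' ''i'' 0 0 = i \<and> i \<le> length ps' \<and> length ps' \<le> r + n \<and> (i < length ps' \<longrightarrow> r < length ps')))"
proof -
  define J where "J k s' \<longleftrightarrow> env s' \<and> deletion_row s' \<and> nmem s' ''r'' 0 0 = r \<and> (\<exists>ps'. rep s' ps' \<and> search_inv (nmem s' ''i'' 0 0) 0 ps' \<and>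
     nmem s' ''i'' 0 0 \<le> length ps' \<and> length ps' \<le> r + n \<and> (k + nmem s' ''i'' 0 0 = r \<or> \<not> length ps' \<le> r \<or> r < nmem s' ''i'' 0 0))" for k s'
  have "runs QUEUE s (\<lambda>t s'. t \<le> r * (45 * Z ^ 4 + 1) + 1 \<and> (\<exists>k. J k s') \<and>
      \<not> bval (BAnd (NLess (sc ''i'') (sc ''l'')) (BNot (NLess (sc ''r'') (sc ''l'')))) s')"
    unfolding QUEUE_def
  proof (rule runs_While)
    show "J r s" unfolding J_def using env tr rep I i r l by auto
    fix k s' assume J: "J k s'" and b: "bval (BAnd (NLess (sc ''i'') (sc ''l'')) (BNot (NLess (sc ''r'') (sc ''l'')))) s'"
    obtain ps' where p: "env s'" "deletion_row s'" "nmem s' ''r'' 0 0 = r" "rep s' ps'" "search_inv (nmem s' ''i'' 0 0) 0 ps'" "length ps' \<le> r + n"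
      "k + nmem s' ''i'' 0 0 = r \<or> \<not> length ps' \<le> r \<or> r < nmem s' ''i'' 0 0" using J unfolding J_def by blast
    \<comment> \<open>The guard gives \<open>i < l\<close> and \<open>l \<le> r\<close>. The
      remaining count is therefore \<open>r - i\<close> and positive, and at most \<open>r\<close>
      nodes are expanded.\<close>
    have il: "nmem s' ''i'' 0 0 < length ps'" "length ps' \<le> r" using b p(3,4) by (auto simp: rep_def)
    then obtain k' where k': "k = Suc k'" using p(7) by (cases k) auto
    have Z': "length ps' + n < Z" using il Z by simp
    have "runs NODE s' (\<lambda>t s'. t \<le> 45 * Z ^ 4 \<and> J k' s')"
    proof (rule runs_mono [OF runs_frame [OF runs_NODE [OF p(1,2) Z' p(4,5) il(1) refl]]], goal_cases)
      case (1 t s'')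
      then obtain ps'' where p'': "rep s'' ps''" "search_inv (Suc (nmem s' ''i'' 0 0)) 0 ps''" "length ps' \<le> length ps''"
          "length ps'' \<le> length ps' + n" and i': "nmem s'' ''i'' 0 0 = Suc (nmem s' ''i'' 0 0)"
        and t: "t \<le> 45 * Z ^ 4" and f: "frame (nw NODE) (rw NODE) s' s''" by blast
      have e: "env s''" by (rule env_frame [OF p(1) f]) auto
      have tr: "deletion_row s''" by (rule deletion_row_frame [OF p(2) f]) auto
      have r'': "nmem s'' ''r'' 0 0 = r" using frameN [OF f, of "''r''"] p(3) by simp
      have "J k' s''" unfolding J_def using e tr r'' i' p'' p(7) k' il by auto
      then show ?case using t by blast
    qed
    then show "\<exists>k'. k = Suc k' \<and> runs NODE s' (\<lambda>t s'. t \<le> 45 * Z ^ 4 \<and> J k' s')" using k' by blast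
  qed
  then show ?thesis
  proof (rule runs_mono, goal_cases)
    case (1 t s')
    then obtain k where J: "J k s'" and t: "t \<le> r * (45 * Z ^ 4 + 1) + 1"
      and b: "\<not> bval (BAnd (NLess (sc ''i'') (sc ''l'')) (BNot (NLess (sc ''r'') (sc ''l'')))) s'" by blast
    have Z1: "1 \<le> Z ^ 4" using Z by simp
    have "r * (45 * Z ^ 4 + 1) + 1 \<le> r * (46 * Z ^ 4) + 46 * Z ^ 4" using Z1 by (intro add_mono mult_le_mono) auto
    also have "\<dots> = (r + 1) * (46 * Z ^ 4)" by simp
    also have "\<dots> \<le> Z * (46 * Z ^ 4)" using Z by (intro mult_le_mono1) simp
    also have "\<dots> \<le> 47 * Z ^ 5"
    proof -
      have "Z ^ 5 = Z * Z ^ 4" by (simp add: eval_nat_numeral)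
      then show ?thesis by simp
    qed
    finally have "t \<le> 47 * Z ^ 5" using t by simp
    moreover obtain ps' where p: "nmem s' ''r'' 0 0 = r" "rep s' ps'" "search_inv (nmem s' ''i'' 0 0) 0 ps'" "nmem s' ''i'' 0 0 \<le> length ps'"
       "length ps' \<le> r + n" using J unfolding J_def by blast
    moreover have "nmem s' ''i'' 0 0 < length ps' \<longrightarrow> r < length ps'" using b p(1,2) by (auto simp: rep_def)
    ultimately show ?case by blast
  qed
qed

lemma runs_START:
  assumes env: "env s" and Z: "n < Z"
  shows "runs START s (\<lambda>t s'. t \<le> 12 * Z ^ 2 \<and> rep s' (map (\<lambda>f. [f]) [0..<n]) \<and> nmem s' ''i'' 0 0 = 0)"
proof -
  define J where "J k s' \<longleftrightarrow> (\<forall>f<k. node s' f [f])" for k s'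
  have Jcong: "J k (s'\<lparr>nmem := upd_cell (nmem s') ''f'' 0 0 v\<rparr>) = J k s'" for k s' v
    by (simp add: J_def node_def)
  have loop: "runs (FOR ''f'' (sc ''n'') START1) s (\<lambda>t s'. t \<le> 10 * Z ^ 2 \<and> J n s' \<and> nmem s' ''n'' 0 0 = n)"
  proof (rule runs_FORn [OF env, where I = J and tb = "10 * Z"], goal_cases)
    case 3
    show ?case by (simp add: J_def)
  next
    case (4 f s')
    have clear: "runs (FOR ''w'' (sc ''n'') (NAssign ''M'' (sc ''f'') (sc ''w'') (NConst 0))) s'
      (\<lambda>t s''. t \<le> 3 * Z \<and> (\<forall>w<n. nmem s'' ''M'' f w = 0) \<and> (\<forall>j. j \<noteq> f \<longrightarrow> nmem s'' ''M'' j = nmem s' ''M'' j) \<and>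
         env s'' \<and> frame {''w'', ''M''} {} s' s'')"
    proof (rule runs_FORn [OF 4(4), where tb = 1 and I = "\<lambda>k s''. (\<forall>w<k. nmem s'' ''M'' f w = 0) \<and>
        (\<forall>j. j \<noteq> f \<longrightarrow> nmem s'' ''M'' j = nmem s' ''M'' j)"], goal_cases)
      case (4 k s'')
      have "nmem s'' ''f'' = nmem s' ''f''" using frameN [OF 4(5), of "''f''"] by simp
      then show ?case using 4(2,3) \<open>nmem s' ''f'' 0 0 = f\<close> by (auto simp: less_Suc_eq fun_eq_iff)
    next
      case (5 t s'')
      then show ?case using for_time0 [OF Z, of 1] by auto
    qed auto
    show ?case unfolding START1_def runs_Seq
    proof (rule runs_mono [OF clear], goal_cases)
      case (1 t s'')
      then have t: "t \<le> 3 * Z" and a: "\<And>w. w < n \<Longrightarrow> nmem s'' ''M'' f w = 0"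
        and b: "\<And>j. j \<noteq> f \<Longrightarrow> nmem s'' ''M'' j = nmem s' ''M'' j"
        and e: "env s''" and fr: "frame {''w'', ''M''} {} s' s''" by auto
      have g: "nmem s'' ''f'' = nmem s' ''f''" "nmem s'' ''P'' = nmem s' ''P''" "nmem s'' ''L'' = nmem s' ''L''"
        "nmem s'' ''K'' = nmem s' ''K''" "rmem s'' = rmem s'" using fr by (auto simp: frame_def)
      have W: "nmem s'' ''W'' 0 f = 2 ^ f" "nmem s'' ''W'' 0 (n + f) = 2 ^ (n + f)" "nmem s'' ''n'' 0 0 = n"
        using envD [OF e] 4(1) by auto
      have code: "code [f] = 2 ^ f + 2 ^ (n + f)" using 4(1) by (simp add: code_def)
      have cost: "path_cost c [f] = 0" by (simp add: path_cost_def)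
      show ?case using t Z a b 4(1,2,3) W
        by (auto simp: g J_def node_def code cost less_Suc_eq)
    qed
  next
    case (5 t s')
    then show ?case using for_time [of "10 * Z" 10 Z 1 n] Z envD(1) [of s'] by (simp add: eval_nat_numeral)
  qed auto
  have Z2: "1 \<le> Z ^ 2" using Z by simp
  show ?thesis unfolding START_def runs_Seq
  proof (rule runs_mono [OF loop], goal_cases)
    case (1 t s')
    then show ?case using Z2 by (auto simp: J_def rep_def node_def)
  qed
qed

end

section \<open>Enumerating deletion sets\<close>

text \<open>The indices number the words over \<open>n\<close> letters, and the set consists of the
  letters of the word. The children of word \<open>r\<close> have the indices from
  \<open>r * n + 1\<close> to \<open>r * n + n\<close>; treating the words in order thus appends new
  rows one after the other.\<close>

fun deletion_set :: "nat \<Rightarrow> nat \<Rightarrow> nat set" where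
  "deletion_set n 0 = {}"
| "deletion_set n (Suc m) = insert (m mod n) (deletion_set n (m div n))"

lemma deletion_set_step: "v < n \<Longrightarrow> deletion_set n (Suc (r * n + v)) = insert v (deletion_set n r)"
  by simp

lemma deletion_set_subset: "n \<ge> 1 \<Longrightarrow> deletion_set n r \<subseteq> {0..<n}"
  by (induction n r rule: deletion_set.induct) auto

text \<open>Spelling the set without repetition multiplies the index plus one by at most
  \<open>n + 1\<close> for each element.\<close>

lemma deletion_set_surj:
  assumes "finite T" "T \<subseteq> {0..<n}"
  shows "\<exists>r. deletion_set n r = T \<and> r + 1 \<le> (n + 1) ^ card T"
  using assms
proof (induction rule: finite_induct)
  case empty
  show ?case by (intro exI [of _ 0]) simp
next
  case (insert v T)
  then obtain r where r: "deletion_set n r = T" "r + 1 \<le> (n + 1) ^ card T" by auto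
  have "v < n" using insert by auto
  then have "deletion_set n (Suc (r * n + v)) = insert v T" using r deletion_set_step by simp
  moreover have "Suc (r * n + v) + 1 \<le> (n + 1) * (r + 1)" using \<open>v < n\<close> by (simp add: algebra_simps)
  then have "Suc (r * n + v) + 1 \<le> (n + 1) * (n + 1) ^ card T" using r(2) by (meson le_trans mult_le_mono2)
  ultimately show ?case using insert by (intro exI [of _ "Suc (r * n + v)"]) simp
qed

text \<open>Adding an element that is already present moves a set to a larger index.\<close>
lemma deletion_set_unbounded:
  assumes T: "T \<subseteq> {0..<n}" "T \<noteq> {}" and B: "(n + 1) ^ card T \<le> B"
  shows "\<exists>r. deletion_set n r = T \<and> B \<le> r \<and> r \<le> (n + 1) * (B + 1)"
proof -
  let ?R = "{r. deletion_set n r = T \<and> r < B}"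
  have "finite T" using T(1) finite_subset by blast
  then obtain r1 where "deletion_set n r1 = T" "r1 + 1 \<le> (n + 1) ^ card T" using deletion_set_surj T(1) by blast
  then have ne: "?R \<noteq> {}" using B by auto
  have fin: "finite ?R" by simp
  \<comment> \<open>Below \<open>B\<close> this is the last index of \<open>T\<close>. Its child
    obtained by inserting some \<open>v \<in> T\<close> is again an index of \<open>T\<close> and
    larger, so it has passed \<open>B\<close>, but by no more than a factor of about
    \<open>n + 1\<close>.\<close>
  define r where "r = Max ?R"
  have r: "deletion_set n r = T" "r < B" using Max_in [OF fin ne] by (auto simp: r_def)
  obtain v where v: "v \<in> T" using T(2) by blast
  then have vn: "v < n" using T(1) by auto
  let ?r = "Suc (r * n + v)"
  have 1: "deletion_set n ?r = T" using deletion_set_step [OF vn, of r] r(1) v by auto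
  have "r \<le> r * n" using vn by simp
  then have "r < ?r" by linarith
  then have "?r \<notin> ?R" using Max_ge [OF fin, folded r_def] by (meson leD)
  then have "B \<le> ?r" using 1 by (simp del: deletion_set.simps)
  moreover have "?r \<le> (n + 1) * (r + 1)" using vn by (simp add: algebra_simps)
  then have "?r \<le> (n + 1) * (B + 1)" using r(2) by (meson add_le_mono1 le_trans less_imp_le mult_le_mono2)
  ultimately show ?thesis using 1 by blast
qed

definition CHILD :: com where
  "CHILD = Seq (FOR ''w'' (sc ''n'') (NAssign ''T'' (sc ''k'') (sc ''w'') (NCell ''T'' (sc ''r'') (sc ''w''))))
     (Seq (NAssign ''T'' (sc ''k'') (sc ''v'') (NConst 1)) (assign ''k'' (NAdd (sc ''k'') (NConst 1))))"

definition CHILDREN :: com where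
  "CHILDREN = FOR ''v'' (sc ''n'') CHILD"

definition POWERS1 :: com where
  "POWERS1 = NAssign ''W'' (NConst 0) (NAdd (sc ''t'') (NConst 1)) (NAdd (cell ''W'' (sc ''t'')) (cell ''W'' (sc ''t'')))"

definition POWERS :: com where
  "POWERS = Seq (NAssign ''W'' (NConst 0) (NConst 0) (NConst 1)) (FOR ''t'' (NAdd (sc ''n'') (sc ''n'')) POWERS1)"

definition ROUND :: com where
  "ROUND = Seq CHILDREN (Seq START (Seq QUEUE
     (Seq (Cond (NLess (sc ''i'') (sc ''l'')) Skip (assign ''d'' (NConst 1)))
       (assign ''r'' (NAdd (sc ''r'') (NConst 1))))))"

definition FEASIBLE :: "bool \<Rightarrow> bexp" where
  "FEASIBLE cyc = (if cyc then BAnd (NEq (cell ''L'' (sc ''j'')) (sc ''n''))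
       (NEq (NCell ''edge'' (end_of ''j'') (NCell ''P'' (sc ''j'') (NConst 0))) (NConst 1))
     else NEq (cell ''L'' (sc ''j'')) (sc ''n''))"

definition OBJECTIVE :: "bool \<Rightarrow> rexp" where
  "OBJECTIVE cyc = (if cyc then RAdd (RCell ''C'' (NConst 0) (sc ''j'')) (RCell ''cost'' (end_of ''j'') (NCell ''P'' (sc ''j'') (NConst 0)))
     else RCell ''C'' (NConst 0) (sc ''j''))"

definition COPY :: com where
  "COPY = FOR ''w'' (sc ''n'') (NAssign ''path'' (NConst 0) (sc ''w'') (NCell ''P'' (sc ''j'') (sc ''w'')))"

text \<open>Until \<open>found\<close> is set, the cell \<open>B\<close> holds no objective value,
  and the test of \<open>found\<close> overrules the comparison with it.\<close>

definition IMPROVE :: com where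
  "IMPROVE = Cond (BAnd (NEq (sc ''found'') (NConst 1)) (BNot (RLess (RCell ''Z'' (NConst 0) (NConst 0)) (RCell ''B'' (NConst 0) (NConst 0)))))
     Skip (Seq (assign ''found'' (NConst 1)) (Seq (RAssign ''B'' (NConst 0) (NConst 0) (RCell ''Z'' (NConst 0) (NConst 0))) COPY))"

definition FINAL1 :: "bool \<Rightarrow> com" where
  "FINAL1 cyc = Cond (FEASIBLE cyc) (Seq (RAssign ''Z'' (NConst 0) (NConst 0) (OBJECTIVE cyc)) IMPROVE) Skip"

definition FINAL :: "bool \<Rightarrow> com" where
  "FINAL cyc = FOR ''j'' (sc ''l'') (FINAL1 cyc)"

definition SOLVE :: "bool \<Rightarrow> com" where
  "SOLVE cyc = Seq POWERS (Seq (assign ''k'' (NConst 1)) (Seq (While (NEq (sc ''d'') (NConst 0)) ROUND) (FINAL cyc)))"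

lemma nw_CHILD [simp]: "nw CHILD = {''w'', ''T'', ''k''}" "rw CHILD = {}"
  by (auto simp: CHILD_def)

lemma nw_CHILDREN [simp]: "nw CHILDREN = {''v'', ''w'', ''T'', ''k''}" "rw CHILDREN = {}"
  by (auto simp: CHILDREN_def)

lemma nw_POWERS1 [simp]: "nw POWERS1 = {''W''}" "rw POWERS1 = {}"
  by (auto simp: POWERS1_def)

lemma nw_POWERS [simp]: "nw POWERS = {''W'', ''t''}" "rw POWERS = {}"
  by (auto simp: POWERS_def)

lemma nw_COPY [simp]: "nw COPY = {''w'', ''path''}" "rw COPY = {}"
  by (auto simp: COPY_def)

lemma nw_IMPROVE [simp]: "nw IMPROVE = {''w'', ''path'', ''found''}" "rw IMPROVE = {''B''}"
  by (auto simp: IMPROVE_def)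

lemma nw_FINAL1 [simp]: "nw (FINAL1 cyc) = {''w'', ''path'', ''found''}" "rw (FINAL1 cyc) = {''B'', ''Z''}"
  by (auto simp: FINAL1_def)

definition feasible :: "nat \<Rightarrow> nat set set \<Rightarrow> bool \<Rightarrow> nat list \<Rightarrow> bool" where
  "feasible n E cyc q \<longleftrightarrow> length q = n \<and> (cyc \<longrightarrow> {last q, hd q} \<in> E)"

definition objective :: "(nat set \<Rightarrow> real) \<Rightarrow> bool \<Rightarrow> nat list \<Rightarrow> real" where
  "objective c cyc q = path_cost c q + (if cyc then c {last q, hd q} else 0)"

context dp
begin

definition rows :: "nat \<Rightarrow> state \<Rightarrow> bool" where
  "rows k s \<longleftrightarrow> nmem s ''k'' 0 0 = k \<and> (\<forall>j<k. \<forall>u<n. nmem s ''T'' j u = (if u \<in> deletion_set n j then 1 else 0))"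

lemma runs_CHILD:
  assumes env: "env s" and Z: "n < Z" and R: "rows (Suc (r * n + v)) s" and r: "nmem s ''r'' 0 0 = r"
    and v: "nmem s ''v'' 0 0 = v" "v < n"
  shows "runs CHILD s (\<lambda>t s'. t \<le> 5 * Z \<and> rows (Suc (r * n + Suc v)) s')"
proof -
  let ?k = "Suc (r * n + v)"
  \<comment> \<open>The parent row lies before the row being written, so copying does not change
    it.\<close>
  have rk: "r < ?k" using n by (metis le_add1 le_imp_less_Suc le_trans mult.right_neutral mult_le_mono2)
  have k: "nmem s ''k'' 0 0 = ?k" and row: "\<And>j u. j < ?k \<Longrightarrow> u < n \<Longrightarrow> nmem s ''T'' j u = (if u \<in> deletion_set n j then 1 else 0)"
    using R by (auto simp: rows_def)
  have copy: "runs (FOR ''w'' (sc ''n'') (NAssign ''T'' (sc ''k'') (sc ''w'') (NCell ''T'' (sc ''r'') (sc ''w'')))) s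
     (\<lambda>t s'. t \<le> 3 * Z \<and> (\<forall>w<n. nmem s' ''T'' ?k w = nmem s ''T'' r w) \<and> (\<forall>j. j \<noteq> ?k \<longrightarrow> nmem s' ''T'' j = nmem s ''T'' j) \<and>
       frame {''w'', ''T''} {} s s')"
  proof (rule runs_FORn [OF env, where tb = 1 and I = "\<lambda>i s'. (\<forall>w<i. nmem s' ''T'' ?k w = nmem s ''T'' r w) \<and>
      (\<forall>j. j \<noteq> ?k \<longrightarrow> nmem s' ''T'' j = nmem s ''T'' j)"], goal_cases)
    case (4 i s')
    have f: "nmem s' ''k'' = nmem s ''k''" "nmem s' ''r'' = nmem s ''r''"
      using frameN [OF 4(5), of "''k''"] frameN [OF 4(5), of "''r''"] by simp_all
    have "nmem s' ''T'' r = nmem s ''T'' r" using 4(2) rk by auto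
    then show ?case using 4(2,3) k r by (auto simp: f less_Suc_eq fun_eq_iff)
  next
    case (5 t s')
    then show ?case using for_time0 [OF Z, of 1] by auto
  qed auto
  have kset: "deletion_set n ?k = insert v (deletion_set n r)" using deletion_set_step [OF v(2)] .
  show ?thesis unfolding CHILD_def runs_Seq
  proof (rule runs_mono [OF copy], goal_cases)
    case (1 t s')
    then have t: "t \<le> 3 * Z" and a: "\<And>w. w < n \<Longrightarrow> nmem s' ''T'' ?k w = nmem s ''T'' r w"
      and b: "\<And>j. j \<noteq> ?k \<Longrightarrow> nmem s' ''T'' j = nmem s ''T'' j" and fr: "frame {''w'', ''T''} {} s s'" by auto
    have f: "nmem s' ''k'' = nmem s ''k''" "nmem s' ''v'' = nmem s ''v''"
      using frameN [OF fr, of "''k''"] frameN [OF fr, of "''v''"] by simp_all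
    have nr: "nmem s' ''T'' j u = (if u \<in> deletion_set n j then 1 else 0)" if "j < ?k" "u < n" for j u
      using row [OF that] b [of j] that by simp
    have nk: "nmem s' ''T'' ?k u = (if u \<in> deletion_set n r then 1 else 0)" if "u < n" for u
      using a [OF that] row [OF rk that] by simp
    let ?s = "s'\<lparr>nmem := upd_cell (upd_cell (nmem s') ''T'' ?k v (Suc 0)) ''k'' 0 0 (Suc ?k)\<rparr>"
    have "rows (Suc ?k) ?s" unfolding rows_def
    proof (intro conjI allI impI)
      fix j u assume ju: "j < Suc ?k" "u < n"
      show "nmem ?s ''T'' j u = (if u \<in> deletion_set n j then 1 else 0)"
      proof (cases "j = ?k")
        case True
        show ?thesis unfolding True kset using nk [OF ju(2)] by (simp del: deletion_set.simps)
      next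
        case False
        then show ?thesis using nr [of j u] ju by simp
      qed
    qed simp
    then show ?case using t Z k v by (simp add: f del: deletion_set.simps)
  qed
qed

lemma runs_CHILDREN:
  assumes env: "env s" and Z: "n < Z" and R: "rows (Suc (r * n)) s" and r: "nmem s ''r'' 0 0 = r"
  shows "runs CHILDREN s (\<lambda>t s'. t \<le> 5 * Z ^ 2 \<and> rows (Suc (Suc r * n)) s')"
proof -
  have cong: "rows k (s'\<lparr>nmem := upd_cell (nmem s') ''v'' 0 0 v\<rparr>) = rows k s'" for k s' v
    by (simp add: rows_def)
  show ?thesis unfolding CHILDREN_def
  proof (rule runs_FORn [OF env, where tb = "5 * Z" and I = "\<lambda>v s'. rows (Suc (r * n + v)) s'"], goal_cases)
    case 3
    then show ?case unfolding cong using R by simp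
  next
    case (4 v s')
    have r': "nmem s' ''r'' 0 0 = r" using frameN [OF 4(5), of "''r''"] r by simp
    show ?case
    proof (rule runs_mono [OF runs_frame [OF runs_CHILD [OF 4(4) Z 4(2) r' 4(3,1)]]], goal_cases)
      case (1 t s'')
      then have t: "t \<le> 5 * Z" "rows (Suc (r * n + Suc v)) s''" and f: "frame (nw CHILD) (rw CHILD) s' s''" by auto
      have "nmem s'' ''v'' = nmem s' ''v''" by (rule frameN [OF f]) simp
      then show ?case unfolding cong using t 4(3) by simp
    qed
  next
    case (5 t s')
    then show ?case using for_time [of "5 * Z" 5 Z 1 n] Z by (simp add: eval_nat_numeral add.commute)
  qed auto
qed

lemma runs_FINAL:
  assumes env: "env s" and Z: "n < Z" "length ps < Z" and rep: "rep s ps" and partial_path: "\<And>j. j < length ps \<Longrightarrow> partial_path (ps ! j)"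
    and found: "nmem s ''found'' 0 0 = 0"
  shows "runs (FINAL cyc) s (\<lambda>t s'. t \<le> 9 * Z ^ 2 \<and>
     (if \<exists>j<length ps. feasible n E cyc (ps ! j)
      then nmem s' ''found'' 0 0 = 1 \<and> (\<exists>j<length ps. feasible n E cyc (ps ! j) \<and>
        (\<forall>w<n. nmem s' ''path'' 0 w = ps ! j ! w) \<and>
        (\<forall>j'<length ps. feasible n E cyc (ps ! j') \<longrightarrow> objective c cyc (ps ! j) \<le> objective c cyc (ps ! j')))
      else nmem s' ''found'' 0 0 = 0))"
proof -
  define best where "best k j s' \<longleftrightarrow> j < k \<and> feasible n E cyc (ps ! j) \<and>
     rmem s' ''B'' 0 0 = objective c cyc (ps ! j) \<and> (\<forall>w<n. nmem s' ''path'' 0 w = ps ! j ! w) \<and>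
     (\<forall>j'<k. feasible n E cyc (ps ! j') \<longrightarrow> objective c cyc (ps ! j) \<le> objective c cyc (ps ! j'))" for k j and s' :: state
  define J where "J k s' \<longleftrightarrow> nmem s' ''found'' 0 0 = 0 \<and> (\<forall>j<k. \<not> feasible n E cyc (ps ! j)) \<or>
     nmem s' ''found'' 0 0 = 1 \<and> (\<exists>j. best k j s')" for k and s' :: state
  have Jcong: "J k (s'\<lparr>nmem := upd_cell (nmem s') ''j'' 0 0 v\<rparr>) = J k s'" for k s' v
    by (simp add: J_def best_def)
  show ?thesis unfolding FINAL_def
  proof (rule runs_FOR [where N = "length ps" and tb = "9 * Z" and I = J], goal_cases)
    case (1 s')
    then show ?case using rep by (simp add: frameN rep_def)
  next
    case 2
    then show ?case using found by (simp add: J_def)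
  next
    case (3 j s')
    have e: "env s'" by (rule env_frame [OF env 3(4)]) auto
    have r: "rep s' ps" by (rule rep_frame [OF rep 3(4)]) auto
    have nd: "node s' j (ps ! j)" using r 3(1) by (simp add: rep_def)
    have pj: "ps ! j \<noteq> []" using partial_path [OF 3(1)] by (simp add: partial_path_def)
    have lst: "nmem s' ''P'' j (nmem s' ''L'' 0 j - Suc 0) = last (ps ! j)" using node_last [OF nd pj] .
    have fst: "nmem s' ''P'' j 0 = hd (ps ! j)" using nd pj by (simp add: node_def hd_conv_nth)
    have LC: "nmem s' ''L'' 0 j = length (ps ! j)" "rmem s' ''C'' 0 j = path_cost c (ps ! j)" using nd by (simp_all add: node_def)
    have F: "bval (FEASIBLE cyc) s' \<longleftrightarrow> feasible n E cyc (ps ! j)"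
      using 3(3) lst fst LC envD(1) [OF e] envD(2) [OF e, of "last (ps ! j)" "hd (ps ! j)"]
      by (simp add: FEASIBLE_def feasible_def)
    show ?case
    proof (cases "feasible n E cyc (ps ! j)")
      case False
      then have "J (Suc j) s'" using 3(2) unfolding J_def best_def by (auto simp: less_Suc_eq)
      then show ?thesis unfolding FINAL1_def runs_Cond F using False 3(3) Z by (simp add: Jcong)
    next
      case True
      have O: "rval (OBJECTIVE cyc) s' = objective c cyc (ps ! j)"
        using True 3(3) lst fst LC envD(4) [OF e, of "last (ps ! j)" "hd (ps ! j)"]
        by (simp add: OBJECTIVE_def objective_def feasible_def)
      let ?s = "s'\<lparr>rmem := upd_cell (rmem s') ''Z'' 0 0 (objective c cyc (ps ! j))\<rparr>"
      have "runs IMPROVE ?s (\<lambda>t s''. 1 + (1 + t) \<le> 9 * Z \<and> nmem s'' ''j'' 0 0 = j \<and> J (Suc j) s'')"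
      proof (cases "nmem s' ''found'' 0 0 = 1 \<and> \<not> objective c cyc (ps ! j) < rmem s' ''B'' 0 0")
        case skip: True
        then obtain j' where "best j j' s'" using 3(2) by (auto simp: J_def)
        then have "best (Suc j) j' ?s" using skip by (auto simp: best_def less_Suc_eq)
        then have "J (Suc j) ?s" using skip by (auto simp: J_def)
        then show ?thesis unfolding IMPROVE_def using skip Z 3(3) by simp
      next
        case new: False
        let ?t = "?s\<lparr>nmem := upd_cell (nmem s') ''found'' 0 0 (Suc 0), rmem := upd_cell (rmem ?s) ''B'' 0 0 (objective c cyc (ps ! j))\<rparr>"
        have ft: "frame {''found''} {''Z'', ''B''} s' ?t" by (auto simp: frame_def)
        have et: "env ?t" by (rule env_frame [OF e ft]) auto
        have P: "nmem s' ''P'' j w = ps ! j ! w" if "w < n" for w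
          using nd that True by (simp add: node_def feasible_def)
        have copy: "runs COPY ?t (\<lambda>t s''. t \<le> 3 * Z \<and> (\<forall>w<n. nmem s'' ''path'' 0 w = ps ! j ! w) \<and>
            frame {''w'', ''path''} {} ?t s'')"
          unfolding COPY_def
        proof (rule runs_FORn [OF et, where tb = 1 and I = "\<lambda>k s''. \<forall>w<k. nmem s'' ''path'' 0 w = ps ! j ! w"], goal_cases)
          case (4 k s'')
          have "nmem s'' ''j'' = nmem s' ''j''" "nmem s'' ''P'' = nmem s' ''P''"
            using frameN [OF 4(5), of "''j''"] frameN [OF 4(5), of "''P''"] by simp_all
          then show ?case using 4(1-3) P 3(3) by (auto simp: less_Suc_eq)
        next
          case (5 t s'')
          then show ?case using for_time0 [OF Z(1), of 1] by auto
        qed auto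
        have "runs COPY ?t (\<lambda>t s''. 1 + (1 + (1 + (1 + (1 + t)))) \<le> 9 * Z \<and> nmem s'' ''j'' 0 0 = j \<and> J (Suc j) s'')"
        proof (rule runs_mono [OF copy], goal_cases)
          case (1 t s'')
          then have t: "t \<le> 3 * Z" and a: "\<And>w. w < n \<Longrightarrow> nmem s'' ''path'' 0 w = ps ! j ! w"
            and fr: "frame {''w'', ''path''} {} ?t s''" by auto
          have f: "nmem s'' ''found'' 0 0 = 1" "nmem s'' ''j'' 0 0 = j" "rmem s'' ''B'' 0 0 = objective c cyc (ps ! j)"
            using frameN [OF fr, of "''found''"] frameN [OF fr, of "''j''"] frameR [OF fr, of "''B''"] 3(3) by simp_all
          have "objective c cyc (ps ! j) \<le> objective c cyc (ps ! j')" if "j' < j" "feasible n E cyc (ps ! j')" for j'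
          proof -
            have "nmem s' ''found'' 0 0 = 1" using 3(2) that unfolding J_def by blast
            then obtain j'' where "best j j'' s'" using 3(2) unfolding J_def by auto
            then have "rmem s' ''B'' 0 0 \<le> objective c cyc (ps ! j')" using that by (simp add: best_def)
            then show ?thesis using new \<open>nmem s' ''found'' 0 0 = 1\<close> by simp
          qed
          then have "best (Suc j) j s''" using True a f by (auto simp: best_def less_Suc_eq)
          then have "J (Suc j) s''" using f by (auto simp: J_def)
          then show ?case using t f Z by simp
        qed
        then show ?thesis unfolding IMPROVE_def using new by auto
      qed
      then have "runs IMPROVE ?s (\<lambda>t s''. 1 + (1 + t) \<le> 9 * Z \<and> nmem s'' ''j'' 0 0 = j \<and>
         J (Suc j) (s''\<lparr>nmem := upd_cell (nmem s'') ''j'' 0 0 (Suc j)\<rparr>))" unfolding Jcong .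
      then show ?thesis unfolding FINAL1_def runs_Cond F using True by (simp add: O)
    qed
  next
    case (4 t s')
    have "t \<le> 9 * Z ^ 2" using 4(2) for_time [of "9 * Z" 9 Z 1 "length ps"] Z by (simp add: eval_nat_numeral)
    then show ?case using 4(1) unfolding J_def best_def by auto
  qed
qed

end

section \<open>The complete algorithm\<close>

lemma runs_POWERS:
  assumes nn: "nmem s ''n'' 0 0 = n" and Z: "n < Z"
  shows "runs POWERS s (\<lambda>t s'. t \<le> 7 * Z \<and> (\<forall>t<2 * n. nmem s' ''W'' 0 t = 2 ^ t))"
proof -
  let ?s = "s\<lparr>nmem := upd_cell (nmem s) ''W'' 0 0 (Suc 0)\<rparr>"
  have "runs (FOR ''t'' (NAdd (sc ''n'') (sc ''n'')) POWERS1) ?s (\<lambda>t s'. 1 + t \<le> 7 * Z \<and> (\<forall>t<2 * n. nmem s' ''W'' 0 t = 2 ^ t))"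
  proof (rule runs_FOR [where N = "2 * n" and tb = 1 and I = "\<lambda>k s'. \<forall>t\<le>k. nmem s' ''W'' 0 t = 2 ^ t"], goal_cases)
    case (1 s')
    then show ?case using nn frameN [OF 1, of "''n''"] by simp
  next
    case (3 k s')
    then show ?case by (simp add: POWERS1_def le_Suc_eq)
  next
    case (4 t s')
    then show ?case using Z by auto
  qed simp
  then show ?thesis by (simp add: POWERS_def)
qed

lemma nw_ROUND [simp]:
  "nw ROUND = {''a'', ''b'', ''D'', ''q'', ''t'', ''g'', ''w'', ''h'', ''P'', ''M'', ''L'', ''K'', ''l'', ''z'', ''x'', ''j'',
     ''y'', ''u'', ''i'', ''f'', ''v'', ''T'', ''k'', ''d'', ''r''}" "rw ROUND = {''C'', ''Z''}"
  by (auto simp: ROUND_def)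

definition solution :: "nat \<Rightarrow> nat set set \<Rightarrow> (nat \<times> nat) set \<Rightarrow> bool \<Rightarrow> nat list \<Rightarrow> bool" where
  "solution n E \<pi> cyc = (if cyc then POHC {0..<n} E \<pi> else POHP {0..<n} E \<pi>)"

lemma objective_cases: "objective c True = cycle_cost c" "objective c False = path_cost c"
  by (auto simp: objective_def cycle_cost_def fun_eq_iff)

context dp
begin

text \<open>An upper bound for the number of states: singletons, and extensions by \<open>u\<close> of an expanded set for
  paths that start in \<open>f\<close>.\<close>

definition states :: nat where
  "states = n + n * n * card {X. X \<subseteq> V \<and> few_comps (card T + 1) E (X - T) \<and> few_comps (card T + 1) E (V - X - T)}"

lemma solution_iff: "solution n E \<pi> cyc q \<longleftrightarrow> partial_path q \<and> feasible n E cyc q"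
  using POHP_iff [of q] by (auto simp: solution_def POHC_def feasible_def insert_commute)

text \<open>The state with the key of \<open>vs\<close> has the same length and the same ends. It is
  feasible for the same reason as \<open>vs\<close> and pays the same closing edge.\<close>

lemma inv_solution:
  assumes I: "search_inv (length ps) 0 ps" and vs: "solution n E \<pi> cyc vs"
  shows "\<exists>j<length ps. feasible n E cyc (ps ! j) \<and> objective c cyc (ps ! j) \<le> objective c cyc vs"
proof -
  have v: "partial_path vs" "feasible n E cyc vs" using vs by (simp_all add: solution_iff)
  then have p: "POHP V E \<pi> vs" "length vs = n" by (auto simp: POHP_iff feasible_def)
  obtain j where j: "j < length ps" "key (ps ! j) = key vs" "path_cost c (ps ! j) \<le> path_cost c vs"
    using inv_optimal [OF I p(1), of n] p(2) n by auto
  have "partial_path (ps ! j)" using I j(1) by (simp add: search_inv_def)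
  then have "length (ps ! j) = length vs" using pre_length v(1) j(2) by (simp add: key_def)
  then show ?thesis using j v(2) by (intro exI [of _ j]) (auto simp: feasible_def objective_def key_def)
qed

lemma rows_frame:
  assumes "rows k s" "frame A B s s'" "''T'' \<notin> A" "''k'' \<notin> A"
  shows "rows k s'"
  using assms by (simp add: rows_def frameN [OF assms(2)])

text \<open>A round that gives up holds more than \<open>r\<close> states, all of which are counted
  by \<open>states\<close>. Conversely, a round whose number is at least \<open>states\<close> must
  finish.\<close>

lemma runs_ROUND:
  assumes env: "env s" and Z: "r + n + n < Z" and R: "rows (Suc (r * n)) s" and r: "nmem s ''r'' 0 0 = r"
    and T': "T = deletion_set n r" and d: "nmem s ''d'' 0 0 = 0"
  shows "runs ROUND s (\<lambda>t s'. t \<le> 67 * Z ^ 5 \<and> env s' \<and> rows (Suc (Suc r * n)) s' \<and> nmem s' ''r'' 0 0 = Suc r \<and>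
     (nmem s' ''d'' 0 0 = 1 \<and> (\<exists>ps. rep s' ps \<and> search_inv (length ps) 0 ps \<and> length ps \<le> r + n) \<or>
      nmem s' ''d'' 0 0 = 0 \<and> r < states))"
proof -
  have Zn: "n < Z" using Z by simp
  have Z5: "1 \<le> Z ^ 5" "Z ^ 2 \<le> Z ^ 5" using Zn power_increasing [of 2 5 Z] by auto
  show ?thesis unfolding ROUND_def runs_Seq
  proof (rule runs_mono [OF runs_frame [OF runs_CHILDREN [OF env Zn R r]]], goal_cases)
    case (1 t1 s1)
    then have t1: "t1 \<le> 5 * Z ^ 2" and R1: "rows (Suc (Suc r * n)) s1" and f1: "frame (nw CHILDREN) (rw CHILDREN) s s1" by auto
    have e1: "env s1" by (rule env_frame [OF env f1]) auto
    have rd1: "nmem s1 ''r'' 0 0 = r" "nmem s1 ''d'' 0 0 = 0"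
      using frameN [OF f1, of "''r''"] frameN [OF f1, of "''d''"] r d by simp_all
    show ?case
    proof (rule runs_mono [OF runs_frame [OF runs_START [OF e1 Zn]]], goal_cases)
      case (1 t2 s2)
      then have t2: "t2 \<le> 12 * Z ^ 2" and rep2: "rep s2 (map (\<lambda>f. [f]) [0..<n])" and i2: "nmem s2 ''i'' 0 0 = 0"
        and f2: "frame (nw START) (rw START) s1 s2" by auto
      have e2: "env s2" by (rule env_frame [OF e1 f2]) auto
      have R2: "rows (Suc (Suc r * n)) s2" by (rule rows_frame [OF R1 f2]) auto
      have rd2: "nmem s2 ''r'' 0 0 = r" "nmem s2 ''d'' 0 0 = 0"
        using frameN [OF f2, of "''r''"] frameN [OF f2, of "''d''"] rd1 by simp_all
      have "r * 1 \<le> r * n" using n by (intro mult_le_mono2) simp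
      \<comment> \<open>The row of the current deletion set was completed in an earlier round, or is
        the initial row 0.\<close>
      then have rlt: "r < Suc (Suc r * n)" unfolding mult_Suc by linarith
      have "nmem s2 ''T'' r a = (if a \<in> T then 1 else 0)" if "a < n" for a
        using R2 rlt that unfolding rows_def T' by (elim conjE allE impE) auto
      then have tr: "deletion_row s2" by (simp add: deletion_row_def rd2(1))
      show ?case
      proof (rule runs_mono [OF runs_frame [OF runs_QUEUE [OF e2 tr Z rep2 inv_init i2 rd2(1)]]], goal_cases)
        case (2 t3 s3)
        then obtain ps i where t3: "t3 \<le> 47 * Z ^ 5" and p: "rep s3 ps" "search_inv i 0 ps" "nmem s3 ''i'' 0 0 = i" "i \<le> length ps"
            "length ps \<le> r + n" "i < length ps \<longrightarrow> r < length ps"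
          and f3: "frame (nw QUEUE) (rw QUEUE) s2 s3" by blast
        have e3: "env s3" by (rule env_frame [OF e2 f3]) auto
        have R3: "rows (Suc (Suc r * n)) s3" by (rule rows_frame [OF R2 f3]) auto
        have rd3: "nmem s3 ''r'' 0 0 = r" "nmem s3 ''d'' 0 0 = 0"
          using frameN [OF f3, of "''r''"] frameN [OF f3, of "''d''"] rd2 by simp_all
        have l3: "nmem s3 ''l'' 0 0 = length ps" using p(1) by (simp add: rep_def)
        have st: "env s' \<and> rows (Suc (Suc r * n)) s' \<and> rep s' ps" if "frame {''d'', ''r''} {} s3 s'" for s'
          using env_frame [OF e3 that] rows_frame [OF R3 that] rep_frame [OF p(1) that] by simp
        show ?case
        proof (cases "i < length ps")
          case True
          let ?s = "s3\<lparr>nmem := upd_cell (nmem s3) ''r'' 0 0 (Suc r)\<rparr>"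
          have "length ps \<le> states" using inv_length [OF p(2)] by (simp add: states_def)
          then have "r < states" using True p(6) by simp
          moreover have "env ?s \<and> rows (Suc (Suc r * n)) ?s \<and> rep ?s ps" by (rule st) (auto simp: frame_def)
          ultimately show ?thesis using True p(3) l3 rd3 t1 t2 t3 Z5 by simp
        next
          case False
          let ?s = "s3\<lparr>nmem := upd_cell (upd_cell (nmem s3) ''d'' 0 0 (Suc 0)) ''r'' 0 0 (Suc r)\<rparr>"
          have i: "i = length ps" using False p(4) by simp
          have "env ?s \<and> rows (Suc (Suc r * n)) ?s \<and> rep ?s ps" by (rule st) (auto simp: frame_def)
          then show ?thesis using False i p(2,3,5) l3 rd3 t1 t2 t3 Z5 by auto
        qed
      qed simp
    qed
  qed
qed

end

text \<open>Each round uses \<open>dp\<close> with another deletion set, so the loop over the rounds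
  is treated outside of that locale.\<close>

locale instance_data =
  fixes n :: nat and E :: "nat set set" and \<pi> :: "(nat \<times> nat) set" and c :: "nat set \<Rightarrow> real"
  assumes n: "n \<ge> 1" and sg: "sgraph {0..<n} E" and po: "partial_order_on {0..<n} \<pi>"
begin

lemma dp: "dp n E \<pi> (deletion_set n r)"
  using n sg po deletion_set_subset [OF n] by unfold_locales

text \<open>Round \<open>r0\<close> is guaranteed to finish, though an earlier one may do so. Hence
  there are at most \<open>r0 + 1\<close> rounds, and one \<open>Z\<close> bounds the sizes in all
  of them.\<close>

lemma runs_SOLVE:
  assumes r0: "dp.states n E (deletion_set n r0) \<le> r0" and Z: "Z = r0 + n + n + 1"
  shows "runs (SOLVE cyc) (input_state n E \<pi> c) (\<lambda>t s. t \<le> 90 * Z ^ 6 \<and>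
     correct_output n (solution n E \<pi> cyc) (objective c cyc) s)"
proof -
  let ?env = "dp.env n E \<pi> c" and ?rows = "dp.rows n" and ?rep = "dp.rep n c"
  let ?s = "input_state n E \<pi> c"
  have Zn: "n < Z" using Z by simp
  \<comment> \<open>The round that ended the loop is quantified away, since its deletion set is
    irrelevant for optimality.\<close>
  define result where "result s \<longleftrightarrow> (\<exists>r ps. ?rep s ps \<and> dp.search_inv n E \<pi> c (deletion_set n r) (length ps) 0 ps \<and>
     length ps \<le> r0 + n)" for s
  define J where "J k s \<longleftrightarrow> ?env s \<and> ?rows (Suc (nmem s ''r'' 0 0 * n)) s \<and> nmem s ''found'' 0 0 = 0 \<and>
     k + nmem s ''r'' 0 0 = Suc r0 \<and>
     (nmem s ''d'' 0 0 = 0 \<and> nmem s ''r'' 0 0 \<le> r0 \<or> nmem s ''d'' 0 0 = 1 \<and> result s)" for k s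
  have loop: "runs (While (NEq (sc ''d'') (NConst 0)) ROUND) s
     (\<lambda>t s'. t \<le> Suc r0 * (67 * Z ^ 5 + 1) + 1 \<and> (\<exists>k. J k s') \<and> \<not> bval (NEq (sc ''d'') (NConst 0)) s')"
    if "J (Suc r0) s" for s using that
  proof (rule runs_While)
    fix k s assume J: "J k s" and b: "bval (NEq (sc ''d'') (NConst 0)) s"
    let ?r = "nmem s ''r'' 0 0"
    have d: "nmem s ''d'' 0 0 = 0" using b by simp
    have e: "?env s" and R: "?rows (Suc (?r * n)) s" and rr: "?r \<le> r0" "k + ?r = Suc r0" and fd: "nmem s ''found'' 0 0 = 0"
      using J d by (auto simp: J_def)
    then obtain k' where k': "k = Suc k'" by (cases k) auto
    have Zr: "?r + n + n < Z" using rr(1) Z by simp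
    have "runs ROUND s (\<lambda>t s'. t \<le> 67 * Z ^ 5 \<and> J k' s')"
    proof (rule runs_mono [OF runs_frame [OF dp.runs_ROUND [OF dp e Zr R refl refl d]]], goal_cases)
      case (1 t s')
      then have t: "t \<le> 67 * Z ^ 5" and e': "?env s'" and R': "?rows (Suc (Suc ?r * n)) s'" and r': "nmem s' ''r'' 0 0 = Suc ?r"
        and or: "nmem s' ''d'' 0 0 = 1 \<and> (\<exists>ps. ?rep s' ps \<and> dp.search_inv n E \<pi> c (deletion_set n ?r) (length ps) 0 ps \<and> length ps \<le> ?r + n) \<or>
           nmem s' ''d'' 0 0 = 0 \<and> ?r < dp.states n E (deletion_set n ?r)"
        and f: "frame (nw ROUND) (rw ROUND) s s'" by blast+
      have fd': "nmem s' ''found'' 0 0 = 0" using frameN [OF f, of "''found''"] fd by simp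
      have "nmem s' ''d'' 0 0 = 0 \<and> Suc ?r \<le> r0 \<or> nmem s' ''d'' 0 0 = 1 \<and> result s'"
        using or
      proof (elim disjE conjE exE)
        fix ps assume "nmem s' ''d'' 0 0 = 1" "?rep s' ps" "dp.search_inv n E \<pi> c (deletion_set n ?r) (length ps) 0 ps" "length ps \<le> ?r + n"
        then show ?thesis using rr(1) unfolding result_def
          by (intro disjI2 conjI exI [of _ ?r] exI [of _ ps]) auto
      next
        assume "nmem s' ''d'' 0 0 = 0" "?r < dp.states n E (deletion_set n ?r)"
        moreover have "?r \<noteq> r0" using calculation(2) r0 by auto
        ultimately show ?thesis using rr(1) by simp
      qed
      then show ?case using t e' R' r' fd' rr(2) k' by (simp add: J_def)
    qed
    then show "\<exists>k'. k = Suc k' \<and> runs ROUND s (\<lambda>t s'. t \<le> 67 * Z ^ 5 \<and> J k' s')" using k' by blast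
  qed
  have fin: "runs (FINAL cyc) s (\<lambda>t s'. t \<le> 9 * Z ^ 2 \<and> correct_output n (solution n E \<pi> cyc) (objective c cyc) s')"
    if J: "J k s" and nb: "\<not> bval (NEq (sc ''d'') (NConst 0)) s" for k s
  proof -
    have e: "?env s" and fd: "nmem s ''found'' 0 0 = 0" and "result s" using J nb by (auto simp: J_def)
    then obtain r ps where rep: "?rep s ps" and I: "dp.search_inv n E \<pi> c (deletion_set n r) (length ps) 0 ps" and len: "length ps \<le> r0 + n"
      by (auto simp: result_def)
    interpret dp n E \<pi> c "deletion_set n r" by (rule dp)
    have partial_path: "partial_path (ps ! j)" if "j < length ps" for j using I that by (simp add: search_inv_def)
    have Zl: "length ps < Z" using len Z by simp
    show ?thesis
    proof (rule runs_mono [OF runs_FINAL [OF e Zn Zl rep partial_path fd, of cyc]], goal_cases)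
      case (2 t s')
      then have t: "t \<le> 9 * Z ^ 2" and res: "if \<exists>j<length ps. feasible n E cyc (ps ! j)
      then nmem s' ''found'' 0 0 = 1 \<and> (\<exists>j<length ps. feasible n E cyc (ps ! j) \<and>
        (\<forall>w<n. nmem s' ''path'' 0 w = ps ! j ! w) \<and>
        (\<forall>j'<length ps. feasible n E cyc (ps ! j') \<longrightarrow> objective c cyc (ps ! j) \<le> objective c cyc (ps ! j')))
      else nmem s' ''found'' 0 0 = 0" by auto
      have "correct_output n (solution n E \<pi> cyc) (objective c cyc) s'"
      proof (cases "\<exists>j<length ps. feasible n E cyc (ps ! j)")
        case True
        then obtain j where j: "nmem s' ''found'' 0 0 = 1" "j < length ps" "feasible n E cyc (ps ! j)"
          "\<And>w. w < n \<Longrightarrow> nmem s' ''path'' 0 w = ps ! j ! w"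
          "\<And>j'. j' < length ps \<Longrightarrow> feasible n E cyc (ps ! j') \<Longrightarrow> objective c cyc (ps ! j) \<le> objective c cyc (ps ! j')"
          using res by auto
        have "length (ps ! j) = n" using j(3) by (simp add: feasible_def)
        then have path: "map (\<lambda>i. nmem s' ''path'' 0 i) [0..<n] = ps ! j" using j(4) by (intro nth_equalityI) auto
        have sol: "solution n E \<pi> cyc (ps ! j)" using partial_path [OF j(2)] j(3) by (simp add: solution_iff)
        have "objective c cyc (ps ! j) \<le> objective c cyc vs" if "solution n E \<pi> cyc vs" for vs
          using inv_solution [OF I that] j(5) by fastforce
        then have "is_arg_min (objective c cyc) (solution n E \<pi> cyc) (ps ! j)"
          using sol by (auto simp: is_arg_min_def not_less)
        then show ?thesis unfolding correct_output_def path using j(1) sol by auto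
      next
        case False
        then have "\<nexists>vs. solution n E \<pi> cyc vs" using inv_solution [OF I] by blast
        then show ?thesis unfolding correct_output_def using res False by simp
      qed
      then show ?case using t by blast
    qed
  qed
  have nn: "nmem ?s ''n'' 0 0 = n" by (simp add: input_state_def)
  have Zp: "1 \<le> Z ^ 6" "Z \<le> Z ^ 6" "Z ^ 2 \<le> Z ^ 6" using Zn power_increasing [of 2 6 Z] self_le_power [of Z 6] by auto
  have "Suc r0 * (67 * Z ^ 5 + 1) \<le> Z * (67 * Z ^ 5 + 1)" using Z by (intro mult_le_mono1) simp
  also have "\<dots> = 67 * Z ^ 6 + Z"
  proof -
    have "Z ^ 6 = Z * Z ^ 5" by (simp add: eval_nat_numeral)
    then show ?thesis by (simp add: algebra_simps)
  qed
  finally have tl: "Suc r0 * (67 * Z ^ 5 + 1) \<le> 68 * Z ^ 6" using Zp(2) by linarith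
  show ?thesis unfolding SOLVE_def runs_Seq
  proof (rule runs_mono [OF runs_frame [OF runs_POWERS [OF nn Zn]]], goal_cases)
    case (1 t1 s1)
    then have t1: "t1 \<le> 7 * Z" and W: "\<forall>t<2 * n. nmem s1 ''W'' 0 t = 2 ^ t" and f: "frame (nw POWERS) (rw POWERS) ?s s1" by auto
    let ?s1 = "s1\<lparr>nmem := upd_cell (nmem s1) ''k'' 0 0 1\<rparr>"
    have m: "nmem s1 x = nmem ?s x" if "x \<noteq> ''W''" "x \<noteq> ''t''" for x using frameN [OF f, of x] that by simp
    have rm: "rmem s1 = rmem ?s" using frameR [OF f] by (auto simp: fun_eq_iff)
    interpret dp n E \<pi> c "deletion_set n 0" by (rule dp)
    \<comment> \<open>Cells that are not part of the input are 0 at the start: row 0 of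
      \<open>T\<close> is the empty set, and \<open>r\<close>, \<open>d\<close> and
      \<open>found\<close> begin with 0.\<close>
    have "env ?s1" using W unfolding env_def by (simp add: m rm) (simp add: input_state_def)
    moreover have "rows (Suc 0) ?s1" unfolding rows_def by (simp add: m) (simp add: input_state_def)
    ultimately have J: "J (Suc r0) ?s1" unfolding J_def by (simp add: m) (simp add: input_state_def)
    have "runs (While (NEq (sc ''d'') (NConst 0)) ROUND) ?s1
       (\<lambda>t2 s2. runs (FINAL cyc) s2 (\<lambda>t3 s'. t1 + (1 + (t2 + t3)) \<le> 90 * Z ^ 6 \<and>
          correct_output n (solution n E \<pi> cyc) (objective c cyc) s'))"
    proof (rule runs_mono [OF loop [OF J]], goal_cases)
      case (1 t2 s2)
      then obtain k where J2: "J k s2" and t2: "t2 \<le> Suc r0 * (67 * Z ^ 5 + 1) + 1"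
        and nb: "\<not> bval (NEq (sc ''d'') (NConst 0)) s2" by blast
      have "t2 \<le> 68 * Z ^ 6 + 1" using t2 tl by linarith
      then show ?case using t1 Zp by (intro runs_mono [OF fin [OF J2 nb]]) (elim conjE, intro conjI, linarith)
    qed
    then show ?case by simp
  qed
qed

end

text \<open>\<open>T\<close> may properly contain the deletion set \<open>S\<close>, as it does when
  \<open>S\<close> is empty and a singleton replaces it.\<close>

lemma dp_states_bound:
  assumes n: "n \<ge> 1" and sg: "sgraph {0..<n} E" and po: "partial_order_on {0..<n} \<pi>"
    and S: "S \<subseteq> {0..<n}" "outerplanar ({0..<n} - S) {e\<in>E. e \<inter> S = {}}"
    and ST: "S \<subseteq> T" "T \<subseteq> {0..<n}"
  shows "dp.states n E T \<le> (n + 1) ^ (5 * card T + 6)"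
proof -
  interpret dp n E \<pi> c T by unfold_locales (use n sg po ST in auto)
  let ?E = "{e \<in> E. e \<inter> S = {}}" and ?G = "{X. X \<subseteq> V \<and> few_comps (card T + 1) E (X - T) \<and> few_comps (card T + 1) E (V - X - T)}"
  have sg': "sgraph (V - S) ?E" using sg by (auto simp: sgraph_def)
  note fb = outerplanar_forbidden [OF S(2) sg']
  obtain vs where vs: "distinct vs" "set vs = V - T" "noncrossing ?E vs"
    using noncrossing_order [OF fb, of "V - T"] by auto
  \<comment> \<open>The order avoids \<open>T\<close> and hence \<open>S\<close>, so edges of
    \<open>E\<close> between its elements survive the deletion of \<open>S\<close>.\<close>
  have "noncrossing E vs" unfolding noncrossing_def
  proof (intro allI impI notI)
    fix a b x y assume s: "subseq [a, b, x, y] vs" and e: "{a, x} \<in> E \<and> {b, y} \<in> E"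
    have "w \<in> set vs" if "w \<in> set [a, b, x, y]" for w using list_emb_set [OF s that] by metis
    then have "{a, b, x, y} \<subseteq> set vs" by simp
    then have "{a, b, x, y} \<subseteq> V - T" using vs(2) by simp
    then have "a \<notin> S" "b \<notin> S" "x \<notin> S" "y \<notin> S" using ST(1) by auto
    then have "{a, x} \<in> ?E \<and> {b, y} \<in> ?E" using e by auto
    then show False using vs(3) [unfolded noncrossing_def, rule_format, OF s] by simp
  qed
  then have G: "card ?G \<le> (n + 1) ^ (4 * (card T + 1)) * 2 ^ card T"
    using few_comps_count(2) [OF _ ST(2) _ vs(1,2), of E "card T + 1"] n by simp
  let ?N = "n + 1"
  have "(2 :: nat) ^ card T \<le> ?N ^ card T" using n by (intro power_mono) auto
  then have "card ?G \<le> ?N ^ (4 * (card T + 1)) * ?N ^ card T" using G by (meson le_trans mult_le_mono2)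
  also have "\<dots> = ?N ^ (5 * card T + 4)" by (simp add: power_add [symmetric])
  finally have g: "card ?G \<le> ?N ^ (5 * card T + 4)" .
  \<comment> \<open>The exponent collects \<open>4 * (card T + 1)\<close> for the intervals and
    \<open>card T\<close> for the part inside \<open>T\<close>; the choice of last and first vertex
    will add 2.\<close>
  have "states \<le> n + n * n * ?N ^ (5 * card T + 4)" unfolding states_def using g by (intro add_left_mono mult_le_mono2)
  also have "\<dots> \<le> n * ?N ^ (5 * card T + 4) + n * n * ?N ^ (5 * card T + 4)" by simp
  also have "\<dots> = n * ?N * ?N ^ (5 * card T + 4)" by (simp add: algebra_simps)
  also have "\<dots> \<le> ?N * ?N * ?N ^ (5 * card T + 4)" by (intro mult_le_mono1) simp
  also have "\<dots> = ?N ^ (5 * card T + 6)"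
  proof -
    have "5 * card T + 6 = Suc (Suc (5 * card T + 4))" by simp
    then show ?thesis by (simp only: power_Suc mult.assoc)
  qed
  finally show ?thesis .
qed

lemma solve_correct:
  assumes n: "n \<ge> 1" and sg: "sgraph {0..<n} E" and po: "partial_order_on {0..<n} \<pi>"
    and C: "C = 90 * 2 ^ 84"
  shows "\<exists>t s. exec (SOLVE cyc) (input_state n E \<pi> c) t s \<and>
     t \<le> C * n ^ (C * max 1 (distance_to_outerplanar {0..<n} E)) \<and>
     correct_output n (solution n E \<pi> cyc) (objective c cyc) s"
proof -
  interpret instance_data n E \<pi> c using n sg po by unfold_locales
  let ?V = "{0..<n}" and ?N = "n + 1"
  obtain S where S: "S \<subseteq> ?V" "card S = distance_to_outerplanar ?V E" "outerplanar (?V - S) {e\<in>E. e \<inter> S = {}}"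
    using distance_to_outerplanar_attained [OF sg] by blast
  \<comment> \<open>Only index 0 yields the empty set, so it cannot be met again in a later round
    with a larger budget.\<close>
  define T where "T = (if S = {} then {0} else S)"
  define K where "K = max 1 (distance_to_outerplanar ?V E)"
  have finS: "finite S" using S(1) finite_subset by blast
  have T: "S \<subseteq> T" "T \<subseteq> ?V" "T \<noteq> {}" using S(1) n by (auto simp: T_def)
  have cT: "card T = K" using S(2) finS card_gt_0_iff [of S] by (auto simp: T_def K_def)
  have K1: "1 \<le> K" by (simp add: K_def)
  have bound: "dp.states n E T \<le> ?N ^ (5 * K + 6)"
    using dp_states_bound [OF n sg po S(1,3) T(1,2)] cT by simp
  \<comment> \<open>The bound on the states also exceeds the first index of \<open>T\<close>, as is
    required for a recurrence beyond it.\<close>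
  have "?N ^ card T \<le> ?N ^ (5 * K + 6)" using cT by (intro power_increasing) auto
  then obtain r0 where r0: "deletion_set n r0 = T" "?N ^ (5 * K + 6) \<le> r0" "r0 \<le> ?N * (?N ^ (5 * K + 6) + 1)"
    using deletion_set_unbounded [OF T(2,3)] by blast
  define Z where "Z = r0 + n + n + 1"
  have "dp.states n E (deletion_set n r0) \<le> r0" using bound r0(1,2) by simp
  then have "runs (SOLVE cyc) (input_state n E \<pi> c) (\<lambda>t s. t \<le> 90 * Z ^ 6 \<and>
     correct_output n (solution n E \<pi> cyc) (objective c cyc) s)" using Z_def by (rule runs_SOLVE)
  then obtain t s where ts: "exec (SOLVE cyc) (input_state n E \<pi> c) t s" "t \<le> 90 * Z ^ 6"
    "correct_output n (solution n E \<pi> cyc) (objective c cyc) s" by (auto simp: runs_def)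
  let ?B = "?N ^ (5 * K + 6)"
  have B1: "1 \<le> ?B" by simp
  have "Z \<le> ?N * (?B + 1) + 2 * ?N" using r0(3) by (simp add: Z_def)
  also have "\<dots> = ?N * (?B + 3)" by (simp add: algebra_simps)
  also have "\<dots> \<le> ?N * (4 * ?B)" using B1 by (intro mult_le_mono2) linarith
  \<comment> \<open>Since \<open>?N \<ge> 2\<close>, the constant 4 costs two more powers of
    \<open>?N\<close>.\<close>
  also have "\<dots> \<le> ?N * (?N ^ 2 * ?B)"
  proof (intro mult_le_mono2 mult_le_mono1)
    have "(2 :: nat) ^ 2 \<le> ?N ^ 2" using n by (intro power_mono) auto
    then show "4 \<le> ?N ^ 2" by simp
  qed
  also have "\<dots> = ?N ^ (5 * K + 9)"
  proof -
    have "5 * K + 9 = Suc (2 + (5 * K + 6))" by simp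
    then show ?thesis by (simp only: power_Suc power_add)
  qed
  finally have "Z ^ 6 \<le> (?N ^ (5 * K + 9)) ^ 6" by (rule power_mono) simp
  also have "\<dots> = ?N ^ ((5 * K + 9) * 6)" by (rule power_mult [symmetric])
  \<comment> \<open>From \<open>K \<ge> 1\<close> one gets \<open>5 * K + 9 \<le> 14 * K\<close>,
    and 84 is 14 times 6.\<close>
  also have "\<dots> \<le> ?N ^ (84 * K)" using K1 by (intro power_increasing) auto
  finally have t: "t \<le> 90 * ?N ^ (84 * K)" using ts(2) by (meson le_trans mult_le_mono2)
  have "90 * ?N ^ (84 * K) \<le> C * n ^ (C * K)"
  proof (cases "n = 1")
    \<comment> \<open>Powers of \<open>n\<close> are 1 here while those of \<open>n + 1\<close> are
      not. The constant has to absorb \<open>90 * 2 ^ 84\<close>, which is where \<open>C\<close>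
      comes from.\<close>
    case True
    have "card S \<le> 1" using card_mono [OF _ S(1)] True by simp
    then have "K = 1" using S(2) by (simp add: K_def)
    have N2: "?N = 2" using True by simp
    show ?thesis unfolding N2 C using True \<open>K = 1\<close> by simp
  next
    case False
    then have n2: "2 \<le> n" using n by simp
    have "?N \<le> 2 * n" using n by simp
    also have "\<dots> \<le> n ^ 2" using n2 by (simp add: power2_eq_square)
    \<comment> \<open>For \<open>n \<ge> 2\<close> the base \<open>n + 1\<close> is replaced by
      \<open>n ^ 2\<close>, which doubles the exponent to \<open>168 * K\<close>.\<close>
    finally have "?N ^ (84 * K) \<le> (n ^ 2) ^ (84 * K)" by (rule power_mono) simp
    also have "\<dots> = n ^ (168 * K)" by (simp add: power_mult [symmetric])
    also have "\<dots> \<le> n ^ (C * K)" using n by (intro power_increasing) (auto simp: C)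
    finally have "90 * ?N ^ (84 * K) \<le> 90 * n ^ (C * K)" by simp
    also have "\<dots> \<le> C * n ^ (C * K)" by (intro mult_le_mono1) (simp add: C)
    finally show ?thesis .
  qed
  then show ?thesis using ts t unfolding K_def by (meson le_trans)
qed

theorem theorem3p8:
  shows "(\<exists>prog C. \<forall>n E \<pi> c.
            n \<ge> 1 \<longrightarrow> sgraph {0..<n} E \<longrightarrow> partial_order_on {0..<n} \<pi> \<longrightarrow>
            (\<exists>t s. exec prog (input_state n E \<pi> c) t s \<and>
                   t \<le> C * n ^ (C * max 1 (distance_to_outerplanar {0..<n} E)) \<and>
                   correct_output n (POHP {0..<n} E \<pi>) (path_cost c) s)) \<and>
         (\<exists>prog C. \<forall>n E \<pi> c.
            n \<ge> 1 \<longrightarrow> sgraph {0..<n} E \<longrightarrow> partial_order_on {0..<n} \<pi> \<longrightarrow>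
            (\<exists>t s. exec prog (input_state n E \<pi> c) t s \<and>
                   t \<le> C * n ^ (C * max 1 (distance_to_outerplanar {0..<n} E)) \<and>
                   correct_output n (POHC {0..<n} E \<pi>) (cycle_cost c) s))"
proof -
  let ?C = "90 * 2 ^ 84 :: nat"
  have "\<exists>t s. exec (SOLVE False) (input_state n E \<pi> c) t s \<and>
      t \<le> ?C * n ^ (?C * max 1 (distance_to_outerplanar {0..<n} E)) \<and>
      correct_output n (POHP {0..<n} E \<pi>) (path_cost c) s"
    if "n \<ge> 1" "sgraph {0..<n} E" "partial_order_on {0..<n} \<pi>" for n E \<pi> c
    using solve_correct [OF that refl, of False c] unfolding objective_cases solution_def if_False .
  moreover have "\<exists>t s. exec (SOLVE True) (input_state n E \<pi> c) t s \<and>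
      t \<le> ?C * n ^ (?C * max 1 (distance_to_outerplanar {0..<n} E)) \<and>
      correct_output n (POHC {0..<n} E \<pi>) (cycle_cost c) s"
    if "n \<ge> 1" "sgraph {0..<n} E" "partial_order_on {0..<n} \<pi>" for n E \<pi> c
    using solve_correct [OF that refl, of True c] unfolding objective_cases solution_def if_True .
  ultimately show ?thesis by blast
qed

end
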